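(* The line bundle $\mathcal L_{\mathrm{Spin}(2n)}$ is isomorphic to the level $1$ Looijenga line bundle $\mathcal L_1$ on $\mathrm{Bun}_{\mathrm{Spin}(2n)}(\mathcal E)$. The pullback of $\mathcal L_{\mathrm U(n)}$ along the functor $\mathrm{Bun}_{\mathrm{SU}(n)}(\mathcal E)\to\mathrm{Bun}_{\mathrm U(n)}(\mathcal E)$ associated with the inclusion $\mathrm{SU}(n)\hookrightarrow\mathrm U(n)$ is isomorphic to the level $1$ Looijenga line bundle $\mathcal L_1$ on $\mathrm{Bun}_{\mathrm{SU}(n)}(\mathcal E)$. This identifies the sections $$\mathrm{Eu}_{\mathrm{SU}(n)}:=\beta^{-n}\cdot\sigma_{\mathrm U(n)}\in\Gamma(\mathrm{Bun}_{\mathrm{SU}(n)}(\mathcal E);\widehat{\mathrm{Ell}}{}^{2n}_{\mathrm{SU}(n)}(\mathrm{pt})\otimes\mathcal L_1),$$ $$\mathrm{Eu}_{\mathrm{Spin}(2n)}:=\beta^{-n}\cdot\sigma_{\mathrm{SO}(2n)}\in\Gamma(\mathrm{Bun}_{\mathrm{Spin}(2n)}(\mathcal E);\widehat{\mathrm{Ell}}{}^{2n}_{\mathrm{Spin}(2n)}(\mathrm{pt})\otimes\mathcal L_1)$$ with super characters of level $1$ vacuum representations of the loop groups $L\mathrm{SU}(n)$ and $L\mathrm{Spin}(2n)$, respectively.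
   Context: Let $G=\mathrm U(n)$, $\mathrm{SU}(n)$ or $\mathrm{Spin}(2n)$, with maximal torus $T$, Lie algebra $\mathfrak t$, cocharacter lattice $X_*(T)=\ker(\exp:\mathfrak t\to T)$ and Weyl group $W$. For $\mathrm U(n)$ and $\mathrm{Spin}(2n)$, $\mathfrak t\simeq\mathbb R^n$ is the Lie algebra of the standard maximal torus of $\mathrm U(n)$, resp. $\mathrm{SO}(2n)$, with complex coordinates $z_1,\dots,z_n$ on $\mathfrak t_{\mathbb C}$; $X_*(T)=\mathbb Z^n$ for $\mathrm U(n)$ and $\ker(\mathbb Z^n\xrightarrow{+}\mathbb Z/2)$ for $\mathrm{Spin}(2n)$; for $\mathrm{SU}(n)$ restrict to $\sum_jz_j=0$. Holomorphic functions in $\tau\in\mathbb H$ are required to have at most polynomial growth along geodesics escaping to $\partial\mathbb H$. $\mathrm{Bun}_G(\mathcal E)=[\mathbb H\times\mathcal C^2[G]/\mathrm{SL}_2(\mathbb Z)\times\pi_0(G)]$, where $\mathcal C^2[G]$ is the coarse quotient sheaf of pairs of commuting elements of $G$ by conjugation by the identity component. For these groups $\mathcal C^2[G]\simeq(T\times T)/^cW$, and via $\mathbb H\times\mathfrak t_{\mathbb C}\to\mathrm{Bun}_G(\mathcal E)$, $(\tau,X_1-\tau X_2)\mapsto(\tau,[e^{X_1},e^{X_2}])$, functions and sections of line bundles on $\mathrm{Bun}_G(\mathcal E)$ are described by $W$-invariant holomorphic functions on opens of $\mathbb H\times\mathfrak t_{\mathbb C}$ with transformation properties under $X_*(T)^{\oplus2}\rtimes\mathrm{SL}_2(\mathbb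 Z)$, acting by $z\mapsto z+m+n'\tau$ and $(\tau,z)\mapsto(\frac{a\tau+b}{c\tau+d},\frac z{c\tau+d})$. $\omega^{\otimes k}$ is the line bundle whose sections are multiplied by $(c\tau+d)^k$. Sections of $\widehat{\mathrm{Ell}}{}_G^{2n}(\mathrm{pt})$ (the sheaf of degree $2n$ equivariant elliptic cocycles of a point) are expressions $\beta^{-n}f$ with $f$ a holomorphic function on an open of $\mathrm{Bun}_G(\mathcal E)$ pulled back to the cover, $|\beta|=-2$, where $\mathrm{SL}_2(\mathbb Z)$ also acts by $\beta\mapsto\beta/(c\tau+d)$; thus $\widehat{\mathrm{Ell}}{}_G^{2n}(\mathrm{pt})\simeq\omega^{\otimes-n}$. **Looijenga line bundles.** For $\ell$ a $W$-invariant positive definite inner product on $\mathfrak t$ with $\ell(v,v)\in2\mathbb Z$ for $v\in X_*(T)$, the level $\ell$ Looijenga line bundle $\mathcal L_\ell$ has as sections the $W$-invariant holomorphic $f$ with $$f(\tau,z+m+n'\tau)=\exp(-\pi i(2\ell(n',z)+\ell(n',n')\tau))f(\tau,z),\quad f\Big(\gamma\cdot\tau,\frac z{c\tau+d}\Big)=\exp\Big(\frac{\pi ic\,\ell(z,z)}{c\tau+d}\Big)f(\tau,z)$$ for $m,n'\in X_*(T)$ and $\gamma=\begin{pmatrix}a&b\\c&d\end{pmatrix}\in\mathrm{SL}_2(\mathbb Z)$. Level $1$ means $\ell(z,w)=\sum_jz_jw_j$ in the coordinates above (restricted to $\sum z_j=0$ for $\mathrm{SU}(n)$); for $\mathrm{Spin}(2)$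 and $\mathrm{Spin}(4)$ it is the pullback of level $1$ along $\mathrm{Spin}(2)\subset\mathrm{Spin}(2N)$, $\mathrm{Spin}(4)\subset\mathrm{Spin}(2N)$, $N\ge3$. **The line bundles $\mathcal L_{\mathrm U(n)},\mathcal L_{\mathrm{Spin}(2n)}$.** With $q=e^{2\pi i\tau}$, $y=e^{2\pi iz}$, $y^{1/2}=e^{\pi iz}$, $$\sigma(\tau,z)=(y^{1/2}-y^{-1/2})\prod_{m>0}\frac{(1-q^my)(1-q^my^{-1})}{(1-q^m)^2},\quad\upsilon(\tau,z)=-y^{1/2}\sigma(\tau,z),\quad\sigma_{\mathrm{SO}(2n)}=\prod_{j=1}^n\sigma(\tau,z_j),\quad\sigma_{\mathrm U(n)}=\prod_{j=1}^n\upsilon(\tau,z_j).$$ For $G=\mathrm U(n)$ (resp. $\mathrm{Spin}(2n)$), $\mathcal A_G$ is the line bundle on $\mathrm{Bun}_G(\mathcal E)$ whose sections are $W$-invariant holomorphic functions transforming by the same cocycle as $\sigma_{\mathrm U(n)}$ (resp. $\sigma_{\mathrm{SO}(2n)}$), and $\mathcal L_G=\mathcal A_G\otimes\omega^{\otimes n}$. **Vacuum representations.** The loop group $LG=C^\infty(S^1,G)$ has at each level a central extension $\widetilde{LG}$ by $S^1$; a positive energy representation is a representation of $S^1\ltimes\widetilde{LG}$ (first $S^1$ rotating loops) whose energy weight spaces $\mathcal H_m$ are finite-dimensional and vanish for $m\ll0$. Its character is $\sum_m\chi_{\mathcal H_m}q^m$ with $\chi_{\mathcal H_m}$ the character of $\mathcal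 H_m$ as a $G$-representation (constant loops); for $\mathbb Z/2$-graded representations the super character uses supertraces. The level $1$ vacuum ($\mathbb Z/2$-graded) representation of $L\mathrm{Spin}(2n)$ has super character $\prod_{j=1}^n(y_j^{1/2}-y_j^{-1/2})\prod_{m>0}(1-q^my_j)(1-q^my_j^{-1})$, $y_j=e^{2\pi iz_j}$; that of $L\mathrm{SU}(n)$ has super character the restriction to $\prod y_j=1$ of $\prod_{j=1}^n(1-y_j)\prod_{m>0}(1-q^my_j)(1-q^my_j^{-1})$. The identification of sections with super characters is for the normalized characters, i.e. after division by $\prod_{m>0}(1-q^m)^{2n}$. *)

theory Defs
  imports "HOL-Analysis.Analysis"
begin

section \<open>Groups, lattices and the action on the cover\<close>

text \<open>
  A group enters only through its maximal torus: the complexified Lie algebra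
  \<open>tC\<close> inside \<open>complex ^ 'n\<close>, the cocharacter lattice \<open>coX\<close> (vectors with integer entries,
  regarded in \<open>complex ^ 'n\<close>) and the Weyl group as a set of maps.  The rank parameter
  \<open>n \<ge> 1\<close> of \<open>U(n)\<close>, \<open>SU(n)\<close>, \<open>Spin(2n)\<close> is \<open>CARD('n)\<close>.
\<close>

record 'v torus_data =
  tC :: "'v set"
  coX :: "'v set"
  weyl :: "('v \<Rightarrow> 'v) set"

definition int_vectors :: "(complex ^ 'n) set" where
  "int_vectors = {v. \<forall>j. v $ j \<in> \<int>}"

definition permutation_maps :: "(complex ^ 'n \<Rightarrow> complex ^ 'n) set" where
  "permutation_maps = {w. \<exists>p. bij p \<and> w = (\<lambda>z. \<chi> j. z $ p j)}"

definition even_signed_permutation_maps :: "(complex ^ 'n \<Rightarrow> complex ^ 'n) set" where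
  "even_signed_permutation_maps =
     {w. \<exists>p s. bij p \<and> (\<forall>j. s j \<in> {1, -1}) \<and> (\<Prod>j\<in>UNIV. s j) = 1 \<and>
               w = (\<lambda>z. \<chi> j. s j * z $ p j)}"

definition U_data :: "(complex ^ 'n) torus_data" where
  "U_data = \<lparr>tC = UNIV, coX = int_vectors, weyl = permutation_maps\<rparr>"

definition SU_data :: "(complex ^ 'n) torus_data" where
  "SU_data = \<lparr>tC = {z. (\<Sum>j\<in>UNIV. z $ j) = 0},
              coX = {v \<in> int_vectors. (\<Sum>j\<in>UNIV. v $ j) = 0},
              weyl = permutation_maps\<rparr>"

definition Spin_data :: "(complex ^ 'n) torus_data" where
  "Spin_data = \<lparr>tC = UNIV,
                coX = {v \<in> int_vectors. (\<Sum>j\<in>UNIV. v $ j) / 2 \<in> \<int>},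
                weyl = even_signed_permutation_maps\<rparr>"

definition upper_half_plane :: "complex set" where
  "upper_half_plane = {\<tau>. Im \<tau> > 0}"

definition cover :: "'v torus_data \<Rightarrow> (complex \<times> 'v) set" where
  "cover G = upper_half_plane \<times> tC G"

text \<open>\<open>(a, b, c, d)\<close> stands for the matrix with rows \<open>(a, b)\<close> and \<open>(c, d)\<close>.\<close>

type_synonym mat2 = "int \<times> int \<times> int \<times> int"

definition SL2Z :: "mat2 set" where
  "SL2Z = {(a, b, c, d). a * d - b * c = 1}"

fun mat2_mult :: "mat2 \<Rightarrow> mat2 \<Rightarrow> mat2" where
  "mat2_mult (a, b, c, d) (a', b', c', d') =
     (a * a' + b * c', a * b' + b * d', c * a' + d * c', c * b' + d * d')"

text \<open>The inverse on \<open>SL2Z\<close>.\<close>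

fun mat2_inv :: "mat2 \<Rightarrow> mat2" where
  "mat2_inv (a, b, c, d) = (d, - b, - c, a)"

fun denom :: "mat2 \<Rightarrow> complex \<Rightarrow> complex" where
  "denom (a, b, c, d) \<tau> = of_int c * \<tau> + of_int d"

fun sl2_act :: "mat2 \<Rightarrow> complex \<times> (complex ^ 'n) \<Rightarrow> complex \<times> (complex ^ 'n)" where
  "sl2_act (a, b, c, d) (\<tau>, z) =
     ((of_int a * \<tau> + of_int b) / (of_int c * \<tau> + of_int d),
      (1 / (of_int c * \<tau> + of_int d)) *s z)"

fun lat_act :: "complex ^ 'n \<Rightarrow> complex ^ 'n \<Rightarrow> complex \<times> (complex ^ 'n) \<Rightarrow> complex \<times> (complex ^ 'n)"
  where "lat_act m n' (\<tau>, z) = (\<tau>, z + m + \<tau> *s n')"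


section \<open>Line bundles\<close>

text \<open>
  Holomorphic functions on open subsets of the cover.  The derivative is taken within \<open>U\<close>,
  so that \<open>U\<close> may lie in the hyperplane that is the complexified Lie algebra of \<open>SU(n)\<close>.
\<close>

definition holo_on :: "(complex \<times> (complex ^ 'n) \<Rightarrow> complex) \<Rightarrow> (complex \<times> (complex ^ 'n)) set \<Rightarrow> bool"
  where "holo_on f U \<longleftrightarrow>
    (\<forall>x\<in>U. \<exists>D. (f has_derivative D) (at x within U) \<and>
               (\<forall>c a v. D (c * a, c *s v) = c * D (a, v)))"

text \<open>
  A line bundle is given by its multipliers: sections satisfy
  \<open>f (lat_act m n' x) = lat L m n' x * f x\<close> and \<open>f (sl2_act \<gamma> x) = sl2 L \<gamma> x * f x\<close>,
  besides being invariant under the Weyl group.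
\<close>

record 'v multiplier =
  lat :: "'v \<Rightarrow> 'v \<Rightarrow> complex \<times> 'v \<Rightarrow> complex"
  sl2 :: "mat2 \<Rightarrow> complex \<times> 'v \<Rightarrow> complex"

text \<open>
  The multipliers form a cocycle of the semidirect product of the lattice part with \<open>SL2Z\<close>.
  The indices in the mixed condition come from
  \<open>(z + m + \<tau> n') / (c \<tau> + d) = z / (c \<tau> + d) + (a m - b n') + (\<gamma> \<tau>) (d n' - c m)\<close>.
\<close>

definition line_bundle :: "(complex ^ 'n) torus_data \<Rightarrow> (complex ^ 'n) multiplier \<Rightarrow> bool" where
  "line_bundle G L \<longleftrightarrow>
     (\<forall>m\<in>coX G. \<forall>n'\<in>coX G. holo_on (lat L m n') (cover G)) \<and>
     (\<forall>\<gamma>\<in>SL2Z. holo_on (sl2 L \<gamma>) (cover G)) \<and>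
     (\<forall>x\<in>cover G.
        (\<forall>m\<in>coX G. \<forall>n'\<in>coX G. lat L m n' x \<noteq> 0) \<and>
        (\<forall>\<gamma>\<in>SL2Z. sl2 L \<gamma> x \<noteq> 0) \<and>
        (\<forall>m1\<in>coX G. \<forall>n1\<in>coX G. \<forall>m2\<in>coX G. \<forall>n2\<in>coX G.
           lat L (m1 + m2) (n1 + n2) x = lat L m1 n1 (lat_act m2 n2 x) * lat L m2 n2 x) \<and>
        (\<forall>\<gamma>1\<in>SL2Z. \<forall>\<gamma>2\<in>SL2Z.
           sl2 L (mat2_mult \<gamma>1 \<gamma>2) x = sl2 L \<gamma>1 (sl2_act \<gamma>2 x) * sl2 L \<gamma>2 x) \<and>
        (\<forall>(a, b, c, d)\<in>SL2Z. \<forall>m\<in>coX G. \<forall>n'\<in>coX G.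
           lat L (of_int a *s m - of_int b *s n') (of_int d *s n' - of_int c *s m)
               (sl2_act (a, b, c, d) x) * sl2 L (a, b, c, d) x =
           sl2 L (a, b, c, d) (lat_act m n' x) * lat L m n' x) \<and>
        (\<forall>w\<in>weyl G. \<forall>m\<in>coX G. \<forall>n'\<in>coX G.
           lat L (w m) (w n') (fst x, w (snd x)) = lat L m n' x) \<and>
        (\<forall>w\<in>weyl G. \<forall>\<gamma>\<in>SL2Z. sl2 L \<gamma> (fst x, w (snd x)) = sl2 L \<gamma> x))"

text \<open>Opens of \<open>\<H> \<times> C\<^sup>2[G]\<close>, pulled back to the cover; they need not be \<open>SL2Z\<close>-invariant.\<close>

definition base_opens :: "(complex ^ 'n) torus_data \<Rightarrow> (complex \<times> (complex ^ 'n)) set set" where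
  "base_opens G =
     {U. openin (top_of_set (cover G)) U \<and>
         (\<forall>x\<in>U. (\<forall>m\<in>coX G. \<forall>n'\<in>coX G. lat_act m n' x \<in> U) \<and>
                (\<forall>w\<in>weyl G. (fst x, w (snd x)) \<in> U))}"

text \<open>
  Polynomial growth along the geodesics escaping to the boundary in the modular curve, that is,
  those ending at a cusp.  Such a geodesic is \<open>\<gamma>\<close> applied to a vertical ray, and growth
  along it is measured after trivialising the bundle by \<open>\<gamma>\<close>: this is the growth of \<open>\<gamma>\<^sup>* f\<close> along
  the vertical ray with \<open>z\<close> fixed.  Without the trivialisation the condition would depend on
  the chosen coordinates of a section and fail for theta functions.
\<close>

definition poly_growth ::
  "(complex ^ 'n) torus_data \<Rightarrow> (complex ^ 'n) multiplier \<Rightarrow> (complex \<times> (complex ^ 'n)) set \<Rightarrow>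
   (complex \<times> (complex ^ 'n) \<Rightarrow> complex) \<Rightarrow> bool" where
  "poly_growth G L U f \<longleftrightarrow>
     (\<forall>\<gamma>\<in>SL2Z. \<forall>z\<in>tC G. \<forall>r t0. t0 > 0 \<longrightarrow>
        (\<forall>t\<ge>t0. sl2_act \<gamma> (Complex r t, z) \<in> U) \<longrightarrow>
        (\<exists>(C::real) (N::nat). \<forall>t\<ge>t0.
           norm (f (sl2_act \<gamma> (Complex r t, z)) / sl2 L \<gamma> (Complex r t, z)) \<le> C * t ^ N))"

text \<open>
  A line bundle on the quotient stack by \<open>SL2Z\<close> is an \<open>SL2Z\<close>-equivariant sheaf on
  \<open>\<H> \<times> C\<^sup>2[G]\<close>: its sections over \<open>U\<close> (extensional functions, so that equality is equality
  on \<open>U\<close>), and the action of \<open>\<gamma>\<close> from sections over \<open>U\<close> to sections over \<open>\<gamma> U\<close>.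
  Global sections over the stack are the \<open>SL2Z\<close>-invariant ones.
\<close>

definition sections ::
  "(complex ^ 'n) torus_data \<Rightarrow> (complex ^ 'n) multiplier \<Rightarrow> (complex \<times> (complex ^ 'n)) set \<Rightarrow>
   (complex \<times> (complex ^ 'n) \<Rightarrow> complex) set" where
  "sections G L U =
     {f \<in> extensional U. holo_on f U \<and> poly_growth G L U f \<and>
        (\<forall>x\<in>U. \<forall>w\<in>weyl G. f (fst x, w (snd x)) = f x) \<and>
        (\<forall>x\<in>U. \<forall>m\<in>coX G. \<forall>n'\<in>coX G. f (lat_act m n' x) = lat L m n' x * f x)}"

definition sl2_push ::
  "(complex ^ 'n) multiplier \<Rightarrow> mat2 \<Rightarrow> (complex \<times> (complex ^ 'n)) set \<Rightarrow>
   (complex \<times> (complex ^ 'n) \<Rightarrow> complex) \<Rightarrow> (complex \<times> (complex ^ 'n) \<Rightarrow> complex)" where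
  "sl2_push L \<gamma> U f =
     (\<lambda>y \<in> sl2_act \<gamma> ` U. sl2 L \<gamma> (sl2_act (mat2_inv \<gamma>) y) * f (sl2_act (mat2_inv \<gamma>) y))"

definition global_sections ::
  "(complex ^ 'n) torus_data \<Rightarrow> (complex ^ 'n) multiplier \<Rightarrow>
   (complex \<times> (complex ^ 'n) \<Rightarrow> complex) set" where
  "global_sections G L =
     {f \<in> sections G L (cover G).
        \<forall>\<gamma>\<in>SL2Z. \<forall>x\<in>cover G. f (sl2_act \<gamma> x) = sl2 L \<gamma> x * f x}"

definition trivial_bundle :: "'v multiplier" where
  "trivial_bundle = \<lparr>lat = (\<lambda>_ _ _. 1), sl2 = (\<lambda>_ _. 1)\<rparr>"

definition tensor :: "'v multiplier \<Rightarrow> 'v multiplier \<Rightarrow> 'v multiplier" where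
  "tensor L L' = \<lparr>lat = (\<lambda>m n' x. lat L m n' x * lat L' m n' x),
                  sl2 = (\<lambda>\<gamma> x. sl2 L \<gamma> x * sl2 L' \<gamma> x)\<rparr>"

definition omega :: "int \<Rightarrow> 'v multiplier" where
  "omega k = \<lparr>lat = (\<lambda>_ _ _. 1), sl2 = (\<lambda>\<gamma> x. denom \<gamma> (fst x) powi k)\<rparr>"

definition pullback :: "('v \<Rightarrow> 'w) \<Rightarrow> 'w multiplier \<Rightarrow> 'v multiplier" where
  "pullback \<iota> L = \<lparr>lat = (\<lambda>m n' x. lat L (\<iota> m) (\<iota> n') (fst x, \<iota> (snd x))),
                   sl2 = (\<lambda>\<gamma> x. sl2 L \<gamma> (fst x, \<iota> (snd x)))\<rparr>"

text \<open>
  An isomorphism of line bundles: bijections of sections, linear over holomorphic functions,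
  compatible with restriction and with the action of \<open>SL2Z\<close>.
\<close>

definition bundle_iso ::
  "(complex ^ 'n) torus_data \<Rightarrow> (complex ^ 'n) multiplier \<Rightarrow> (complex ^ 'n) multiplier \<Rightarrow>
   ((complex \<times> (complex ^ 'n)) set \<Rightarrow> (complex \<times> (complex ^ 'n) \<Rightarrow> complex) \<Rightarrow>
    (complex \<times> (complex ^ 'n) \<Rightarrow> complex)) \<Rightarrow> bool" where
  "bundle_iso G L L' \<phi> \<longleftrightarrow> line_bundle G L \<and> line_bundle G L' \<and>
     (\<forall>U\<in>base_opens G.
        bij_betw (\<phi> U) (sections G L U) (sections G L' U) \<and>
        (\<forall>f\<in>sections G L U. \<forall>g\<in>sections G L U.
           \<phi> U (\<lambda>x\<in>U. f x + g x) = (\<lambda>x\<in>U. \<phi> U f x + \<phi> U g x)) \<and>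
        (\<forall>h\<in>sections G trivial_bundle U. \<forall>f\<in>sections G L U.
           \<phi> U (\<lambda>x\<in>U. h x * f x) = (\<lambda>x\<in>U. h x * \<phi> U f x)) \<and>
        (\<forall>V\<in>base_opens G. V \<subseteq> U \<longrightarrow>
           (\<forall>f\<in>sections G L U. \<phi> V (restrict f V) = restrict (\<phi> U f) V)) \<and>
        (\<forall>\<gamma>\<in>SL2Z. \<forall>f\<in>sections G L U.
           \<phi> (sl2_act \<gamma> ` U) (sl2_push L \<gamma> U f) = sl2_push L' \<gamma> U (\<phi> U f)))"


section \<open>Looijenga line bundles\<close>

text \<open>
  The inner product on the real Lie algebra (the vectors of \<open>tC\<close> with real entries) is given
  through its complex bilinear extension.
\<close>

definition is_level ::
  "(complex ^ 'n) torus_data \<Rightarrow> (complex ^ 'n \<Rightarrow> complex ^ 'n \<Rightarrow> complex) \<Rightarrow> bool" where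
  "is_level G lev \<longleftrightarrow>
     (\<forall>u\<in>tC G. \<forall>v\<in>tC G. \<forall>w\<in>tC G. \<forall>c. lev (u + v) w = lev u w + lev v w \<and> lev (c *s u) w = c * lev u w) \<and>
     (\<forall>u\<in>tC G. \<forall>v\<in>tC G. lev u v = lev v u) \<and>
     (\<forall>w\<in>weyl G. \<forall>u\<in>tC G. \<forall>v\<in>tC G. lev (w u) (w v) = lev u v) \<and>
     (\<forall>u\<in>tC G. \<forall>v\<in>tC G. (\<forall>j. u $ j \<in> \<real>) \<and> (\<forall>j. v $ j \<in> \<real>) \<longrightarrow> lev u v \<in> \<real>) \<and>
     (\<forall>v\<in>tC G. (\<forall>j. v $ j \<in> \<real>) \<and> v \<noteq> 0 \<longrightarrow> Re (lev v v) > 0) \<and>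
     (\<forall>v\<in>coX G. \<exists>k::int. lev v v = 2 * of_int k)"

text \<open>
  In the coordinates used here the pullback along \<open>Spin(2) \<subset> Spin(2N)\<close> or
  \<open>Spin(4) \<subset> Spin(2N)\<close> is given by the same formula, so level 1 needs no separate case there.
\<close>

definition level_one :: "complex ^ 'n \<Rightarrow> complex ^ 'n \<Rightarrow> complex" where
  "level_one z w = (\<Sum>j\<in>UNIV. z $ j * w $ j)"

definition looijenga :: "(complex ^ 'n \<Rightarrow> complex ^ 'n \<Rightarrow> complex) \<Rightarrow> (complex ^ 'n) multiplier" where
  "looijenga lev =
     \<lparr>lat = (\<lambda>m n' (\<tau>, z). exp (- (of_real pi * \<i> * (2 * lev n' z + lev n' n' * \<tau>)))),
      sl2 = (\<lambda>(a, b, c, d) (\<tau>, z).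
               exp (of_real pi * \<i> * of_int c * lev z z / (of_int c * \<tau> + of_int d)))\<rparr>"


section \<open>The bundles attached to the sigma function\<close>

definition nome :: "complex \<Rightarrow> complex" where
  "nome \<tau> = exp (2 * of_real pi * \<i> * \<tau>)"

definition y_half :: "complex \<Rightarrow> complex" where
  "y_half z = exp (of_real pi * \<i> * z)"

definition y_of :: "complex \<Rightarrow> complex" where
  "y_of z = exp (2 * of_real pi * \<i> * z)"

definition sigma :: "complex \<Rightarrow> complex \<Rightarrow> complex" where
  "sigma \<tau> z = (y_half z - inverse (y_half z)) *
     (\<Prod>m. (1 - nome \<tau> ^ Suc m * y_of z) * (1 - nome \<tau> ^ Suc m * inverse (y_of z)) /
            (1 - nome \<tau> ^ Suc m) ^ 2)"

definition upsilon :: "complex \<Rightarrow> complex \<Rightarrow> complex" where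
  "upsilon \<tau> z = - y_half z * sigma \<tau> z"

definition sigma_SO :: "complex \<times> (complex ^ 'n) \<Rightarrow> complex" where
  "sigma_SO x = (\<Prod>j\<in>UNIV. sigma (fst x) (snd x $ j))"

definition sigma_U :: "complex \<times> (complex ^ 'n) \<Rightarrow> complex" where
  "sigma_U x = (\<Prod>j\<in>UNIV. upsilon (fst x) (snd x $ j))"

text \<open>
  For a function with zeros on a nowhere dense set only, such as \<open>sigma_SO\<close> and
  \<open>sigma_U\<close> on the full cover, the multiplier below is unique (on the lattice,
  \<open>SL2Z\<close> and the cover), so the choice is immaterial.
\<close>

definition transforms_by ::
  "(complex ^ 'n) torus_data \<Rightarrow> (complex \<times> (complex ^ 'n) \<Rightarrow> complex) \<Rightarrow>
   (complex ^ 'n) multiplier \<Rightarrow> bool" where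
  "transforms_by G s L \<longleftrightarrow> line_bundle G L \<and>
     (\<forall>x\<in>cover G.
        (\<forall>m\<in>coX G. \<forall>n'\<in>coX G. s (lat_act m n' x) = lat L m n' x * s x) \<and>
        (\<forall>\<gamma>\<in>SL2Z. s (sl2_act \<gamma> x) = sl2 L \<gamma> x * s x))"

definition bundle_of ::
  "(complex ^ 'n) torus_data \<Rightarrow> (complex \<times> (complex ^ 'n) \<Rightarrow> complex) \<Rightarrow> (complex ^ 'n) multiplier"
  where "bundle_of G s = (SOME L. transforms_by G s L)"

definition A_U :: "(complex ^ 'n) multiplier" where
  "A_U = bundle_of U_data sigma_U"

definition A_Spin :: "(complex ^ 'n) multiplier" where
  "A_Spin = bundle_of Spin_data sigma_SO"

definition L_U :: "(complex ^ 'n) multiplier" where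
  "L_U = tensor A_U (omega (int CARD('n)))"

definition L_Spin :: "(complex ^ 'n) multiplier" where
  "L_Spin = tensor A_Spin (omega (int CARD('n)))"

text \<open>The coordinates on the torus of \<open>SU(n)\<close> are restricted from \<open>U(n)\<close>.\<close>

definition SU_to_U :: "complex ^ 'n \<Rightarrow> complex ^ 'n" where
  "SU_to_U z = z"


section \<open>Elliptic cocycles\<close>

text \<open>\<open>Beta k f\<close> is the expression \<open>\<beta>\<^sup>k f\<close>.\<close>

datatype 'p beta_expr = Beta int "'p \<Rightarrow> complex"

text \<open>
  Sections of the sheaf of degree \<open>2k\<close> cocycles, twisted by \<open>L\<close>.  As \<open>SL2Z\<close> acts by
  \<open>\<beta> \<mapsto> \<beta> / (c \<tau> + d)\<close>, invariance of \<open>\<beta>\<^sup>-\<^sup>k f\<close> says that \<open>f\<close> is multiplied by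
  \<open>(c \<tau> + d)\<^sup>-\<^sup>k\<close>.
\<close>

definition ell_sections ::
  "(complex ^ 'n) torus_data \<Rightarrow> int \<Rightarrow> (complex ^ 'n) multiplier \<Rightarrow>
   (complex \<times> (complex ^ 'n)) beta_expr set" where
  "ell_sections G k L = {Beta (- k) f | f. f \<in> global_sections G (tensor (omega (- k)) L)}"

text \<open>
  The map \<open>id \<otimes> \<phi>\<close> for a bundle isomorphism \<open>\<phi>\<close>: the bundle of \<open>\<beta>\<^sup>k\<close> is trivial
  on \<open>\<H> \<times> C\<^sup>2[G]\<close>, where \<open>f\<close> is a section of the source of \<open>\<phi>\<close>.
\<close>

definition map_beta :: "(('p \<Rightarrow> complex) \<Rightarrow> ('p \<Rightarrow> complex)) \<Rightarrow> 'p beta_expr \<Rightarrow> 'p beta_expr" where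
  "map_beta \<psi> e = (case e of Beta k f \<Rightarrow> Beta k (\<psi> f))"

definition Eu_SU :: "(complex \<times> (complex ^ 'n)) beta_expr" where
  "Eu_SU = Beta (- int CARD('n)) (restrict sigma_U (cover SU_data))"

definition Eu_Spin :: "(complex \<times> (complex ^ 'n)) beta_expr" where
  "Eu_Spin = Beta (- int CARD('n)) (restrict sigma_SO (cover Spin_data))"


section \<open>Vacuum representations and their super characters\<close>

text \<open>
  The super character of a \<open>\<int>/2\<close>-graded positive energy representation of a loop group depends
  only on the action of the rotation circle and of the constant loops in the maximal torus.
  This is recorded by a homogeneous basis of simultaneous eigenvectors with their energy,
  parity (\<open>odd\<close>) and weight; the weight \<open>\<lambda>\<close> is the character
  \<open>z \<mapsto> exp (2 \<pi> \<i> (\<Sum>j. \<lambda>\<^sub>j z\<^sub>j))\<close>.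
\<close>

record ('b, 'v) graded_rep =
  basis :: "'b set"
  energy :: "'b \<Rightarrow> int"
  is_odd :: "'b \<Rightarrow> bool"
  weight :: "'b \<Rightarrow> 'v"

definition torus_char :: "complex ^ 'n \<Rightarrow> complex ^ 'n \<Rightarrow> complex" where
  "torus_char \<mu> z = exp (2 * of_real pi * \<i> * (\<Sum>j\<in>UNIV. \<mu> $ j * z $ j))"

definition energy_char ::
  "('b, complex ^ 'n) graded_rep \<Rightarrow> int \<Rightarrow> bool \<Rightarrow> complex ^ 'n \<Rightarrow> complex" where
  "energy_char V m p z =
     (\<Sum>b | b \<in> basis V \<and> energy V b = m \<and> is_odd V b = p. torus_char (weight V b) z)"

text \<open>
  Energies are bounded below with finite-dimensional energy spaces, the weights are characters
  of the torus, and the characters of the energy spaces, being those of representations of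
  the whole group, are invariant under the Weyl group.
\<close>

definition positive_energy :: "(complex ^ 'n) torus_data \<Rightarrow> ('b, complex ^ 'n) graded_rep \<Rightarrow> bool"
  where "positive_energy G V \<longleftrightarrow>
     (\<exists>m0. \<forall>b\<in>basis V. m0 \<le> energy V b) \<and>
     (\<forall>m. finite {b \<in> basis V. energy V b = m}) \<and>
     (\<forall>b\<in>basis V. \<forall>v\<in>coX G. (\<Sum>j\<in>UNIV. weight V b $ j * v $ j) \<in> \<int>) \<and>
     (\<forall>m p. \<forall>w\<in>weyl G. \<forall>z\<in>tC G. energy_char V m p (w z) = energy_char V m p z)"

definition super_character ::
  "('b, complex ^ 'n) graded_rep \<Rightarrow> complex \<times> (complex ^ 'n) \<Rightarrow> complex" where
  "super_character V x =
     (\<Sum>\<^sub>\<infinity>m. (energy_char V m False (snd x) - energy_char V m True (snd x)) * nome (fst x) powi m)"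

definition normalized_super_character ::
  "('b, complex ^ 'n) graded_rep \<Rightarrow> complex \<times> (complex ^ 'n) \<Rightarrow> complex" where
  "normalized_super_character V x =
     super_character V x / (\<Prod>m. (1 - nome (fst x) ^ Suc m) ^ (2 * CARD('n)))"

text \<open>
  The level 1 vacuum representations are fermionic Fock spaces: the exterior algebra on a set
  of modes, a basis vector being the finite set of occupied modes.  The mode \<open>(m, j, s)\<close> has
  energy \<open>m\<close>, is odd, and has as weight the \<open>j\<close>-th unit vector, with sign \<open>+\<close> iff \<open>s\<close>.
  For \<open>Spin(2n)\<close> the modes of energy 0 span half of the \<open>2n\<close> zero modes of periodic fermions,
  so that the space of energy 0 is the spinor representation, with highest weight
  \<open>(1/2, \<dots>, 1/2)\<close>; for \<open>SU(n)\<close> the Fock space of \<open>L U(n)\<close> is restricted.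
\<close>

type_synonym 'n mode = "nat \<times> 'n \<times> bool"

definition mode_weight :: "'n mode \<Rightarrow> complex ^ 'n" where
  "mode_weight = (\<lambda>(m, j, s). axis j (if s then 1 else -1))"

definition fock_space ::
  "'n mode set \<Rightarrow> complex ^ 'n \<Rightarrow> ('n mode set, complex ^ 'n) graded_rep" where
  "fock_space M \<mu> =
     \<lparr>basis = {S. finite S \<and> S \<subseteq> M},
      energy = (\<lambda>S. \<Sum>(m, j, s)\<in>S. int m),
      is_odd = (\<lambda>S. odd (card S)),
      weight = (\<lambda>S. \<mu> + (\<Sum>e\<in>S. mode_weight e))\<rparr>"

definition vacuum_SU :: "('n mode set, complex ^ 'n) graded_rep" where
  "vacuum_SU = fock_space {(m, j, s). s \<or> m > 0} 0"

definition vacuum_Spin :: "('n mode set, complex ^ 'n) graded_rep" where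
  "vacuum_Spin = fock_space {(m, j, s). \<not> s \<or> m > 0} (\<chi> j. 1 / 2)"

text \<open>The product formulas for the super characters.\<close>

definition vacuum_product_SU :: "complex \<times> (complex ^ 'n) \<Rightarrow> complex" where
  "vacuum_product_SU x =
     (\<Prod>j\<in>UNIV. (1 - y_of (snd x $ j)) *
        (\<Prod>m. (1 - nome (fst x) ^ Suc m * y_of (snd x $ j)) *
               (1 - nome (fst x) ^ Suc m * inverse (y_of (snd x $ j)))))"

definition vacuum_product_Spin :: "complex \<times> (complex ^ 'n) \<Rightarrow> complex" where
  "vacuum_product_Spin x =
     (\<Prod>j\<in>UNIV. (y_half (snd x $ j) - inverse (y_half (snd x $ j))) *
        (\<Prod>m. (1 - nome (fst x) ^ Suc m * y_of (snd x $ j)) *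
               (1 - nome (fst x) ^ Suc m * inverse (y_of (snd x $ j)))))"

end

theory Submission
  imports Defs "HOL-Complex_Analysis.Cauchy_Integral_Formula"
begin

text \<open>
The function \<open>\<sigma>(\<tau>, \<cdot>)\<close> has simple zeros exactly on the lattice \<open>\<int> + \<tau>\<int>\<close>, is multiplied by
\<open>(-1)\<^sup>m\<^sup>+\<^sup>n exp (-\<pi>\<i>(2nz + n\<^sup>2\<tau>))\<close> under \<open>z \<mapsto> z + m + n\<tau>\<close> (\<open>sigma_lat\<close>), and has derivative
\<open>2\<pi>\<i>\<close> at \<open>0\<close>.  These facts already force its behaviour under all of \<open>SL2Z\<close>
(\<open>sigma_modular\<close>): for \<open>j = c\<tau> + d\<close> the quotient of \<open>\<sigma>(\<gamma>\<tau>, z/j)\<close> by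
\<open>exp (\<pi>\<i>cz\<^sup>2/j) \<sigma>(\<tau>, z)\<close> is doubly periodic, and numerator and denominator both have simple zeros
on the lattice; so it is an entire bounded function, hence constant, and the derivatives at \<open>0\<close> show
that the constant is \<open>1/j\<close>.

Multiplying over the coordinates, \<open>sigma_SO\<close> transforms by the tensor product of
\<open>\<omega>\<^sup>-\<^sup>n\<close> and a multiplier \<open>theta_bundle\<close> that is defined on the whole lattice
\<open>\<int>\<^sup>n\<close> and differs from the level 1 Looijenga multiplier only by the sign
\<open>(-1)\<close> to the sum of all entries of \<open>m\<close> and \<open>n'\<close>.  On the cocharacters of \<open>Spin(2n)\<close> and
\<open>SU(n)\<close> the sums of the entries of \<open>m\<close> and of \<open>n'\<close> are even, so there the two
multipliers coincide (\<open>agree_looijenga\<close>).  The further factor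
\<open>\<Prod>j. - y\<^sub>j\<^sup>1\<^sup>/\<^sup>2\<close> that turns \<open>sigma_SO\<close> into \<open>sigma_U\<close> is constant on the torus
of \<open>SU(n)\<close> (\<open>y_half_prod_SU\<close>).

The bundles of the theorem are described by an arbitrary multiplier for \<open>sigma_SO\<close>, resp. \<open>sigma_U\<close>.
As these functions vanish on a nowhere dense set only, the multiplier is determined on the cover
(\<open>transforms_by_unique\<close>).  Twisting by \<open>\<omega>\<^sup>n\<close> removes the weight, and then source and target of
the required isomorphism have equal multipliers (\<open>L_Spin_agree\<close>, \<open>SU_L_U_agree\<close>); the identity is
the isomorphism, and it fixes the Euler classes.  These are sections because \<open>\<sigma>\<close> is holomorphic in
both variables (\<open>Osgood\<close>) and bounded along vertical rays (\<open>sigma_bounded\<close>).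

On the side of representations, expanding the product of \<open>1 - q\<^sup>m y\<^sup>w\<close> over all fermionic modes
gives the sum over the finite sets of occupied modes, that is the super character of the Fock space
(\<open>fock_space_super_character\<close>).  The Weyl group permutes the modes, up to exchanging particles and
holes among the zero modes (\<open>fock_space_weyl\<close>).
\<close>

section \<open>The q-Pochhammer product\<close>

text \<open>
The symbol \<open>(x; q)\<^sub>\<infinity>\<close>.  The product starts at \<open>m = 0\<close>, in contrast to the one in the definition of
\<open>\<sigma>\<close>: so the factor \<open>1 - y\<close> is absorbed, and shifting \<open>x\<close> by \<open>q\<close> never requires a
division by a factor that may vanish.
\<close>

definition qpoch :: "complex \<Rightarrow> complex \<Rightarrow> complex" where
  "qpoch q x = (\<Prod>m. 1 - x * q ^ m)"

lemma convergent_prod_qpoch: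
  fixes q x :: complex
  assumes "norm q < 1"
  shows "convergent_prod (\<lambda>m. 1 - x * q ^ m)"
proof -
  have "summable (\<lambda>m. norm x * norm q ^ m)"
    using assms by (intro summable_mult summable_geometric) auto
  then have "abs_convergent_prod (\<lambda>m. 1 - x * q ^ m)"
    by (intro summable_imp_abs_convergent_prod) (simp add: norm_mult norm_power)
  then show ?thesis by (rule abs_convergent_prod_imp_convergent_prod)
qed

lemma qpoch_LIMSEQ:
  assumes "norm q < 1"
  shows "(\<lambda>n. \<Prod>m<n. 1 - x * q ^ m) \<longlonglongrightarrow> qpoch q x"
  using convergent_prod_LIMSEQ[OF convergent_prod_qpoch[OF assms, of x]]
  by (simp add: qpoch_def LIMSEQ_lessThan_iff_atMost)

lemma qpoch_eq_0_imp:
  assumes "norm q < 1" "qpoch q x = 0"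
  obtains m where "x * q ^ m = 1"
  using prodinf_nonzero[OF convergent_prod_qpoch[OF assms(1), of x]] assms(2)
  unfolding qpoch_def by force

lemma qpoch_rec:
  assumes "norm q < 1"
  shows "qpoch q x = (1 - x) * qpoch q (q * x)"
proof -
  have "(\<lambda>n. (1 - x) * (\<Prod>m<n. 1 - (q * x) * q ^ m)) \<longlonglongrightarrow> (1 - x) * qpoch q (q * x)"
    by (intro tendsto_intros qpoch_LIMSEQ assms)
  moreover have "(1 - x) * (\<Prod>m<n. 1 - (q * x) * q ^ m) = (\<Prod>m<Suc n. 1 - x * q ^ m)" for n
    unfolding prod.lessThan_Suc_shift by (simp add: o_def mult_ac)
  ultimately have "(\<lambda>n. \<Prod>m<Suc n. 1 - x * q ^ m) \<longlonglongrightarrow> (1 - x) * qpoch q (q * x)"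
    by simp
  moreover have "(\<lambda>n. \<Prod>m<Suc n. 1 - x * q ^ m) \<longlonglongrightarrow> qpoch q x"
    using qpoch_LIMSEQ[OF assms, of x] by (rule LIMSEQ_Suc)
  ultimately show ?thesis by (rule LIMSEQ_unique[symmetric])
qed

text \<open>
The factors differ from \<open>1\<close> by at most \<open>R r\<^sup>m\<close>, so the convergence is uniform in both variables at once.  This
gives joint continuity, and holomorphy along every holomorphic curve in \<open>(q, x)\<close>.
\<close>

lemma uniform_limit_qpoch:
  assumes "r < 1"
  shows "uniform_limit (cball 0 r \<times> cball 0 R) (\<lambda>n (q, x). \<Prod>m<n. 1 - x * q ^ m)
           (\<lambda>(q, x). qpoch q x) sequentially"
proof (cases "0 \<le> r \<and> 0 \<le> R")
  case True
  define K where "K = (cball 0 r :: complex set) \<times> (cball 0 R :: complex set)"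
  define f where "f = (\<lambda>m (q::complex, x::complex). 1 - x * q ^ m)"
  have "norm (norm (f m p - 1)) \<le> R * r ^ m" if "p \<in> K" for m p
    using that True by (auto simp: f_def K_def norm_mult norm_power intro!: mult_mono power_mono)
  moreover have "summable (\<lambda>m. R * r ^ m)"
    using True assms by (intro summable_mult summable_geometric) auto
  ultimately have "uniform_limit K (\<lambda>N p. \<Sum>n<N. norm (f n p - 1)) (\<lambda>p. \<Sum>n. norm (f n p - 1)) sequentially"
    by (rule Weierstrass_m_test)
  then have "uniformly_convergent_on K (\<lambda>N p. \<Sum>n<N. norm (f n p - 1))"
    by (auto simp: uniformly_convergent_on_def)
  moreover have "continuous_on K (f n)" for n
    unfolding f_def case_prod_unfold by (intro continuous_intros)
  moreover have "compact K" by (auto simp: K_def intro: compact_Times)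
  ultimately have "uniformly_convergent_on K (\<lambda>N p. \<Prod>n<N. f n p)"
    by (intro uniformly_convergent_on_prod')
  then obtain l where l: "uniform_limit K (\<lambda>N p. \<Prod>n<N. f n p) l sequentially"
    by (auto simp: uniformly_convergent_on_def)
  have "l p = (\<lambda>(q, x). qpoch q x) p" if "p \<in> K" for p
  proof (cases p)
    case (Pair q x)
    have "(\<lambda>N. \<Prod>n<N. f n p) \<longlonglongrightarrow> l p"
      using tendsto_uniform_limitI[OF l that] .
    moreover have "(\<lambda>N. \<Prod>n<N. f n p) \<longlonglongrightarrow> qpoch q x"
      using qpoch_LIMSEQ[of q x] that assms by (simp add: Pair f_def K_def)
    ultimately show ?thesis by (simp add: Pair LIMSEQ_unique)
  qed
  then have "uniform_limit K (\<lambda>N p. \<Prod>n<N. f n p) (\<lambda>(q, x). qpoch q x) sequentially"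
    using uniform_limit_cong'[of K "\<lambda>N p. \<Prod>n<N. f n p" "\<lambda>N p. \<Prod>n<N. f n p" l "\<lambda>(q, x). qpoch q x" sequentially] l
    by simp
  then show ?thesis by (simp add: f_def K_def case_prod_unfold)
qed (auto simp: not_le)

lemma continuous_on_qpoch_case_prod: "continuous_on (ball 0 1 \<times> UNIV) (\<lambda>(q, x). qpoch q x)"
proof -
  have "isCont (\<lambda>(q, x). qpoch q x) p" if "p \<in> ball 0 1 \<times> UNIV" for p
  proof -
    obtain q x where p: "p = (q, x)" by force
    with that have "norm q < 1" by auto
    then obtain r where r: "norm q < r" "r < 1" using dense by blast
    define K where "K = (cball 0 r :: complex set) \<times> (cball 0 (norm x + 1) :: complex set)"
    have "continuous_on K (\<lambda>(q, x). qpoch q x)"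
      by (rule uniform_limit_theorem[OF _ uniform_limit_qpoch[OF r(2), of "norm x + 1", folded K_def]])
        (auto intro!: always_eventually continuous_intros simp: case_prod_unfold)
    then have "continuous_on (ball 0 r \<times> ball 0 (norm x + 1)) (\<lambda>(q, x). qpoch q x)"
      by (rule continuous_on_subset) (auto simp: K_def)
    moreover have "open (ball (0::complex) r \<times> ball (0::complex) (norm x + 1))"
      by (intro open_Times) auto
    ultimately show ?thesis
      using r by (auto simp: continuous_on_eq_continuous_at p)
  qed
  then show ?thesis by (simp add: continuous_at_imp_continuous_on)
qed

lemma continuous_on_qpoch [continuous_intros]:
  assumes "continuous_on S f" "continuous_on S g" "\<And>x. x \<in> S \<Longrightarrow> norm (f x) < 1"
  shows "continuous_on S (\<lambda>x. qpoch (f x) (g x))"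
proof -
  have "continuous_on S ((\<lambda>(q, x). qpoch q x) \<circ> (\<lambda>x. (f x, g x)))"
    using assms by (intro continuous_on_compose continuous_on_subset[OF continuous_on_qpoch_case_prod])
      (auto intro!: continuous_intros)
  then show ?thesis by (simp add: o_def)
qed

lemma holomorphic_on_qpoch [holomorphic_intros]:
  assumes "open S" "f holomorphic_on S" "g holomorphic_on S" "\<And>x. x \<in> S \<Longrightarrow> norm (f x) < 1"
  shows "(\<lambda>x. qpoch (f x) (g x)) holomorphic_on S"
proof (rule holomorphic_uniform_sequence[OF \<open>open S\<close>])
  show "(\<lambda>z. \<Prod>m<n. 1 - g z * f z ^ m) holomorphic_on S" for n
    using assms by (intro holomorphic_intros) auto
next
  fix z assume "z \<in> S"
  then obtain d where d: "d > 0" "cball z d \<subseteq> S"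
    using \<open>open S\<close> open_contains_cball by blast
  have cont: "continuous_on (cball z d) f" "continuous_on (cball z d) g"
    using assms d by (auto intro!: holomorphic_on_imp_continuous_on elim: holomorphic_on_subset)
  obtain w where w: "w \<in> cball z d" "\<And>y. y \<in> cball z d \<Longrightarrow> norm (f y) \<le> norm (f w)"
    using continuous_attains_sup[OF compact_cball _ continuous_on_norm[OF cont(1)]] d by auto
  have "bounded (g ` cball z d)"
    using cont by (intro compact_imp_bounded compact_continuous_image) auto
  then obtain R where R: "\<And>y. y \<in> cball z d \<Longrightarrow> norm (g y) \<le> R"
    unfolding bounded_iff by blast
  have "norm (f w) < 1" using assms w d by auto
  from uniform_limit_qpoch[OF this, of R]
  have "uniform_limit (cball z d) (\<lambda>n z. \<Prod>m<n. 1 - g z * f z ^ m) (\<lambda>z. qpoch (f z) (g z)) sequentially"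
    unfolding uniform_limit_iff
    by (rule all_forward) (use w R in \<open>auto elim!: eventually_mono\<close>)
  with d show "\<exists>d>0. cball z d \<subseteq> S \<and>
      uniform_limit (cball z d) (\<lambda>n z. \<Prod>m<n. 1 - g z * f z ^ m) (\<lambda>z. qpoch (f z) (g z)) sequentially"
    by blast
qed

section \<open>Separately holomorphic functions of two variables\<close>

text \<open>
If \<open>x\<close> is close to \<open>a\<close>, then \<open>f x\<close> is uniformly close to \<open>f a\<close> on a disc, and by Cauchy's estimate so
are their derivatives.  Hence the second partial derivative is continuous in both variables, which
together with the existence of the first one gives the total derivative.
\<close>

lemma Osgood:
  fixes f :: "complex \<Rightarrow> complex \<Rightarrow> complex"
  assumes "open A" "open B" and cont: "continuous_on (A \<times> B) (\<lambda>(x, y). f x y)"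
    and hol1: "\<And>y. y \<in> B \<Longrightarrow> (\<lambda>x. f x y) holomorphic_on A"
    and hol2: "\<And>x. x \<in> A \<Longrightarrow> f x holomorphic_on B"
    and ab: "a \<in> A" "b \<in> B"
  obtains D1 D2 where
    "((\<lambda>(x, y). f x y) has_derivative (\<lambda>(u, v). D1 * u + D2 * v)) (at (a, b))"
proof -
  obtain r1 where r1: "r1 > 0" "cball a r1 \<subseteq> A" using \<open>open A\<close> ab open_contains_cball by blast
  obtain r2 where r2: "r2 > 0" "cball b r2 \<subseteq> B" using \<open>open B\<close> ab open_contains_cball by blast
  define r where "r = r2 / 2"
  have r: "r > 0" "cball b (2 * r) \<subseteq> B" using r2 by (auto simp: r_def)
  define X where "X = ball a r1"
  define Y where "Y = ball b r"
  have XY: "a \<in> X" "b \<in> Y" "open X" "open Y" "convex Y" "X \<subseteq> A" "Y \<subseteq> B"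
    using r r1 by (force simp: X_def Y_def)+
  define D where "D = (\<lambda>x y. deriv (f x) y)"
  have D: "(f x has_field_derivative D x y) (at y)" if "x \<in> A" "y \<in> B" for x y
    using hol2[OF that(1)] that \<open>open B\<close> by (auto simp: D_def intro: holomorphic_derivI)
  have D_cont: "((\<lambda>(x, y). D x y) \<longlongrightarrow> D a b) (at (a, b) within X \<times> Y)"
    unfolding tendsto_iff
  proof (intro allI impI)
    fix e :: real assume e: "e > 0"
    have "D a holomorphic_on B"
      unfolding D_def using hol2[OF ab(1)] \<open>open B\<close> by (rule holomorphic_deriv)
    then have "isCont (D a) b"
      using ab \<open>open B\<close> continuous_on_eq_continuous_at holomorphic_on_imp_continuous_on by blast
    then obtain d1 where d1: "d1 > 0" "\<And>y. dist y b < d1 \<Longrightarrow> dist (D a y) (D a b) < e / 2"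
      using e unfolding continuous_at_eps_delta by (meson half_gt_zero)
    \<comment> \<open>The disc of radius \<open>2 r\<close> leaves room for a disc of radius \<open>r\<close> about each \<open>y \<in> Y\<close>.\<close>
    have "uniformly_continuous_on (cball a r1 \<times> cball b (2 * r)) (\<lambda>(x, y). f x y)"
      using r r1 by (intro compact_uniformly_continuous compact_Times continuous_on_subset[OF cont]) auto
    then obtain d2 where d2: "d2 > 0" "\<And>x y x' y'. x \<in> cball a r1 \<Longrightarrow> y \<in> cball b (2 * r) \<Longrightarrow>
        x' \<in> cball a r1 \<Longrightarrow> y' \<in> cball b (2 * r) \<Longrightarrow> dist (x, y) (x', y') < d2 \<Longrightarrow> dist (f x y) (f x' y') < e * r / 2"
      using e r unfolding uniformly_continuous_on_def
      by (drule_tac x = "e * r / 2" in spec) (auto simp: Ball_def)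
    have "dist (D x y) (D a b) < e" if xy: "x \<in> X" "y \<in> Y" "dist (x, y) (a, b) < min d1 d2" for x y
    proof -
      have "dist x a \<le> dist (x, y) (a, b)" "dist y b \<le> dist (x, y) (a, b)"
        by (metis dist_fst_le fst_conv, metis dist_snd_le snd_conv)
      then have dxy: "dist x a < d2" "dist y b < d1" using xy(3) by auto
      have sub: "cball y r \<subseteq> cball b (2 * r)"
      proof
        fix w assume "w \<in> cball y r"
        then show "w \<in> cball b (2 * r)"
          using xy(2) dist_triangle[of b w y] by (simp add: Y_def)
      qed
      have xA: "x \<in> A" and aA: "a \<in> A" and yB: "y \<in> B" using xy ab XY by auto
      have hol: "(\<lambda>w. f x w - f a w) holomorphic_on B"
        by (intro holomorphic_intros hol2 xA aA)
      have "norm ((deriv ^^ 1) (\<lambda>w. f x w - f a w) y) \<le> fact 1 * (e * r / 2) / r ^ 1"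
      proof (rule Cauchy_higher_deriv_bound)
        show "(\<lambda>w. f x w - f a w) holomorphic_on ball y r"
          using hol by (rule holomorphic_on_subset) (use sub r in \<open>auto simp: subset_iff\<close>)
        show "continuous_on (cball y r) (\<lambda>w. f x w - f a w)"
          using holomorphic_on_imp_continuous_on[OF hol] by (rule continuous_on_subset) (use sub r in auto)
        show "f x w - f a w \<in> ball 0 (e * r / 2)" if "w \<in> ball y r" for w
        proof -
          have "w \<in> cball b (2 * r)" using that sub by (meson ball_subset_cball subsetD)
          then show ?thesis
            using d2(2)[of x w a w] xy(1) dxy r1
            by (auto simp: X_def dist_norm dist_Pair_Pair norm_minus_commute)
        qed
      qed (use r in auto)
      also have "(deriv ^^ 1) (\<lambda>w. f x w - f a w) y = D x y - D a y"
        using D[OF xA yB] D[OF aA yB] by (auto intro!: DERIV_imp_deriv derivative_eq_intros)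
      finally have "dist (D x y) (D a y) \<le> e / 2" using r by (simp add: dist_norm)
      with d1(2)[OF dxy(2)] show ?thesis
        using dist_triangle[of "D x y" "D a b" "D a y"] by linarith
    qed
    then show "\<forall>\<^sub>F p in at (a, b) within X \<times> Y. dist (case p of (x, y) \<Rightarrow> D x y) (D a b) < e"
      unfolding eventually_at using d1 d2 by (intro exI[of _ "min d1 d2"]) auto
  qed
  have "((\<lambda>x. f x b) has_field_derivative deriv (\<lambda>x. f x b) a) (at a within X)"
    using hol1[OF ab(2)] ab \<open>open A\<close> by (auto intro: holomorphic_derivI has_field_derivative_at_within)
  then have "((\<lambda>x. f x b) has_derivative (*) (deriv (\<lambda>x. f x b) a)) (at a within X)"
    by (simp add: has_field_derivative_def)
  then have "((\<lambda>(x, y). f x y) has_derivative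
      (\<lambda>(u, v). (deriv (\<lambda>x. f x b) a) * u + blinfun_mult_right (D a b) v)) (at (a, b) within X \<times> Y)"
  proof (rule has_derivative_partialsI)
    show "((\<lambda>y. f x y) has_derivative blinfun_apply (blinfun_mult_right (D x y))) (at y within Y)"
      if "x \<in> X" "y \<in> Y" for x y
      using D[of x y] that XY unfolding has_field_derivative_def
      by (auto intro: has_derivative_at_withinI)
    show "continuous (at (a, b) within X \<times> Y) (\<lambda>(x, y). blinfun_mult_right (D x y))"
      using bounded_linear.tendsto[OF bounded_linear_blinfun_mult_right D_cont]
      by (simp add: continuous_within case_prod_unfold)
  qed (use XY in auto)
  moreover have "at (a, b) within X \<times> Y = at (a, b)"
    using XY by (intro at_within_open open_Times) auto
  ultimately show ?thesis
    using that[of "deriv (\<lambda>x. f x b) a" "D a b"] by (simp add: case_prod_unfold)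
qed

section \<open>The sigma function: translations, zeros and holomorphy\<close>

lemma norm_nome_less_1: "Im \<tau> > 0 \<Longrightarrow> norm (nome \<tau>) < 1"
  by (simp add: nome_def)

lemma nome_nonzero [simp]: "nome \<tau> \<noteq> 0"
  and y_half_nonzero [simp]: "y_half z \<noteq> 0"
  and y_of_nonzero [simp]: "y_of z \<noteq> 0"
  by (simp_all add: nome_def y_half_def y_of_def)

lemma y_of_conv_y_half: "y_of z = y_half z ^ 2"
  by (simp add: y_of_def y_half_def exp_double[symmetric] mult.assoc)

lemma y_of_add: "y_of (z + w) = y_of z * y_of w"
  and y_half_add: "y_half (z + w) = y_half z * y_half w"
  by (simp_all add: y_of_def y_half_def ring_distribs exp_add)

lemma y_of_minus: "y_of (- z) = inverse (y_of z)"
  and y_half_minus: "y_half (- z) = inverse (y_half z)"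
  by (simp_all add: y_of_def y_half_def exp_minus)

lemma nome_conv_y_of: "nome \<tau> = y_of \<tau>"
  by (simp add: nome_def y_of_def)

lemma y_of_int [simp]: "y_of (of_int k) = 1"
  unfolding y_of_def using exp_integer_2pi[of "of_int k"] by (simp add: mult_ac)

lemma y_half_1: "y_half 1 = -1"
  by (simp add: y_half_def mult.commute exp_pi_i)

lemma prodinf_conv_qpoch:
  assumes "norm q < 1"
  shows "(\<Prod>m. 1 - q ^ Suc m * x) = qpoch q (q * x)"
    and "convergent_prod (\<lambda>m. 1 - q ^ Suc m * x)"
  using convergent_prod_qpoch[OF assms, of "q * x"] by (simp_all add: qpoch_def mult_ac)

lemma qpoch_self_nonzero:
  assumes "norm q < 1" "q \<noteq> 0"
  shows "qpoch q q \<noteq> 0"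
proof
  assume "qpoch q q = 0"
  then obtain m where "q * q ^ m = 1" using assms qpoch_eq_0_imp by blast
  then have "norm q ^ Suc m = 1" by (metis norm_one norm_power power_Suc)
  moreover have "norm q ^ Suc m < 1" using assms by (intro power_Suc_less_one) auto
  ultimately show False by simp
qed

text \<open>
Since \<open>y\<^sup>1\<^sup>/\<^sup>2 - y\<^sup>-\<^sup>1\<^sup>/\<^sup>2 = - y\<^sup>-\<^sup>1\<^sup>/\<^sup>2 (1 - y)\<close>, the outer factor completes the product over
\<open>1 - q\<^sup>m y\<close> to \<open>(y; q)\<^sub>\<infinity>\<close>.
\<close>

lemma sigma_conv_qpoch:
  assumes "Im \<tau> > 0"
  shows "sigma \<tau> z = - inverse (y_half z) * qpoch (nome \<tau>) (y_of z) *
           qpoch (nome \<tau>) (nome \<tau> * inverse (y_of z)) / qpoch (nome \<tau>) (nome \<tau>) ^ 2"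
proof -
  note q = norm_nome_less_1[OF assms]
  note c = prodinf_conv_qpoch[OF q]
  have "qpoch (nome \<tau>) (nome \<tau> * y_of z) * qpoch (nome \<tau>) (nome \<tau> * inverse (y_of z)) /
      qpoch (nome \<tau>) (nome \<tau> * 1) ^ 2 =
    (\<Prod>m. (1 - nome \<tau> ^ Suc m * y_of z) * (1 - nome \<tau> ^ Suc m * inverse (y_of z)) /
      (1 - nome \<tau> ^ Suc m * 1) ^ 2)"
    unfolding c(1)[symmetric]
    by (simp only: prodinf_divide prodinf_mult prodinf_power[symmetric] c(2) convergent_prod_mult convergent_prod_power)
  then have "sigma \<tau> z = (y_half z - inverse (y_half z)) * (qpoch (nome \<tau>) (nome \<tau> * y_of z) * qpoch (nome \<tau>) (nome \<tau> * inverse (y_of z)) / 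
      qpoch (nome \<tau>) (nome \<tau>) ^ 2)"
    unfolding sigma_def by simp
  moreover have "y_half z - inverse (y_half z) = - inverse (y_half z) * (1 - y_of z)"
    by (simp add: y_of_conv_y_half field_simps power2_eq_square)
  ultimately show ?thesis
    by (simp add: qpoch_rec[OF q, of "y_of z"])
qed

lemma sigma_shift_1:
  assumes "Im \<tau> > 0"
  shows "sigma \<tau> (z + 1) = - sigma \<tau> z"
  using y_of_int[of 1] by (simp add: sigma_conv_qpoch[OF assms] y_of_add y_half_add y_half_1)

text \<open>
The shift replaces \<open>y\<close> by \<open>q y\<close>.  Then \<open>(y; q)\<^sub>\<infinity>\<close> loses the factor \<open>1 - y\<close> and \<open>(q/y; q)\<^sub>\<infinity>\<close> gains
\<open>1 - 1/y\<close>, and the quotient of these is \<open>- 1/y\<close>.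
\<close>

lemma sigma_shift_tau:
  assumes "Im \<tau> > 0"
  shows "sigma \<tau> (z + \<tau>) = - inverse (y_half \<tau> * y_of z) * sigma \<tau> z"
proof -
  note q = norm_nome_less_1[OF assms]
  define Q where "Q = nome \<tau>"
  have [simp]: "Q \<noteq> 0" by (simp add: Q_def)
  have y: "y_of (z + \<tau>) = Q * y_of z" by (simp add: y_of_add nome_conv_y_of Q_def)
  have 1: "qpoch Q (y_of z) = (1 - y_of z) * qpoch Q (Q * y_of z)"
    and 2: "qpoch Q (inverse (y_of z)) = (1 - inverse (y_of z)) * qpoch Q (Q * inverse (y_of z))"
    unfolding Q_def by (rule qpoch_rec[OF q])+
  have 3: "Q * inverse (Q * y_of z) = inverse (y_of z)" by (simp add: field_simps)
  have 4: "- inverse (h * H) * A * ((1 - inverse (H ^ 2)) * B) / C =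
      - inverse (h * H ^ 2) * (- inverse H * ((1 - H ^ 2) * A) * B / C)"
    if "H \<noteq> 0" "h \<noteq> 0" for h H A B C :: complex
  proof -
    have "1 - inverse (H ^ 2) = - inverse (H ^ 2) * (1 - H ^ 2)"
      using that by (simp add: field_simps)
    then show ?thesis by (simp add: mult_ac)
  qed
  show ?thesis
    using 4[of "y_half z" "y_half \<tau>" "qpoch Q (Q * y_of z)" "qpoch Q (Q * inverse (y_of z))" "qpoch Q Q ^ 2"]
    unfolding sigma_conv_qpoch[OF assms] y Q_def[symmetric] 3 1 2 y_half_add
    by (simp add: y_of_conv_y_half mult_ac)
qed

lemma sigma_minus: "sigma \<tau> (- z) = - sigma \<tau> z"
proof -
  have "(\<lambda>m. (1 - nome \<tau> ^ Suc m * inverse (y_of z)) * (1 - nome \<tau> ^ Suc m * y_of z) / (1 - nome \<tau> ^ Suc m) ^ 2) =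
    (\<lambda>m. (1 - nome \<tau> ^ Suc m * y_of z) * (1 - nome \<tau> ^ Suc m * inverse (y_of z)) / (1 - nome \<tau> ^ Suc m) ^ 2)"
    by (simp only: mult.commute)
  then show ?thesis
    unfolding sigma_def y_half_minus y_of_minus inverse_inverse_eq
    by (simp add: minus_mult_left del: power_Suc)
qed

text \<open>
The translation factor of \<open>\<sigma>\<close>, with the sign \<open>(-1)\<^sup>m\<^sup>+\<^sup>n\<close> written as an exponential: an identity
between such factors then says that two exponents differ by an even integer.
\<close>

definition theta_lat :: "complex \<Rightarrow> complex \<Rightarrow> complex \<Rightarrow> complex \<Rightarrow> complex" where
  "theta_lat m n \<tau> z = exp (of_real pi * \<i> * (m + n - 2 * n * z - n ^ 2 * \<tau>))"

fun theta_sl2 :: "mat2 \<Rightarrow> complex \<Rightarrow> complex \<Rightarrow> complex" where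
  "theta_sl2 (a, b, c, d) \<tau> z = exp (of_real pi * \<i> * (of_int c * z ^ 2 / (of_int c * \<tau> + of_int d)))"

lemma exp_pi_i_cong:
  assumes "A - B = 2 * of_int k"
  shows "exp (of_real pi * \<i> * A) = exp (of_real pi * \<i> * B)"
proof -
  have "A = B + 2 * of_int k" using assms by (simp add: algebra_simps)
  then have "of_real pi * \<i> * A = of_real pi * \<i> * B + 2 * of_real pi * \<i> * of_int k"
    by (simp add: algebra_simps)
  then show ?thesis
    using exp_integer_2pi[of "of_int k"] by (simp add: exp_add mult_ac)
qed

lemma sigma_shift_int:
  assumes "Im \<tau> > 0"
  shows "sigma \<tau> (z + of_int m) = exp (of_real pi * \<i> * of_int m) * sigma \<tau> z"
proof (induction m rule: int_induct[where k = 0])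
  case (step1 i)
  then show ?case
    using sigma_shift_1[OF assms, of "z + of_int i"]
    by (simp add: ring_distribs exp_add mult.commute[of \<i>] add_ac) 
next
  case (step2 i)
  have "exp (of_real pi * \<i> * of_int (i - 1)) = - exp (of_real pi * \<i> * of_int i)"
    by (simp add: right_diff_distrib exp_diff)
  then show ?case
    using sigma_shift_1[OF assms, of "z + of_int (i - 1)"] step2
    by (simp add: add_ac)
qed simp

lemma theta_lat_step:
  "theta_lat 0 (n + 1) \<tau> z = - inverse (y_half \<tau> * y_of (z + n * \<tau>)) * theta_lat 0 n \<tau> z"
proof -
  have "theta_lat 0 (n + 1) \<tau> z = y_half 1 * (inverse (y_half \<tau> * y_of (z + n * \<tau>)) * theta_lat 0 n \<tau> z)"
    unfolding y_half_def y_of_def theta_lat_def exp_minus[symmetric] exp_add[symmetric]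
    by (rule arg_cong[of _ _ exp]) (simp add: algebra_simps power2_eq_square)
  then show ?thesis by (simp add: y_half_1)
qed

lemma sigma_shift_int_tau:
  assumes "Im \<tau> > 0"
  shows "sigma \<tau> (z + of_int n * \<tau>) = theta_lat 0 (of_int n) \<tau> z * sigma \<tau> z"
proof (induction n rule: int_induct[where k = 0])
  case base
  show ?case by (simp add: theta_lat_def)
next
  case (step1 i)
  then show ?case
    using sigma_shift_tau[OF assms, of "z + of_int i * \<tau>"] theta_lat_step[of "of_int i" \<tau> z]
    by (simp add: algebra_simps)
next
  case (step2 i)
  define w where "w = z + of_int (i - 1) * \<tau>"
  have "w + \<tau> = z + of_int i * \<tau>" by (simp add: w_def algebra_simps)
  with sigma_shift_tau[OF assms, of w]
  have "- inverse (y_half \<tau> * y_of w) * sigma \<tau> w = theta_lat 0 (of_int i) \<tau> z * sigma \<tau> z"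
    using step2 by simp
  also have "\<dots> = - inverse (y_half \<tau> * y_of w) * (theta_lat 0 (of_int (i - 1)) \<tau> z * sigma \<tau> z)"
    using theta_lat_step[of "of_int (i - 1)" \<tau> z] by (simp add: w_def)
  finally show ?case by (simp add: w_def)
qed

text \<open>
The factors for translation by \<open>m\<close> and by \<open>n \<tau>\<close> combine to \<open>theta_lat\<close> because their exponents
differ from it by the even integer \<open>2 n m\<close> only.
\<close>

lemma sigma_lat:
  assumes "Im \<tau> > 0" "m \<in> \<int>" "n \<in> \<int>"
  shows "sigma \<tau> (z + m + \<tau> * n) = theta_lat m n \<tau> z * sigma \<tau> z"
proof -
  obtain m' n' where "m = of_int m'" "n = of_int n'" using assms by (auto elim!: Ints_cases)
  then have "sigma \<tau> (z + m + \<tau> * n) = theta_lat 0 n \<tau> (z + m) * sigma \<tau> (z + m)"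
    using sigma_shift_int_tau[OF assms(1), of "z + m" n'] by (simp add: mult_ac)
  also have "sigma \<tau> (z + m) = exp (of_real pi * \<i> * m) * sigma \<tau> z"
    using sigma_shift_int[OF assms(1)] \<open>m = _\<close> by simp
  also have "theta_lat 0 n \<tau> (z + m) = exp (of_real pi * \<i> * (n - 2 * n * z - n ^ 2 * \<tau>))"
    unfolding theta_lat_def
    by (rule exp_pi_i_cong[of _ _ "- n' * m'"]) (simp add: \<open>m = _\<close> \<open>n = _\<close> algebra_simps)
  finally show ?thesis
    by (simp add: theta_lat_def exp_add[symmetric] algebra_simps)
qed

lemma y_of_eq_1_iff: "y_of z = 1 \<longleftrightarrow> z \<in> \<int>"
proof -
  have "y_of z = 1 \<longleftrightarrow> (\<exists>n::int. 2 * of_real pi * \<i> * z = of_int (2 * n) * of_real pi * \<i>)"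
    unfolding y_of_def exp_eq_1 by (auto simp: complex_eq_iff) 
  also have "\<dots> \<longleftrightarrow> (\<exists>n::int. z = of_int n)" by (auto simp: field_simps)
  finally show ?thesis by (auto elim: Ints_cases)
qed

text \<open>
A convergent infinite product vanishes only if one of its factors does, and a vanishing factor says
that \<open>y\<close> is an integral power of \<open>q\<close>.
\<close>

lemma sigma_eq_0_imp:
  assumes "Im \<tau> > 0" "sigma \<tau> z = 0"
  obtains m n where "m \<in> \<int>" "n \<in> \<int>" "z = m + \<tau> * n"
proof -
  note q = norm_nome_less_1[OF assms(1)]
  have pow: "nome \<tau> ^ k = y_of (\<tau> * of_nat k)" for k
    by (simp add: nome_def y_of_def exp_of_nat_mult[symmetric] mult_ac)
  from assms have "qpoch (nome \<tau>) (y_of z) = 0 \<or> qpoch (nome \<tau>) (nome \<tau> * inverse (y_of z)) = 0"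
    using qpoch_self_nonzero[OF q] by (auto simp: sigma_conv_qpoch)
  then have "\<exists>n\<in>\<int>. y_of (z + \<tau> * n) = 1"
  proof
    assume "qpoch (nome \<tau>) (y_of z) = 0"
    with q obtain k where "y_of z * nome \<tau> ^ k = 1" by (rule qpoch_eq_0_imp)
    then show ?thesis by (intro bexI[of _ "of_nat k"]) (auto simp: pow y_of_add)
  next
    assume "qpoch (nome \<tau>) (nome \<tau> * inverse (y_of z)) = 0"
    with q obtain k where "nome \<tau> * inverse (y_of z) * nome \<tau> ^ k = 1" by (rule qpoch_eq_0_imp)
    then have "nome \<tau> ^ Suc k = y_of z" by (simp add: field_simps)
    then have "y_of (\<tau> * - of_nat (Suc k)) = inverse (y_of z)"
      by (simp only: pow mult_minus_right y_of_minus)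
    then show ?thesis by (intro bexI[of _ "- of_nat (Suc k)"]) (auto simp: y_of_add diff_conv_add_uminus simp del: of_nat_Suc add_uminus_conv_diff)
  qed
  then obtain n where n: "n \<in> \<int>" "z + \<tau> * n \<in> \<int>" by (auto simp: y_of_eq_1_iff)
  then show ?thesis by (intro that[of "z + \<tau> * n" "- n"]) auto
qed

lemma sigma_lattice_0:
  assumes "Im \<tau> > 0" "m \<in> \<int>" "n \<in> \<int>"
  shows "sigma \<tau> (m + \<tau> * n) = 0"
  using sigma_lat[OF assms, of 0] by (simp add: sigma_def y_half_def)

lemma holomorphic_on_sigma [holomorphic_intros]:
  assumes "open S" "f holomorphic_on S" "g holomorphic_on S" "\<And>x. x \<in> S \<Longrightarrow> Im (f x) > 0"
  shows "(\<lambda>x. sigma (f x) (g x)) holomorphic_on S"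
proof -
  have h: "(\<lambda>x. nome (f x)) holomorphic_on S" "(\<lambda>x. y_of (g x)) holomorphic_on S"
    "(\<lambda>x. y_half (g x)) holomorphic_on S"
    unfolding nome_def y_of_def y_half_def by (intro holomorphic_intros assms)+
  have "(\<lambda>z. - inverse (y_half (g z)) * qpoch (nome (f z)) (y_of (g z)) *
           qpoch (nome (f z)) (nome (f z) * inverse (y_of (g z))) / qpoch (nome (f z)) (nome (f z)) ^ 2) holomorphic_on S"
    by (intro holomorphic_intros h assms norm_nome_less_1) (simp_all add: qpoch_self_nonzero assms norm_nome_less_1)
  then show ?thesis
    by (rule holomorphic_transform) (simp add: sigma_conv_qpoch assms)
qed

lemma continuous_on_sigma [continuous_intros]:
  assumes "continuous_on S f" "continuous_on S g" "\<And>x. x \<in> S \<Longrightarrow> Im (f x) > 0"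
  shows "continuous_on S (\<lambda>x. sigma (f x) (g x))"
proof -
  have h: "continuous_on S (\<lambda>x. nome (f x))" "continuous_on S (\<lambda>x. y_of (g x))"
    "continuous_on S (\<lambda>x. y_half (g x))"
    unfolding nome_def y_of_def y_half_def by (intro continuous_intros assms)+
  have "continuous_on S (\<lambda>z. - inverse (y_half (g z)) * qpoch (nome (f z)) (y_of (g z)) *
           qpoch (nome (f z)) (nome (f z) * inverse (y_of (g z))) / qpoch (nome (f z)) (nome (f z)) ^ 2)"
    by (intro continuous_intros h ballI assms norm_nome_less_1) (simp_all add: qpoch_self_nonzero assms norm_nome_less_1)
  then show ?thesis
    by (rule continuous_on_eq) (simp add: sigma_conv_qpoch assms)
qed

lemma sigma_has_derivative:
  assumes "Im \<tau> > 0"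
  obtains D1 D2 where
    "((\<lambda>(t, w). sigma t w) has_derivative (\<lambda>(u, v). D1 * u + D2 * v)) (at (\<tau>, z))"
proof (rule Osgood[of "{\<tau>. Im \<tau> > 0}" UNIV sigma \<tau> z])
  show "open {\<tau>. Im \<tau> > 0}" by (simp add: open_halfspace_Im_gt)
  then show "(\<lambda>x. sigma x y) holomorphic_on {\<tau>. 0 < Im \<tau>}" for y
    by (intro holomorphic_intros) auto
  show "continuous_on ({\<tau>. 0 < Im \<tau>} \<times> UNIV) (\<lambda>(x, y). sigma x y)"
    unfolding case_prod_unfold by (intro continuous_intros) auto
  show "sigma x holomorphic_on UNIV" if "x \<in> {\<tau>. 0 < Im \<tau>}" for x
    using holomorphic_on_sigma[of UNIV "\<lambda>_. x" "\<lambda>z. z"] that by auto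
qed (use assms that in auto)

text \<open>
The normalisation of \<open>\<sigma>\<close>: dividing by \<open>(q; q)\<^sub>\<infinity>\<^sup>2\<close> makes the derivative at \<open>0\<close> independent of \<open>\<tau>\<close>.
This determines the weight of \<open>\<sigma>\<close> under \<open>SL2Z\<close>.
\<close>

lemma deriv_sigma_0:
  assumes "Im \<tau> > 0"
  shows "(sigma \<tau> has_field_derivative 2 * of_real pi * \<i>) (at 0)"
proof -
  note q = norm_nome_less_1[OF assms]
  define g where "g = (\<lambda>z. qpoch (nome \<tau>) (nome \<tau> * y_of z) *
           qpoch (nome \<tau>) (nome \<tau> * inverse (y_of z)) / qpoch (nome \<tau>) (nome \<tau>) ^ 2)"
  define e where "e = (\<lambda>z. - inverse (y_half z) * (1 - y_of z))"
  have sig: "sigma \<tau> z = e z * g z" for z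
    unfolding sigma_conv_qpoch[OF assms] g_def e_def by (simp add: qpoch_rec[OF q, of "y_of z"])
  have "g holomorphic_on UNIV"
    unfolding g_def y_of_def
    by (intro holomorphic_intros) (auto simp: q qpoch_self_nonzero)
  then have g: "(g has_field_derivative deriv g 0) (at 0)"
    by (auto intro: holomorphic_derivI)
  have "(e has_field_derivative 2 * of_real pi * \<i>) (at 0)"
    unfolding e_def y_half_def y_of_def by (auto intro!: derivative_eq_intros)
  from DERIV_mult[OF this g] have "((\<lambda>z. e z * g z) has_field_derivative 2 * of_real pi * \<i> * g 0) (at 0)"
    by (simp add: e_def y_of_def)
  moreover have "g 0 = 1" using qpoch_self_nonzero[OF q] by (simp add: g_def y_of_def power2_eq_square)
  ultimately show ?thesis by (simp add: sig[abs_def])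
qed

section \<open>Modularity of the sigma function\<close>

fun moebius :: "mat2 \<Rightarrow> complex \<Rightarrow> complex" where
  "moebius (a, b, c, d) \<tau> = (of_int a * \<tau> + of_int b) / (of_int c * \<tau> + of_int d)"

lemma SL2Z_det:
  assumes "(a, b, c, d) \<in> SL2Z"
  shows "a * d - b * c = 1" and "of_int a * of_int d - of_int b * of_int c = (1::complex)"
proof -
  show "a * d - b * c = 1" using assms by (simp add: SL2Z_def)
  then show "of_int a * of_int d - of_int b * of_int c = (1::complex)"
    by (metis of_int_1 of_int_diff of_int_mult)
qed

lemma denom_nonzero:
  assumes "\<gamma> \<in> SL2Z" "Im \<tau> > 0"
  shows "denom \<gamma> \<tau> \<noteq> 0"
proof -
  obtain a b c d where g: "\<gamma> = (a, b, c, d)" by (cases \<gamma>)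
  have "c \<noteq> 0 \<or> d \<noteq> 0" using SL2Z_det(1)[OF assms(1)[unfolded g]] by auto
  with assms(2) show ?thesis by (auto simp: g complex_eq_iff)
qed

lemma Im_moebius:
  assumes "\<gamma> \<in> SL2Z" "Im \<tau> > 0"
  shows "Im (moebius \<gamma> \<tau>) > 0"
proof -
  obtain a b c d where g: "\<gamma> = (a, b, c, d)" by (cases \<gamma>)
  define J where "J = of_int c * \<tau> + of_int d"
  have J: "J \<noteq> 0" using denom_nonzero[OF assms] by (simp add: g J_def)
  have det: "real_of_int a * of_int d - of_int b * of_int c = 1"
    using SL2Z_det(1)[OF assms(1)[unfolded g]] by (metis of_int_1 of_int_diff of_int_mult)
  have "Im (moebius \<gamma> \<tau>) = Im ((of_int a * \<tau> + of_int b) * cnj J) / (cmod J)^2"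
    by (simp add: g J_def Im_complex_div_eq_0 complex_div_cnj[of _ J, unfolded J_def])
  also have "Im ((of_int a * \<tau> + of_int b) * cnj J) = (real_of_int a * of_int d - of_int b * of_int c) * Im \<tau>"
    by (simp add: J_def algebra_simps)
  finally show ?thesis using J assms(2) by (simp add: det)
qed

lemma mat2_mult_SL2Z:
  assumes "\<gamma>1 \<in> SL2Z" "\<gamma>2 \<in> SL2Z"
  shows "mat2_mult \<gamma>1 \<gamma>2 \<in> SL2Z"
proof -
  obtain a b c d a' b' c' d' where "\<gamma>1 = (a, b, c, d)" "\<gamma>2 = (a', b', c', d')"
    by (cases \<gamma>1, cases \<gamma>2)
  moreover have "(a * a' + b * c') * (c * b' + d * d') - (a * b' + b * d') * (c * a' + d * c') =
      (a * d - b * c) * (a' * d' - b' * c')" by (simp add: algebra_simps)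
  ultimately show ?thesis using assms by (simp add: SL2Z_def)
qed

lemma denom_mult:
  assumes "\<gamma>2 \<in> SL2Z" "Im \<tau> > 0"
  shows "denom (mat2_mult \<gamma>1 \<gamma>2) \<tau> = denom \<gamma>1 (moebius \<gamma>2 \<tau>) * denom \<gamma>2 \<tau>"
proof -
  obtain a b c d a' b' c' d' where g: "\<gamma>1 = (a, b, c, d)" "\<gamma>2 = (a', b', c', d')"
    by (cases \<gamma>1, cases \<gamma>2)
  have "of_int c' * \<tau> + of_int d' \<noteq> 0" using denom_nonzero[OF assms] by (simp add: g)
  then show ?thesis by (simp add: g field_simps)
qed

lemma theta_lat_nonzero [simp]: "theta_lat m n \<tau> z \<noteq> 0"
  by (simp add: theta_lat_def)

lemma theta_sl2_nonzero [simp]: "theta_sl2 \<gamma> \<tau> z \<noteq> 0"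
  by (cases \<gamma>) simp

lemma theta_lat_add:
  assumes "m2 \<in> \<int>" "n1 \<in> \<int>"
  shows "theta_lat (m1 + m2) (n1 + n2) \<tau> z =
    theta_lat m1 n1 \<tau> (z + m2 + \<tau> * n2) * theta_lat m2 n2 \<tau> z"
proof -
  obtain k l where kl: "m2 = of_int k" "n1 = of_int l" using assms by (auto elim!: Ints_cases)
  show ?thesis
    unfolding theta_lat_def exp_add[symmetric] distrib_left[symmetric]
    \<comment> \<open>The exponents differ by \<open>2 n\<^sub>1 m\<^sub>2\<close>.\<close>
    by (rule exp_pi_i_cong[of _ _ "k * l"]) (simp add: kl algebra_simps power2_eq_square)
qed

lemma theta_lat_sign:
  assumes "m \<in> \<int>" "n \<in> \<int>" "s \<in> {1, -1}"
  shows "theta_lat (s * m) (s * n) \<tau> (s * z) = theta_lat m n \<tau> z"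
proof (cases "s = 1")
  case False
  with assms(3) have s: "s = -1" by simp
  obtain k l where kl: "m = of_int k" "n = of_int l" using assms by (auto elim!: Ints_cases)
  show ?thesis
    unfolding theta_lat_def
    by (rule exp_pi_i_cong[of _ _ "- k - l"]) (simp add: kl s algebra_simps power2_eq_square)
qed simp

lemma theta_sl2_sign:
  assumes "s \<in> {1, -1}"
  shows "theta_sl2 \<gamma> \<tau> (s * z) = theta_sl2 \<gamma> \<tau> z"
  using assms by (cases \<gamma>) auto

text \<open>
With \<open>J1\<close> and \<open>J2\<close> the two denominators, the exponents agree because the lower left entry \<open>c\<^sub>1\<^sub>2\<close> of the
product satisfies \<open>c\<^sub>1\<^sub>2 J2 = c + c' J1 J2\<close>, which is the determinant condition.
\<close>

lemma theta_sl2_mult: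
  assumes "\<gamma>1 \<in> SL2Z" "\<gamma>2 \<in> SL2Z" "Im \<tau> > 0"
  shows "theta_sl2 (mat2_mult \<gamma>1 \<gamma>2) \<tau> z =
    theta_sl2 \<gamma>1 (moebius \<gamma>2 \<tau>) (1 / denom \<gamma>2 \<tau> * z) * theta_sl2 \<gamma>2 \<tau> z"
proof -
  obtain a b c d a' b' c' d' where g: "\<gamma>1 = (a, b, c, d)" "\<gamma>2 = (a', b', c', d')"
    by (cases \<gamma>1, cases \<gamma>2)
  define J1 J2 where "J1 = denom \<gamma>1 (moebius \<gamma>2 \<tau>)" and "J2 = denom \<gamma>2 \<tau>"
  have J: "J1 \<noteq> 0" "J2 \<noteq> 0"
    using denom_nonzero[OF assms(1) Im_moebius[OF assms(2,3)]] denom_nonzero[OF assms(2,3)]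
    by (auto simp: J1_def J2_def)
  have J12: "of_int (c * a' + d * c') * \<tau> + of_int (c * b' + d * d') = J1 * J2"
    using denom_mult[OF assms(2,3), of \<gamma>1] by (simp add: g J1_def J2_def)
  have J1': "of_int c * moebius \<gamma>2 \<tau> + of_int d = J1" and J2': "of_int c' * \<tau> + of_int d' = J2"
    by (simp_all add: J1_def J2_def g)
  have "of_int (c * a' + d * c') * (of_int c' * \<tau> + of_int d') =
      of_int c + of_int c' * (of_int (c * a' + d * c') * \<tau> + of_int (c * b' + d * d'))"
    unfolding of_int_add of_int_mult using SL2Z_det(2)[OF assms(2)[unfolded g]] by algebra
  then have "of_int (c * a' + d * c') * J2 = of_int c + of_int c' * (J1 * J2)"
    unfolding J12 J2' .
  then have "of_int (c * a' + d * c') * z ^ 2 / (J1 * J2) =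
      of_int c * (1 / J2 * z) ^ 2 / J1 + of_int c' * z ^ 2 / J2"
    using J by (simp add: divide_simps power2_eq_square) algebra
  then have *: "of_real pi * \<i> * (of_int (c * a' + d * c') * z ^ 2 / (J1 * J2)) =
      of_real pi * \<i> * (of_int c * (1 / J2 * z) ^ 2 / J1) + of_real pi * \<i> * (of_int c' * z ^ 2 / J2)"
    by (simp only: distrib_left)
  have "theta_sl2 (mat2_mult \<gamma>1 \<gamma>2) \<tau> z = exp (of_real pi * \<i> * (of_int (c * a' + d * c') * z ^ 2 / (J1 * J2)))"
    unfolding g mat2_mult.simps theta_sl2.simps J12 ..
  also have "\<dots> = theta_sl2 \<gamma>1 (moebius \<gamma>2 \<tau>) (1 / J2 * z) * theta_sl2 \<gamma>2 \<tau> z"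
    unfolding * exp_add unfolding g(1) g(2)[symmetric] theta_sl2.simps J1' unfolding g(2) theta_sl2.simps J2' ..
  finally show ?thesis unfolding J2_def .
qed

text \<open>
The compatibility of translations with \<open>SL2Z\<close>.  The exponents of both sides differ by an integer, whose
parity is that of \<open>(a + 1)(c + 1) m + (b + 1)(d + 1) n\<close>.  This is even, because \<open>ad - bc = 1\<close> prevents
\<open>a, c\<close> and also \<open>b, d\<close> from being both even.
\<close>

lemma theta_mixed:
  assumes "(a, b, c, d) \<in> SL2Z" "Im \<tau> > 0" "m \<in> \<int>" "n \<in> \<int>"
  shows "theta_lat (of_int a * m - of_int b * n) (of_int d * n - of_int c * m)
      (moebius (a, b, c, d) \<tau>) (1 / denom (a, b, c, d) \<tau> * z) * theta_sl2 (a, b, c, d) \<tau> z =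
    theta_sl2 (a, b, c, d) \<tau> (z + m + \<tau> * n) * theta_lat m n \<tau> z"
proof -
  obtain k l where kl: "m = of_int k" "n = of_int l" using assms by (auto elim!: Ints_cases)
  note det = SL2Z_det[OF assms(1)]
  define A B C D where "A = complex_of_int a" "B = complex_of_int b" "C = complex_of_int c" "D = complex_of_int d"
  define J where "J = C * \<tau> + D"
  have J: "J \<noteq> 0" using denom_nonzero[OF assms(1,2)] by (simp add: J_def A_B_C_D_def)
  have det': "A * D - B * C = 1" using det(2) by (simp add: A_B_C_D_def)
  \<comment> \<open>The difference of the two exponents, found by expanding both sides over the denominator \<open>J\<close>.\<close>
  define K where "K = (a - c - 1) * k - a * c * k ^ 2 + 2 * (b * c * k * l) + ((d - b - 1) * l - b * d * l ^ 2)"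
  have "odd (a * d - b * c)" using det(1) by simp
  then have "even K" unfolding K_def by auto
  then obtain K' where K': "K = 2 * K'" by blast
  define N where "N = D * n - C * m"
  define L where "L = A * m - B * n + N - 2 * N * (1 / J * z) - N ^ 2 * ((A * \<tau> + B) / J) + C * z ^ 2 / J"
  define R where "R = C * (z + m + \<tau> * n) ^ 2 / J + (m + n - 2 * n * z - n ^ 2 * \<tau>)"
  define K2 where "K2 = (A - C - 1) * m - A * C * m ^ 2 + 2 * (B * C * m * n) + ((D - B - 1) * n - B * D * n ^ 2)"
  have LJ: "L * J = (A * m - B * n + N) * J - 2 * N * z - N ^ 2 * (A * \<tau> + B) + C * z ^ 2"
    and RJ: "R * J = C * (z + m + \<tau> * n) ^ 2 + (m + n - 2 * n * z - n ^ 2 * \<tau>) * J"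
  proof -
    have f: "(1 / J * z) * J = z" "(A * \<tau> + B) / J * J = A * \<tau> + B" "C * v / J * J = C * v" for v
      using J by simp_all
    have "(A * m - B * n + N - 2 * N * X - N ^ 2 * Y + W) * J =
        (A * m - B * n + N) * J - 2 * N * (X * J) - N ^ 2 * (Y * J) + W * J" for X Y W
      by algebra
    then show "L * J = (A * m - B * n + N) * J - 2 * N * z - N ^ 2 * (A * \<tau> + B) + C * z ^ 2"
      unfolding L_def by (simp only: f)
    show "R * J = C * (z + m + \<tau> * n) ^ 2 + (m + n - 2 * n * z - n ^ 2 * \<tau>) * J"
      unfolding R_def distrib_right by (simp only: f distrib_right)
  qed
  have "L * J - R * J = K2 * J"
    unfolding LJ RJ unfolding K2_def N_def J_def using det' by algebra
  then have "(L - R) * J = K2 * J" by (simp only: left_diff_distrib)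
  then have "L - R = K2" using J by simp
  also have "K2 = of_int K" unfolding K2_def K_def kl by (simp add: A_B_C_D_def)
  finally have "L - R = 2 * of_int K'" by (simp add: K')
  then have "exp (of_real pi * \<i> * L) = exp (of_real pi * \<i> * R)" by (rule exp_pi_i_cong)
  then show ?thesis
    unfolding theta_lat_def theta_sl2.simps moebius.simps denom.simps exp_add[symmetric] distrib_left[symmetric]
      A_B_C_D_def[symmetric] J_def[symmetric] N_def[symmetric]
    unfolding L_def R_def by simp
qed

text \<open>
The map \<open>z \<mapsto> z / (c \<tau> + d)\<close> carries the lattice of \<open>\<tau>\<close> to that of \<open>\<gamma> \<tau>\<close>.
\<close>

lemma lattice_moebius:
  assumes "(a, b, c, d) \<in> SL2Z" "Im \<tau> > 0"
  shows "1 / denom (a, b, c, d) \<tau> * (z + m + \<tau> * n) =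
    1 / denom (a, b, c, d) \<tau> * z + (of_int a * m - of_int b * n) +
    moebius (a, b, c, d) \<tau> * (of_int d * n - of_int c * m)"
proof -
  define A B C D where "A = complex_of_int a" "B = complex_of_int b" "C = complex_of_int c" "D = complex_of_int d"
  define J where "J = C * \<tau> + D"
  have J: "J \<noteq> 0" using denom_nonzero[OF assms] by (simp add: J_def A_B_C_D_def)
  have "z + m + \<tau> * n = z + (A * m - B * n) * J + (A * \<tau> + B) * (D * n - C * m)"
    unfolding J_def using SL2Z_det(2)[OF assms(1)] unfolding A_B_C_D_def by algebra
  then have "1 / J * (z + m + \<tau> * n) = 1 / J * z + (A * m - B * n) + (A * \<tau> + B) / J * (D * n - C * m)"
    by (simp only:) (use J in \<open>simp add: divide_simps\<close>)
  then show ?thesis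
    unfolding moebius.simps denom.simps A_B_C_D_def[symmetric] J_def[symmetric] .
qed

text \<open>
The functions \<open>N\<close> and \<open>D\<close> have the same translation factors and the same simple zeros, so their
quotient extends to a doubly periodic entire function \<open>h\<close>.  It is bounded, hence constant by
Liouville's theorem, and its value at \<open>0\<close> is the quotient \<open>1 / j\<close> of the derivatives there.
\<close>

theorem sigma_modular:
  assumes "\<gamma> \<in> SL2Z" "Im \<tau> > 0"
  shows "sigma (moebius \<gamma> \<tau>) (1 / denom \<gamma> \<tau> * z) = theta_sl2 \<gamma> \<tau> z / denom \<gamma> \<tau> * sigma \<tau> z"
proof -
  obtain a b c d where g: "\<gamma> = (a, b, c, d)" by (cases \<gamma>)
  note gS = assms(1)[unfolded g]
  define j where "j = denom \<gamma> \<tau>"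
  have j: "j \<noteq> 0" using denom_nonzero[OF assms] by (simp add: j_def)
  note Im' = Im_moebius[OF assms]
  define N where "N = (\<lambda>z. sigma (moebius \<gamma> \<tau>) (1 / j * z))"
  define D where "D = (\<lambda>z. theta_sl2 \<gamma> \<tau> z * sigma \<tau> z)"
  define e where "e = (\<lambda>m n z. theta_lat (of_int a * m - of_int b * n) (of_int d * n - of_int c * m)
      (moebius \<gamma> \<tau>) (1 / j * z))"
  have e: "e m n z \<noteq> 0" for m n z by (simp add: e_def)
  have N_shift: "N (z + m + \<tau> * n) = e m n z * N z" if "m \<in> \<int>" "n \<in> \<int>" for m n z
  proof -
    have "N (z + m + \<tau> * n) = sigma (moebius \<gamma> \<tau>) (1 / j * z + (of_int a * m - of_int b * n) +
        moebius \<gamma> \<tau> * (of_int d * n - of_int c * m))"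
      unfolding N_def j_def using lattice_moebius[OF gS assms(2)] by (simp only: g)
    also have "\<dots> = e m n z * N z"
      unfolding e_def N_def using Im' that by (intro sigma_lat) auto
    finally show ?thesis .
  qed
  have D_shift: "D (z + m + \<tau> * n) = e m n z * D z" if "m \<in> \<int>" "n \<in> \<int>" for m n z
    unfolding D_def e_def using theta_mixed[OF gS assms(2) that, of z] sigma_lat[OF assms(2) that, of z]
    by (simp add: g j_def)
  have sig0: "sigma \<tau> (z + m + \<tau> * n) = 0 \<longleftrightarrow> sigma \<tau> z = 0" if "m \<in> \<int>" "n \<in> \<int>" for m n z
    using sigma_lat[OF assms(2) that] by simp
  have sigma_at_0 [simp]: "sigma \<tau> 0 = 0" "N 0 = 0" "D 0 = 0"
    using sigma_lattice_0[OF assms(2), of 0 0] sigma_lattice_0[OF Im', of 0 0] by (auto simp: N_def D_def)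
  \<comment> \<open>By periodicity the value that makes \<open>h\<close> continuous at \<open>0\<close> is the right one at every zero.\<close>
  define h where "h = (\<lambda>z. if sigma \<tau> z = 0 then 1 / j else N z / D z)"
  have h_shift: "h (z + m + \<tau> * n) = h z" if "m \<in> \<int>" "n \<in> \<int>" for m n z
    unfolding h_def N_shift[OF that] D_shift[OF that] sig0[OF that] using e by simp
  have N_hol: "N holomorphic_on UNIV" and sig_hol: "sigma \<tau> holomorphic_on UNIV"
    unfolding N_def using Im' assms(2) holomorphic_on_sigma[of UNIV "\<lambda>_. \<tau>" "\<lambda>z. z"]
    by (auto intro!: holomorphic_intros)
  have theta_hol: "theta_sl2 \<gamma> \<tau> holomorphic_on UNIV"
    unfolding g theta_sl2.simps[abs_def] using j unfolding j_def g denom.simps by (intro holomorphic_intros)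
  have D_hol: "D holomorphic_on UNIV"
    unfolding D_def by (intro holomorphic_intros theta_hol sig_hol)
  have "(N has_field_derivative 2 * of_real pi * \<i> * (1 / j)) (at 0)"
    unfolding N_def
    by (rule DERIV_chain2[OF _ DERIV_cmult_Id]) (use deriv_sigma_0[OF Im'] in simp)
  then have N0: "((\<lambda>z. N z / z) \<longlongrightarrow> 2 * of_real pi * \<i> * (1 / j)) (at 0)"
    by (simp add: has_field_derivative_iff)
  have s0: "((\<lambda>z. sigma \<tau> z / z) \<longlongrightarrow> 2 * of_real pi * \<i>) (at 0)"
    using deriv_sigma_0[OF assms(2)] by (simp add: has_field_derivative_iff)
  have ev: "eventually (\<lambda>z. sigma \<tau> z \<noteq> 0) (at 0)"
    using tendsto_imp_eventually_ne[OF s0, of 0] by (auto elim: eventually_mono)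
  have "isCont (theta_sl2 \<gamma> \<tau>) 0"
    using holomorphic_on_imp_continuous_on[OF theta_hol] by (simp add: continuous_on_eq_continuous_at)
  then have t0: "(theta_sl2 \<gamma> \<tau> \<longlongrightarrow> 1) (at 0)" by (simp add: isCont_def g)
  have "((\<lambda>z. (N z / z) / (theta_sl2 \<gamma> \<tau> z * (sigma \<tau> z / z))) \<longlongrightarrow>
      (2 * of_real pi * \<i> * (1 / j)) / (1 * (2 * of_real pi * \<i>))) (at 0)"
    by (intro tendsto_intros N0 s0 t0) auto
  moreover have "eventually (\<lambda>z. (N z / z) / (theta_sl2 \<gamma> \<tau> z * (sigma \<tau> z / z)) = h z) (at 0)"
    using ev
  proof eventually_elim
    case (elim z)
    then have "z \<noteq> 0" by auto
    with elim show ?case by (simp add: h_def D_def)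
  qed
  ultimately have "(h \<longlongrightarrow> 1 / j) (at 0)"
    by (subst (asm) tendsto_cong) auto
  then have h_cont_0: "isCont h 0" by (simp add: isCont_def h_def)
  define U where "U = {z. sigma \<tau> z \<noteq> 0}"
  have "open U"
    unfolding U_def using holomorphic_on_imp_continuous_on[OF sig_hol]
    by (intro open_Collect_neq) (auto intro: continuous_intros)
  have h_hol_U: "h holomorphic_on U"
  proof (rule holomorphic_transform)
    show "(\<lambda>z. N z / D z) holomorphic_on U"
      using holomorphic_on_subset[OF N_hol] holomorphic_on_subset[OF D_hol]
      by (intro holomorphic_intros) (auto simp: D_def U_def)
  qed (auto simp: h_def U_def)
  obtain r where r: "r > 0" "\<And>z. z \<in> ball 0 r - {0} \<Longrightarrow> z \<in> U"
    using ev unfolding eventually_at by (auto simp: U_def dist_commute)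
  have "h holomorphic_on ball 0 r"
  proof (rule no_isolated_singularity)
    show "h holomorphic_on ball 0 r - {0}" using h_hol_U by (rule holomorphic_on_subset) (use r(2) in blast)
    have "isCont h z" if "z \<in> ball 0 r" for z
    proof (cases "z = 0")
      case False
      then have "z \<in> U" using r that by auto
      then show ?thesis using holomorphic_on_imp_continuous_on[OF h_hol_U] \<open>open U\<close>
        by (simp add: continuous_on_eq_continuous_at)
    qed (simp add: h_cont_0)
    then show "continuous_on (ball 0 r) h" by (simp add: continuous_at_imp_continuous_on)
  qed auto
  then have h_diff_0: "h field_differentiable at 0"
    using r by (auto intro: holomorphic_on_imp_differentiable_at)
  have "h field_differentiable at z0" for z0
  proof (cases "z0 \<in> U")
    case True
    then show ?thesis using h_hol_U \<open>open U\<close> by (auto intro: holomorphic_on_imp_differentiable_at)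
  next
    case False
    then have "sigma \<tau> z0 = 0" by (simp add: U_def)
    with assms(2) obtain m n where mn: "m \<in> \<int>" "n \<in> \<int>" "z0 = m + \<tau> * n" by (rule sigma_eq_0_imp)
    have "h = h \<circ> (\<lambda>z. z - z0)"
      using h_shift[OF mn(1,2), of "z - z0" for z] mn(3) by (auto simp: fun_eq_iff add.assoc)
    moreover have "(h \<circ> (\<lambda>z. z - z0)) field_differentiable at z0"
      by (intro field_differentiable_compose derivative_intros) (use h_diff_0 in simp)
    ultimately show ?thesis by simp
  qed
  then have h_hol: "h holomorphic_on UNIV"
    by (auto simp: holomorphic_on_def intro: field_differentiable_at_within)
  \<comment> \<open>A compact rectangle that meets every orbit of the lattice.\<close>
  define P where "P = cbox 0 (Complex 1 (Im \<tau>))"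
  have "h z \<in> h ` P" for z
  proof -
    define n where "n = \<lfloor>Im z / Im \<tau>\<rfloor>"
    define w where "w = z - of_int n * \<tau>"
    define m where "m = \<lfloor>Re w\<rfloor>"
    have "0 \<le> Im w \<and> Im w \<le> Im \<tau>"
    proof -
      have "of_int n \<le> Im z / Im \<tau>" "Im z / Im \<tau> \<le> of_int n + 1"
        unfolding n_def by linarith+
      then show ?thesis
        using assms(2) by (simp add: w_def pos_le_divide_eq pos_divide_le_eq algebra_simps)
    qed
    then have "w - of_int m \<in> P"
      by (auto simp: P_def in_cbox_complex_iff m_def) (use floor_correct[of "Re w"] in linarith)+
    moreover have "z = (w - of_int m) + of_int m + \<tau> * of_int n" by (simp add: w_def)
    then have "h z = h (w - of_int m)" using h_shift[of "of_int m" "of_int n" "w - of_int m"] by simp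
    ultimately show ?thesis by blast
  qed
  moreover have "bounded (h ` P)"
    unfolding P_def
    by (intro compact_imp_bounded compact_continuous_image continuous_on_subset[OF holomorphic_on_imp_continuous_on[OF h_hol]]) auto
  ultimately have "bounded (range h)" by (auto intro: bounded_subset)
  with h_hol have "h constant_on UNIV" by (rule Liouville_theorem)
  then have "h z = h 0" by (auto simp: constant_on_def)
  then have hz: "h z = 1 / j" by (simp add: h_def)
  have "N z = D z / j"
  proof (cases "sigma \<tau> z = 0")
    case False
    then show ?thesis using hz j by (simp add: h_def D_def field_simps)
  next
    case True
    with assms(2) obtain m n where mn: "m \<in> \<int>" "n \<in> \<int>" "z = m + \<tau> * n" by (rule sigma_eq_0_imp)
    then show ?thesis using N_shift[OF mn(1,2), of 0] True by (simp add: D_def)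
  qed
  then show ?thesis by (simp add: N_def D_def j_def)
qed

section \<open>Holomorphic functions on the cover\<close>

lemma holo_on_cong:
  assumes "\<And>x. x \<in> U \<Longrightarrow> f x = g x" "holo_on f U"
  shows "holo_on g U"
  using assms unfolding holo_on_def by (metis (no_types, lifting) has_derivative_transform)

lemma holo_on_imp_continuous_on: "holo_on f U \<Longrightarrow> continuous_on U f"
  unfolding holo_on_def continuous_on_eq_continuous_within
  using has_derivative_continuous by blast

lemma holo_on_const: "holo_on (\<lambda>_. c) U"
  unfolding holo_on_def by (intro ballI exI[of _ "\<lambda>_. 0"]) auto

lemma holo_on_fst: "holo_on fst U"
  unfolding holo_on_def
  by (intro ballI exI[of _ fst]) (auto intro: bounded_linear_imp_has_derivative bounded_linear_fst)

lemma holo_on_coord: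
  fixes U :: "(complex \<times> (complex ^ 'n)) set"
  shows "holo_on (\<lambda>x. snd x $ j) U"
proof -
  have "bounded_linear (\<lambda>x :: complex \<times> (complex ^ 'n). snd x $ j)"
    by (intro bounded_linear_compose[OF bounded_linear_vec_nth] bounded_linear_snd)
  then show ?thesis
    unfolding holo_on_def
    by (intro ballI exI[of _ "\<lambda>x. snd x $ j"]) (auto intro: bounded_linear_imp_has_derivative)
qed

lemma holo_on_add:
  assumes "holo_on f U" "holo_on g U"
  shows "holo_on (\<lambda>x. f x + g x) U"
  unfolding holo_on_def
proof
  fix x assume "x \<in> U"
  with assms obtain D E where
    "(f has_derivative D) (at x within U)" "\<And>c a v. D (c * a, c *s v) = c * D (a, v)"
    "(g has_derivative E) (at x within U)" "\<And>c a v. E (c * a, c *s v) = c * E (a, v)"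
    unfolding holo_on_def by meson
  then show "\<exists>D. ((\<lambda>x. f x + g x) has_derivative D) (at x within U) \<and> (\<forall>c a v. D (c * a, c *s v) = c * D (a, v))"
    by (intro exI[of _ "\<lambda>x. D x + E x"]) (auto intro: has_derivative_add simp: ring_distribs)
qed

lemma holo_on_mult:
  assumes "holo_on f U" "holo_on g U"
  shows "holo_on (\<lambda>x. f x * g x) U"
  unfolding holo_on_def
proof
  fix x assume "x \<in> U"
  with assms obtain D E where
    "(f has_derivative D) (at x within U)" "\<And>c a v. D (c * a, c *s v) = c * D (a, v)"
    "(g has_derivative E) (at x within U)" "\<And>c a v. E (c * a, c *s v) = c * E (a, v)"
    unfolding holo_on_def by meson
  then show "\<exists>D. ((\<lambda>x. f x * g x) has_derivative D) (at x within U) \<and> (\<forall>c a v. D (c * a, c *s v) = c * D (a, v))"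
    by (intro exI[of _ "\<lambda>h. f x * E h + D h * g x"] conjI has_derivative_mult) (auto simp: algebra_simps)
qed

lemma holo_on_sum: "(\<And>i. i \<in> I \<Longrightarrow> holo_on (f i) U) \<Longrightarrow> holo_on (\<lambda>x. \<Sum>i\<in>I. f i x) U"
  by (induction I rule: infinite_finite_induct) (auto intro: holo_on_const holo_on_add)

lemma holo_on_prod: "(\<And>i. i \<in> I \<Longrightarrow> holo_on (f i) U) \<Longrightarrow> holo_on (\<lambda>x. \<Prod>i\<in>I. f i x) U"
  by (induction I rule: infinite_finite_induct) (auto intro: holo_on_const holo_on_mult)

lemma holo_on_compose:
  assumes "holo_on f U" "\<And>x. x \<in> U \<Longrightarrow> g field_differentiable at (f x)"
  shows "holo_on (\<lambda>x. g (f x)) U"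
  unfolding holo_on_def
proof
  fix x assume x: "x \<in> U"
  with assms obtain D where D:
    "(f has_derivative D) (at x within U)" "\<And>c a v. D (c * a, c *s v) = c * D (a, v)"
    unfolding holo_on_def by meson
  obtain g' where "(g has_field_derivative g') (at (f x))"
    using assms(2)[OF x] by (auto simp: field_differentiable_def)
  then have "((\<lambda>x. g (f x)) has_derivative (\<lambda>h. g' * D h)) (at x within U)"
    using D(1) unfolding has_field_derivative_def by (rule has_derivative_compose[rotated])
  then show "\<exists>D. ((\<lambda>x. g (f x)) has_derivative D) (at x within U) \<and> (\<forall>c a v. D (c * a, c *s v) = c * D (a, v))"
    using D(2) by (intro exI[of _ "\<lambda>h. g' * D h"]) auto
qed

lemma holo_on_exp: "holo_on f U \<Longrightarrow> holo_on (\<lambda>x. exp (f x)) U"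
  by (rule holo_on_compose) (auto intro: field_differentiable_within_exp)

lemma holo_on_divide:
  assumes "holo_on f U" "holo_on g U" "\<And>x. x \<in> U \<Longrightarrow> g x \<noteq> 0"
  shows "holo_on (\<lambda>x. f x / g x) U"
  unfolding divide_inverse
  using assms by (intro holo_on_mult holo_on_compose[of g U inverse]) (auto intro!: derivative_intros)

lemma holo_on_diff:
  assumes "holo_on f U" "holo_on g U"
  shows "holo_on (\<lambda>x. f x - g x) U"
proof -
  have "holo_on (\<lambda>x. f x + (-1) * g x) U"
    by (intro holo_on_add holo_on_mult holo_on_const assms)
  then show ?thesis by simp
qed

lemma holo_on_power: "holo_on f U \<Longrightarrow> holo_on (\<lambda>x. f x ^ n) U"
  by (induction n) (auto intro: holo_on_const holo_on_mult)

lemmas holo_intros = holo_on_const holo_on_fst holo_on_coord holo_on_add holo_on_diff holo_on_mult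
  holo_on_sum holo_on_prod holo_on_exp holo_on_divide holo_on_power

text \<open>
Each factor is the composition of \<open>\<sigma>\<close>, which is complex differentiable in both variables together,
with a linear map.
\<close>

lemma holo_on_sigma_SO:
  assumes "U \<subseteq> upper_half_plane \<times> UNIV"
  shows "holo_on sigma_SO U"
  unfolding sigma_SO_def
proof (intro holo_on_prod)
  fix j :: 'a
  show "holo_on (\<lambda>x. sigma (fst x) (snd x $ j)) U"
    unfolding holo_on_def
  proof
    fix x assume "x \<in> U"
    then have "Im (fst x) > 0" using assms by (auto simp: upper_half_plane_def)
    then obtain D1 D2 where
      D: "((\<lambda>(t, w). sigma t w) has_derivative (\<lambda>(u, v). D1 * u + D2 * v)) (at (fst x, snd x $ j))"
      by (rule sigma_has_derivative)
    have "bounded_linear (\<lambda>x :: complex \<times> (complex ^ 'a). (fst x, snd x $ j))"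
      by (intro bounded_linear_Pair bounded_linear_fst
        bounded_linear_compose[OF bounded_linear_vec_nth] bounded_linear_snd)
    then have "((\<lambda>x :: complex \<times> (complex ^ 'a). (fst x, snd x $ j)) has_derivative
        (\<lambda>x. (fst x, snd x $ j))) (at x within U)"
      by (rule bounded_linear_imp_has_derivative)
    from has_derivative_compose[OF this D]
    show "\<exists>D. ((\<lambda>x. sigma (fst x) (snd x $ j)) has_derivative D) (at x within U) \<and>
        (\<forall>c a v. D (c * a, c *s v) = c * D (a, v))"
      by (intro exI[of _ "\<lambda>x. D1 * fst x + D2 * snd x $ j"]) (auto simp: algebra_simps)
  qed
qed

section \<open>Tori, actions on the cover and cocycles\<close>

lemma lat_act_eq: "lat_act m n x = (fst x, snd x + m + fst x *s n)"
  by (cases x) simp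

lemma sl2_act_eq: "sl2_act \<gamma> x = (moebius \<gamma> (fst x), (1 / denom \<gamma> (fst x)) *s snd x)"
  by (cases x; cases \<gamma>) simp

lemma mat2_inv_SL2Z: "\<gamma> \<in> SL2Z \<Longrightarrow> mat2_inv \<gamma> \<in> SL2Z"
  by (cases \<gamma>) (auto simp: SL2Z_def algebra_simps)

lemma sl2_act_mult:
  assumes "\<gamma>1 \<in> SL2Z" "\<gamma>2 \<in> SL2Z" "Im (fst x) > 0"
  shows "sl2_act (mat2_mult \<gamma>1 \<gamma>2) x = sl2_act \<gamma>1 (sl2_act \<gamma>2 x)"
proof -
  obtain a b c d a' b' c' d' where g: "\<gamma>1 = (a, b, c, d)" "\<gamma>2 = (a', b', c', d')"
    by (cases \<gamma>1, cases \<gamma>2)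
  have nz: "denom \<gamma>2 (fst x) \<noteq> 0" "denom \<gamma>1 (moebius \<gamma>2 (fst x)) \<noteq> 0"
    by (intro denom_nonzero Im_moebius assms)+
  have M: "moebius \<gamma>2 (fst x) * denom \<gamma>2 (fst x) = of_int a' * fst x + of_int b'"
    using nz(1) by (simp add: g)
  have "moebius (mat2_mult \<gamma>1 \<gamma>2) (fst x) =
      (of_int (a * a' + b * c') * fst x + of_int (a * b' + b * d')) / denom (mat2_mult \<gamma>1 \<gamma>2) (fst x)"
    by (simp add: g)
  also have "of_int (a * a' + b * c') * fst x + of_int (a * b' + b * d') =
      (of_int a * moebius \<gamma>2 (fst x) + of_int b) * denom \<gamma>2 (fst x)"
    unfolding distrib_right mult.assoc M by (simp add: g algebra_simps)
  also have "\<dots> / denom (mat2_mult \<gamma>1 \<gamma>2) (fst x) = moebius \<gamma>1 (moebius \<gamma>2 (fst x))"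
    unfolding denom_mult[OF assms(2,3)] using nz by (simp add: g)
  finally show ?thesis
    unfolding sl2_act_eq denom_mult[OF assms(2,3)] by (simp add: vector_smult_assoc mult.commute)
qed

lemma sl2_act_one: "sl2_act (1, 0, 0, 1) x = x"
  by (cases x) simp

lemma sl2_act_inv:
  assumes "\<gamma> \<in> SL2Z" "Im (fst x) > 0"
  shows "sl2_act (mat2_inv \<gamma>) (sl2_act \<gamma> x) = x"
proof -
  have "mat2_mult (mat2_inv \<gamma>) \<gamma> = (1, 0, 0, 1)"
    using assms(1) by (cases \<gamma>) (auto simp: SL2Z_def algebra_simps)
  then show ?thesis
    using sl2_act_mult[OF mat2_inv_SL2Z[OF assms(1)] assms] by (simp add: sl2_act_one)
qed

lemma lat_act_add: "lat_act (m1 + m2) (n1 + n2) x = lat_act m1 n1 (lat_act m2 n2 x)"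
  by (simp add: lat_act_eq vector_add_ldistrib algebra_simps)

text \<open>
The two actions fit together to an action of the semidirect product; the mixed condition in
\<open>line_bundle\<close> is the cocycle condition for this identity.
\<close>

lemma lat_act_sl2_act:
  assumes "(a, b, c, d) \<in> SL2Z" "Im (fst x) > 0"
  shows "lat_act (of_int a *s m - of_int b *s n) (of_int d *s n - of_int c *s m) (sl2_act (a, b, c, d) x) =
    sl2_act (a, b, c, d) (lat_act m n x)"
proof -
  have "(1 / denom (a, b, c, d) (fst x)) *s (snd x + m + fst x *s n) =
      (1 / denom (a, b, c, d) (fst x)) *s snd x + (of_int a *s m - of_int b *s n) +
      moebius (a, b, c, d) (fst x) *s (of_int d *s n - of_int c *s m)"
    unfolding vec_eq_iff vector_add_component vector_smult_component vector_minus_component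
    by (intro allI lattice_moebius assms)
  then show ?thesis by (simp only: lat_act_eq sl2_act_eq fst_conv snd_conv)
qed

text \<open>
The definition of \<open>line_bundle\<close> as an introduction rule and as elimination rules, with the nested
bounded quantifiers resolved.
\<close>

lemma line_bundleI:
  assumes "\<And>m n. m \<in> coX G \<Longrightarrow> n \<in> coX G \<Longrightarrow> holo_on (lat L m n) (cover G)"
    and "\<And>\<gamma>. \<gamma> \<in> SL2Z \<Longrightarrow> holo_on (sl2 L \<gamma>) (cover G)"
    and "\<And>x m n. x \<in> cover G \<Longrightarrow> m \<in> coX G \<Longrightarrow> n \<in> coX G \<Longrightarrow> lat L m n x \<noteq> 0"
    and "\<And>x \<gamma>. x \<in> cover G \<Longrightarrow> \<gamma> \<in> SL2Z \<Longrightarrow> sl2 L \<gamma> x \<noteq> 0"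
    and "\<And>x m1 n1 m2 n2. x \<in> cover G \<Longrightarrow> m1 \<in> coX G \<Longrightarrow> n1 \<in> coX G \<Longrightarrow> m2 \<in> coX G \<Longrightarrow> n2 \<in> coX G \<Longrightarrow>
      lat L (m1 + m2) (n1 + n2) x = lat L m1 n1 (lat_act m2 n2 x) * lat L m2 n2 x"
    and "\<And>x \<gamma>1 \<gamma>2. x \<in> cover G \<Longrightarrow> \<gamma>1 \<in> SL2Z \<Longrightarrow> \<gamma>2 \<in> SL2Z \<Longrightarrow>
      sl2 L (mat2_mult \<gamma>1 \<gamma>2) x = sl2 L \<gamma>1 (sl2_act \<gamma>2 x) * sl2 L \<gamma>2 x"
    and "\<And>x a b c d m n. x \<in> cover G \<Longrightarrow> (a, b, c, d) \<in> SL2Z \<Longrightarrow> m \<in> coX G \<Longrightarrow> n \<in> coX G \<Longrightarrow>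
      lat L (of_int a *s m - of_int b *s n) (of_int d *s n - of_int c *s m) (sl2_act (a, b, c, d) x) *
        sl2 L (a, b, c, d) x =
      sl2 L (a, b, c, d) (lat_act m n x) * lat L m n x"
    and "\<And>x w m n. x \<in> cover G \<Longrightarrow> w \<in> weyl G \<Longrightarrow> m \<in> coX G \<Longrightarrow> n \<in> coX G \<Longrightarrow>
      lat L (w m) (w n) (fst x, w (snd x)) = lat L m n x"
    and "\<And>x w \<gamma>. x \<in> cover G \<Longrightarrow> w \<in> weyl G \<Longrightarrow> \<gamma> \<in> SL2Z \<Longrightarrow>
      sl2 L \<gamma> (fst x, w (snd x)) = sl2 L \<gamma> x"
  shows "line_bundle G L"
  unfolding line_bundle_def
proof (intro conjI ballI)
  fix x \<gamma> assume x: "x \<in> cover G" "\<gamma> \<in> SL2Z"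
  obtain a b c d where g: "\<gamma> = (a, b, c, d)" by (cases \<gamma>)
  show "case \<gamma> of (a, b, c, d) \<Rightarrow> \<forall>m\<in>coX G. \<forall>n'\<in>coX G.
      lat L (of_int a *s m - of_int b *s n') (of_int d *s n' - of_int c *s m)
        (sl2_act (a, b, c, d) x) * sl2 L (a, b, c, d) x =
      sl2 L (a, b, c, d) (lat_act m n' x) * lat L m n' x"
    unfolding g prod.case by (intro ballI assms(7) x x(2)[unfolded g])
qed (rule assms; assumption)+

lemma line_bundleD:
  assumes "line_bundle G L"
  shows "\<And>m n. m \<in> coX G \<Longrightarrow> n \<in> coX G \<Longrightarrow> holo_on (lat L m n) (cover G)"
    and "\<And>\<gamma>. \<gamma> \<in> SL2Z \<Longrightarrow> holo_on (sl2 L \<gamma>) (cover G)"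
    and "\<And>x m n. x \<in> cover G \<Longrightarrow> m \<in> coX G \<Longrightarrow> n \<in> coX G \<Longrightarrow> lat L m n x \<noteq> 0"
    and "\<And>x \<gamma>. x \<in> cover G \<Longrightarrow> \<gamma> \<in> SL2Z \<Longrightarrow> sl2 L \<gamma> x \<noteq> 0"
    and "\<And>x m1 n1 m2 n2. x \<in> cover G \<Longrightarrow> m1 \<in> coX G \<Longrightarrow> n1 \<in> coX G \<Longrightarrow> m2 \<in> coX G \<Longrightarrow> n2 \<in> coX G \<Longrightarrow>
      lat L (m1 + m2) (n1 + n2) x = lat L m1 n1 (lat_act m2 n2 x) * lat L m2 n2 x"
    and "\<And>x \<gamma>1 \<gamma>2. x \<in> cover G \<Longrightarrow> \<gamma>1 \<in> SL2Z \<Longrightarrow> \<gamma>2 \<in> SL2Z \<Longrightarrow>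
      sl2 L (mat2_mult \<gamma>1 \<gamma>2) x = sl2 L \<gamma>1 (sl2_act \<gamma>2 x) * sl2 L \<gamma>2 x"
    and "\<And>x a b c d m n. x \<in> cover G \<Longrightarrow> (a, b, c, d) \<in> SL2Z \<Longrightarrow> m \<in> coX G \<Longrightarrow> n \<in> coX G \<Longrightarrow>
      lat L (of_int a *s m - of_int b *s n) (of_int d *s n - of_int c *s m) (sl2_act (a, b, c, d) x) *
        sl2 L (a, b, c, d) x =
      sl2 L (a, b, c, d) (lat_act m n x) * lat L m n x"
    and "\<And>x w m n. x \<in> cover G \<Longrightarrow> w \<in> weyl G \<Longrightarrow> m \<in> coX G \<Longrightarrow> n \<in> coX G \<Longrightarrow>
      lat L (w m) (w n) (fst x, w (snd x)) = lat L m n x"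
    and "\<And>x w \<gamma>. x \<in> cover G \<Longrightarrow> w \<in> weyl G \<Longrightarrow> \<gamma> \<in> SL2Z \<Longrightarrow>
      sl2 L \<gamma> (fst x, w (snd x)) = sl2 L \<gamma> x"
proof -
  note A = assms[unfolded line_bundle_def]
  note X = A[THEN conjunct2, THEN conjunct2, THEN bspec]
  note X1 = X[THEN conjunct2]
  note X2 = X1[THEN conjunct2]
  note X3 = X2[THEN conjunct2]
  note X4 = X3[THEN conjunct2]
  note X5 = X4[THEN conjunct2]
  show "\<And>m n. m \<in> coX G \<Longrightarrow> n \<in> coX G \<Longrightarrow> holo_on (lat L m n) (cover G)"
    by (rule A[THEN conjunct1, rule_format])
  show "\<And>\<gamma>. \<gamma> \<in> SL2Z \<Longrightarrow> holo_on (sl2 L \<gamma>) (cover G)"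
    by (rule A[THEN conjunct2, THEN conjunct1, rule_format])
  show "\<And>x m n. x \<in> cover G \<Longrightarrow> m \<in> coX G \<Longrightarrow> n \<in> coX G \<Longrightarrow> lat L m n x \<noteq> 0"
    by (rule X[THEN conjunct1, rule_format])
  show "\<And>x \<gamma>. x \<in> cover G \<Longrightarrow> \<gamma> \<in> SL2Z \<Longrightarrow> sl2 L \<gamma> x \<noteq> 0"
    by (rule X1[THEN conjunct1, rule_format])
  show "\<And>x m1 n1 m2 n2. x \<in> cover G \<Longrightarrow> m1 \<in> coX G \<Longrightarrow> n1 \<in> coX G \<Longrightarrow> m2 \<in> coX G \<Longrightarrow> n2 \<in> coX G \<Longrightarrow>
      lat L (m1 + m2) (n1 + n2) x = lat L m1 n1 (lat_act m2 n2 x) * lat L m2 n2 x"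
    by (rule X2[THEN conjunct1, rule_format])
  show "\<And>x \<gamma>1 \<gamma>2. x \<in> cover G \<Longrightarrow> \<gamma>1 \<in> SL2Z \<Longrightarrow> \<gamma>2 \<in> SL2Z \<Longrightarrow>
      sl2 L (mat2_mult \<gamma>1 \<gamma>2) x = sl2 L \<gamma>1 (sl2_act \<gamma>2 x) * sl2 L \<gamma>2 x"
    by (rule X3[THEN conjunct1, rule_format])
  show "\<And>x a b c d m n. x \<in> cover G \<Longrightarrow> (a, b, c, d) \<in> SL2Z \<Longrightarrow> m \<in> coX G \<Longrightarrow> n \<in> coX G \<Longrightarrow>
      lat L (of_int a *s m - of_int b *s n) (of_int d *s n - of_int c *s m) (sl2_act (a, b, c, d) x) *
        sl2 L (a, b, c, d) x =
      sl2 L (a, b, c, d) (lat_act m n x) * lat L m n x"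
    by (rule X4[THEN conjunct1, THEN bspec, of _ "(a, b, c, d)" for a b c d, unfolded prod.case, rule_format])
  show "\<And>x w m n. x \<in> cover G \<Longrightarrow> w \<in> weyl G \<Longrightarrow> m \<in> coX G \<Longrightarrow> n \<in> coX G \<Longrightarrow>
      lat L (w m) (w n) (fst x, w (snd x)) = lat L m n x"
    by (rule X5[THEN conjunct1, rule_format])
  show "\<And>x w \<gamma>. x \<in> cover G \<Longrightarrow> w \<in> weyl G \<Longrightarrow> \<gamma> \<in> SL2Z \<Longrightarrow>
      sl2 L \<gamma> (fst x, w (snd x)) = sl2 L \<gamma> x"
    by (rule X5[THEN conjunct2, rule_format])
qed

text \<open>
What \<open>U(n)\<close>, \<open>SU(n)\<close> and \<open>Spin(2n)\<close> have in common.  A permutation is an even signed permutation without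
signs, so all three Weyl groups satisfy the same condition.
\<close>

locale torus =
  fixes G :: "(complex ^ 'n) torus_data"
  assumes coX_int: "coX G \<subseteq> int_vectors"
    and coX_subset_tC: "coX G \<subseteq> tC G"
    and tC_add: "u \<in> tC G \<Longrightarrow> v \<in> tC G \<Longrightarrow> u + v \<in> tC G"
    and tC_scale: "u \<in> tC G \<Longrightarrow> c *s u \<in> tC G"
    and coX_add: "m \<in> coX G \<Longrightarrow> n \<in> coX G \<Longrightarrow> m + n \<in> coX G"
    and coX_scale: "m \<in> coX G \<Longrightarrow> of_int k *s m \<in> coX G"
    and weyl_subset: "weyl G \<subseteq> even_signed_permutation_maps"
    and weyl_tC: "w \<in> weyl G \<Longrightarrow> z \<in> tC G \<Longrightarrow> w z \<in> tC G"
    and weyl_coX: "w \<in> weyl G \<Longrightarrow> m \<in> coX G \<Longrightarrow> w m \<in> coX G"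
begin

lemma Im_cover: "x \<in> cover G \<Longrightarrow> Im (fst x) > 0"
  by (auto simp: cover_def upper_half_plane_def)

lemma coX_Ints: "m \<in> coX G \<Longrightarrow> m $ j \<in> \<int>"
  using coX_int by (auto simp: int_vectors_def)

lemma coX_comb: "m \<in> coX G \<Longrightarrow> n \<in> coX G \<Longrightarrow> of_int a *s m - of_int b *s n \<in> coX G"
  using coX_add[OF coX_scale[of m a] coX_scale[of n "- b"]]
  by simp

lemma lat_act_cover: "x \<in> cover G \<Longrightarrow> m \<in> coX G \<Longrightarrow> n \<in> coX G \<Longrightarrow> lat_act m n x \<in> cover G"
  using coX_subset_tC by (auto simp: cover_def lat_act_eq intro!: tC_add tC_scale)

lemma sl2_act_cover: "x \<in> cover G \<Longrightarrow> \<gamma> \<in> SL2Z \<Longrightarrow> sl2_act \<gamma> x \<in> cover G"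
  using Im_moebius[of \<gamma> "fst x"]
  by (auto simp: cover_def sl2_act_eq upper_half_plane_def intro!: tC_scale)

lemma weyl_cover: "x \<in> cover G \<Longrightarrow> w \<in> weyl G \<Longrightarrow> (fst x, w (snd x)) \<in> cover G"
  by (auto simp: cover_def weyl_tC)

lemma weylE:
  assumes "w \<in> weyl G"
  obtains p s where "bij p" "\<forall>j. s j \<in> {1, -1}" "(\<Prod>j\<in>UNIV. s j) = 1" "w = (\<lambda>z. \<chi> j. s j * z $ p j)"
proof -
  have "w \<in> even_signed_permutation_maps" using assms weyl_subset by (rule rev_subsetD)
  then have "\<exists>p s. bij p \<and> (\<forall>j. s j \<in> {1, -1}) \<and> (\<Prod>j\<in>UNIV. s j) = 1 \<and> w = (\<lambda>z. \<chi> j. s j * z $ p j)"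
    unfolding even_signed_permutation_maps_def by (rule CollectD)
  then show ?thesis by (elim exE conjE) (rule that)
qed

end

text \<open>
The multiplier by which the function \<open>h\<close> itself transforms.
\<close>

definition coboundary :: "(complex \<times> (complex ^ 'n) \<Rightarrow> complex) \<Rightarrow> (complex ^ 'n) multiplier" where
  "coboundary h = \<lparr>lat = (\<lambda>m n x. h (lat_act m n x) / h x), sl2 = (\<lambda>\<gamma> x. h (sl2_act \<gamma> x) / h x)\<rparr>"

lemma lat_coboundary: "lat (coboundary h) m n x = h (lat_act m n x) / h x"
  and sl2_coboundary: "sl2 (coboundary h) \<gamma> x = h (sl2_act \<gamma> x) / h x"
  by (simp_all add: coboundary_def)

lemma lat_tensor: "lat (tensor L L') m n x = lat L m n x * lat L' m n x"
  and sl2_tensor: "sl2 (tensor L L') \<gamma> x = sl2 L \<gamma> x * sl2 L' \<gamma> x"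
  by (simp_all add: tensor_def)

text \<open>
The values of a multiplier matter only on the cover, the cocharacter lattice and \<open>SL2Z\<close>.  Multipliers
that agree there have literally the same sections, so that the identity is an isomorphism between
them (\<open>bundle_iso_agree\<close>).
\<close>

definition agree :: "(complex ^ 'n) torus_data \<Rightarrow> (complex ^ 'n) multiplier \<Rightarrow> (complex ^ 'n) multiplier \<Rightarrow> bool" where
  "agree G L L' \<longleftrightarrow> (\<forall>x\<in>cover G.
     (\<forall>m\<in>coX G. \<forall>n\<in>coX G. lat L m n x = lat L' m n x) \<and> (\<forall>\<gamma>\<in>SL2Z. sl2 L \<gamma> x = sl2 L' \<gamma> x))"

lemma agree_sym: "agree G L L' \<Longrightarrow> agree G L' L"
  and agree_trans: "agree G L L' \<Longrightarrow> agree G L' L'' \<Longrightarrow> agree G L L''"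
  by (simp_all add: agree_def)

lemma agree_tensor: "agree G L L' \<Longrightarrow> agree G M M' \<Longrightarrow> agree G (tensor L M) (tensor L' M')"
  by (simp add: agree_def tensor_def)

context torus
begin

lemma line_bundle_agree:
  assumes "line_bundle G L" "agree G L L'"
  shows "line_bundle G L'"
proof -
  have l: "lat L' m n x = lat L m n x" if "m \<in> coX G" "n \<in> coX G" "x \<in> cover G" for m n x
    using assms(2) that by (simp add: agree_def)
  have s: "sl2 L' \<gamma> x = sl2 L \<gamma> x" if "\<gamma> \<in> SL2Z" "x \<in> cover G" for \<gamma> x
    using assms(2) that by (simp add: agree_def)
  note closure = lat_act_cover sl2_act_cover weyl_cover coX_add coX_comb weyl_coX mat2_mult_SL2Z
  note L = line_bundleD[OF assms(1)]
  show ?thesis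
  proof (rule line_bundleI)
    show "holo_on (lat L' m n) (cover G)" if "m \<in> coX G" "n \<in> coX G" for m n
      using l[OF that, symmetric] L(1)[OF that] by (rule holo_on_cong)
    show "holo_on (sl2 L' \<gamma>) (cover G)" if "\<gamma> \<in> SL2Z" for \<gamma>
      using s[OF that, symmetric] L(2)[OF that] by (rule holo_on_cong)
    fix x assume x: "x \<in> cover G"
    show "lat L' m n x \<noteq> 0" if "m \<in> coX G" "n \<in> coX G" for m n
      using L(3)[OF x that] by (simp only: l x that simp_thms)
    show "sl2 L' \<gamma> x \<noteq> 0" if "\<gamma> \<in> SL2Z" for \<gamma>
      using L(4)[OF x that] by (simp only: s x that simp_thms)
    show "lat L' (m1 + m2) (n1 + n2) x = lat L' m1 n1 (lat_act m2 n2 x) * lat L' m2 n2 x"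
      if "m1 \<in> coX G" "n1 \<in> coX G" "m2 \<in> coX G" "n2 \<in> coX G" for m1 n1 m2 n2
      using L(5)[OF x that] by (simp only: l x that closure)
    show "sl2 L' (mat2_mult \<gamma>1 \<gamma>2) x = sl2 L' \<gamma>1 (sl2_act \<gamma>2 x) * sl2 L' \<gamma>2 x"
      if "\<gamma>1 \<in> SL2Z" "\<gamma>2 \<in> SL2Z" for \<gamma>1 \<gamma>2
      using L(6)[OF x that] by (simp only: s x that closure)
    show "lat L' (of_int a *s m - of_int b *s n) (of_int d *s n - of_int c *s m) (sl2_act (a, b, c, d) x) *
        sl2 L' (a, b, c, d) x = sl2 L' (a, b, c, d) (lat_act m n x) * lat L' m n x"
      if "(a, b, c, d) \<in> SL2Z" "m \<in> coX G" "n \<in> coX G" for a b c d m n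
      using L(7)[OF x that] by (simp only: l s x that closure)
    fix w assume w: "w \<in> weyl G"
    show "lat L' (w m) (w n) (fst x, w (snd x)) = lat L' m n x" if "m \<in> coX G" "n \<in> coX G" for m n
      using L(8)[OF x w that] by (simp only: l x w that closure)
    show "sl2 L' \<gamma> (fst x, w (snd x)) = sl2 L' \<gamma> x" if "\<gamma> \<in> SL2Z" for \<gamma>
      using L(9)[OF x w that] by (simp only: s x w that closure)
  qed
qed

text \<open>
The growth condition evaluates the multiplier only along the vertical rays, which lie in the cover.
\<close>

lemma poly_growth_agree:
  assumes "agree G L L'" "poly_growth G L U f"
  shows "poly_growth G L' U f"
  unfolding poly_growth_def
proof (intro ballI allI impI)
  fix \<gamma> z and r t0 :: real
  assume *: "\<gamma> \<in> SL2Z" "z \<in> tC G" "t0 > 0" "\<forall>t\<ge>t0. sl2_act \<gamma> (Complex r t, z) \<in> U"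
  with assms(2) obtain C N where CN: "\<forall>t\<ge>t0. norm (f (sl2_act \<gamma> (Complex r t, z)) / sl2 L \<gamma> (Complex r t, z)) \<le> C * t ^ N"
    unfolding poly_growth_def by blast
  have "sl2 L \<gamma> (Complex r t, z) = sl2 L' \<gamma> (Complex r t, z)" if "t \<ge> t0" for t
  proof -
    have "(Complex r t, z) \<in> cover G"
      using that * by (simp add: cover_def upper_half_plane_def)
    then show ?thesis using assms(1) *(1) unfolding agree_def by blast
  qed
  with CN have "\<forall>t\<ge>t0. norm (f (sl2_act \<gamma> (Complex r t, z)) / sl2 L' \<gamma> (Complex r t, z)) \<le> C * t ^ N"
    by metis
  then show "\<exists>C N. \<forall>t\<ge>t0. norm (f (sl2_act \<gamma> (Complex r t, z)) / sl2 L' \<gamma> (Complex r t, z)) \<le> C * t ^ N"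
    by blast
qed

lemma sections_agree_subset:
  assumes "agree G L L'" "U \<subseteq> cover G"
  shows "sections G L U \<subseteq> sections G L' U"
proof
  fix f assume f: "f \<in> sections G L U"
  have "lat L m n x = lat L' m n x" if "x \<in> U" "m \<in> coX G" "n \<in> coX G" for m n x
    using that assms unfolding agree_def by blast
  with f poly_growth_agree[OF assms(1)] show "f \<in> sections G L' U"
    unfolding sections_def mem_Collect_eq by metis
qed

lemma sections_agree:
  assumes "agree G L L'" "U \<subseteq> cover G"
  shows "sections G L U = sections G L' U"
  using sections_agree_subset[OF assms] sections_agree_subset[OF agree_sym[OF assms(1)] assms(2)]
  by (rule equalityI)

lemma global_sections_agree:
  assumes "agree G L L'"
  shows "global_sections G L = global_sections G L'"
proof -
  have "sl2 L \<gamma> x = sl2 L' \<gamma> x" if "\<gamma> \<in> SL2Z" "x \<in> cover G" for \<gamma> x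
    using that assms unfolding agree_def by blast
  then show ?thesis
    unfolding global_sections_def sections_agree[OF assms order.refl] by (metis (no_types, lifting))
qed

lemma bundle_iso_agree:
  assumes "line_bundle G L" "line_bundle G L'" "agree G L L'"
  shows "bundle_iso G L L' (\<lambda>_ f. f)"
  unfolding bundle_iso_def
proof (intro conjI ballI)
  fix U assume "U \<in> base_opens G"
  then have U: "U \<subseteq> cover G" by (auto simp: base_opens_def dest: openin_imp_subset)
  show "bij_betw (\<lambda>f. f) (sections G L U) (sections G L' U)"
    unfolding sections_agree[OF assms(3) U] by (simp add: bij_betw_def)
  fix \<gamma> f assume \<gamma>: "\<gamma> \<in> SL2Z"
  have "sl2 L \<gamma> (sl2_act (mat2_inv \<gamma>) y) = sl2 L' \<gamma> (sl2_act (mat2_inv \<gamma>) y)" if y: "y \<in> sl2_act \<gamma> ` U" for y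
  proof -
    obtain x where x: "y = sl2_act \<gamma> x" "x \<in> U" using y by (rule imageE)
    then have "sl2_act (mat2_inv \<gamma>) y \<in> cover G"
      using sl2_act_inv[OF \<gamma> Im_cover] U by (metis subsetD)
    then show ?thesis using assms(3) \<gamma> unfolding agree_def by blast
  qed
  then show "sl2_push L \<gamma> U f = sl2_push L' \<gamma> U f"
    unfolding sl2_push_def by (intro restrict_ext) simp
qed (rule assms | simp)+

end

text \<open>
Every condition on a multiplier is multiplicative.
\<close>

lemma line_bundle_tensor:
  assumes "line_bundle G L" "line_bundle G L'"
  shows "line_bundle G (tensor L L')"
proof -
  note L = line_bundleD[OF assms(1)] and L' = line_bundleD[OF assms(2)]
  have pr: "A * A' * (B * B') = C * C' * (E * E')" if "A * B = C * E" "A' * B' = C' * E'"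
    for A A' B B' C C' E E' :: complex
    using that by algebra
  show ?thesis
    unfolding tensor_def
  proof (rule line_bundleI; unfold multiplier.simps)
    show "lat L (of_int a *s m - of_int b *s n) (of_int d *s n - of_int c *s m) (sl2_act (a, b, c, d) x) *
          lat L' (of_int a *s m - of_int b *s n) (of_int d *s n - of_int c *s m) (sl2_act (a, b, c, d) x) *
        (sl2 L (a, b, c, d) x * sl2 L' (a, b, c, d) x) =
        sl2 L (a, b, c, d) (lat_act m n x) * sl2 L' (a, b, c, d) (lat_act m n x) *
        (lat L m n x * lat L' m n x)"
      if "x \<in> cover G" "(a, b, c, d) \<in> SL2Z" "m \<in> coX G" "n \<in> coX G" for x a b c d m n
      by (rule pr[OF L(7)[OF that] L'(7)[OF that]])
    show "lat L (m1 + m2) (n1 + n2) x * lat L' (m1 + m2) (n1 + n2) x =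
        lat L m1 n1 (lat_act m2 n2 x) * lat L' m1 n1 (lat_act m2 n2 x) * (lat L m2 n2 x * lat L' m2 n2 x)"
      if "x \<in> cover G" "m1 \<in> coX G" "n1 \<in> coX G" "m2 \<in> coX G" "n2 \<in> coX G" for x m1 n1 m2 n2
      unfolding L(5)[OF that] L'(5)[OF that] by (simp only: mult_ac)
    show "sl2 L (mat2_mult \<gamma>1 \<gamma>2) x * sl2 L' (mat2_mult \<gamma>1 \<gamma>2) x =
        sl2 L \<gamma>1 (sl2_act \<gamma>2 x) * sl2 L' \<gamma>1 (sl2_act \<gamma>2 x) * (sl2 L \<gamma>2 x * sl2 L' \<gamma>2 x)"
      if "x \<in> cover G" "\<gamma>1 \<in> SL2Z" "\<gamma>2 \<in> SL2Z" for x \<gamma>1 \<gamma>2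
      unfolding L(6)[OF that] L'(6)[OF that] by (simp only: mult_ac)
  qed (simp_all only: holo_on_mult L(1-4,8,9) L'(1-4,8,9) mult_eq_0_iff simp_thms)
qed

context torus
begin

lemma line_bundle_omega: "line_bundle G (omega k)"
proof (rule line_bundleI)
  show "holo_on (sl2 (omega k) \<gamma>) (cover G)" if "\<gamma> \<in> SL2Z" for \<gamma>
    unfolding omega_def multiplier.simps
  proof (rule holo_on_compose[OF holo_on_fst])
    fix x assume "x \<in> cover G"
    then have nz: "denom \<gamma> (fst x) \<noteq> 0" using that by (intro denom_nonzero Im_cover)
    obtain a b c d where g: "\<gamma> = (a, b, c, d)" by (cases \<gamma>)
    have "(\<lambda>\<tau>. denom \<gamma> \<tau> powi k) holomorphic_on {\<tau>. denom \<gamma> \<tau> \<noteq> 0}"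
      unfolding g denom.simps by (intro holomorphic_intros) auto
    moreover have "open {\<tau>. denom \<gamma> \<tau> \<noteq> 0}"
      unfolding g denom.simps by (intro open_Collect_neq continuous_intros)
    ultimately show "(\<lambda>\<tau>. denom \<gamma> \<tau> powi k) field_differentiable at (fst x)"
      using nz by (auto intro: holomorphic_on_imp_differentiable_at)
  qed
  show "sl2 (omega k) (mat2_mult \<gamma>1 \<gamma>2) x = sl2 (omega k) \<gamma>1 (sl2_act \<gamma>2 x) * sl2 (omega k) \<gamma>2 x"
    if "x \<in> cover G" "\<gamma>1 \<in> SL2Z" "\<gamma>2 \<in> SL2Z" for x \<gamma>1 \<gamma>2
    using denom_mult[OF that(3) Im_cover[OF that(1)]]
    by (simp add: omega_def sl2_act_eq power_int_mult_distrib)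
qed (simp_all add: omega_def holo_on_const lat_act_eq denom_nonzero Im_cover del: denom.simps)

end

section \<open>The theta bundle\<close>

text \<open>
The multiplier of \<open>sigma_SO\<close> without its weight.  It makes sense for the lattice \<open>\<int>\<^sup>n\<close> of \<open>U(n)\<close>, for which
the Looijenga multiplier is not a cocycle.
\<close>

definition theta_bundle :: "(complex ^ 'n) multiplier" where
  "theta_bundle =
     \<lparr>lat = (\<lambda>m n x. \<Prod>j\<in>UNIV. theta_lat (m $ j) (n $ j) (fst x) (snd x $ j)),
      sl2 = (\<lambda>\<gamma> x. \<Prod>j\<in>UNIV. theta_sl2 \<gamma> (fst x) (snd x $ j))\<rparr>"

lemma bij_prod_reindex: "bij p \<Longrightarrow> (\<Prod>j\<in>UNIV. f (p j)) = (\<Prod>j\<in>UNIV. f j)"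
  by (rule prod.reindex_bij_betw)

context torus
begin

text \<open>
All cocycle conditions hold coordinatewise.  A signed permutation permutes the factors, and the
factors are even functions of \<open>(m, n, z)\<close>.
\<close>

lemma line_bundle_theta: "line_bundle G theta_bundle"
proof (rule line_bundleI)
  show "holo_on (lat theta_bundle m n) (cover G)" for m n
    unfolding theta_bundle_def multiplier.simps theta_lat_def by (intro holo_intros)
  show "holo_on (sl2 theta_bundle \<gamma>) (cover G)" if "\<gamma> \<in> SL2Z" for \<gamma>
  proof -
    obtain a b c d where g: "\<gamma> = (a, b, c, d)" by (cases \<gamma>)
    show ?thesis
      unfolding theta_bundle_def multiplier.simps theta_sl2.simps g
      by (intro holo_intros) (use denom_nonzero[OF that Im_cover] in \<open>auto simp: g\<close>)
  qed
next
  fix x assume x: "x \<in> cover G"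
  note Im = Im_cover[OF x]
  show "lat theta_bundle m n x \<noteq> 0" "sl2 theta_bundle \<gamma> x \<noteq> 0" for m n \<gamma>
    by (simp_all add: theta_bundle_def)
  show "lat theta_bundle (m1 + m2) (n1 + n2) x = lat theta_bundle m1 n1 (lat_act m2 n2 x) * lat theta_bundle m2 n2 x"
    if "m1 \<in> coX G" "n1 \<in> coX G" "m2 \<in> coX G" "n2 \<in> coX G" for m1 n1 m2 n2
    using that by (simp add: theta_bundle_def lat_act_eq theta_lat_add coX_Ints prod.distrib)
  show "sl2 theta_bundle (mat2_mult \<gamma>1 \<gamma>2) x = sl2 theta_bundle \<gamma>1 (sl2_act \<gamma>2 x) * sl2 theta_bundle \<gamma>2 x"
    if "\<gamma>1 \<in> SL2Z" "\<gamma>2 \<in> SL2Z" for \<gamma>1 \<gamma>2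
    using theta_sl2_mult[OF that Im] by (simp add: theta_bundle_def sl2_act_eq prod.distrib)
  show "lat theta_bundle (of_int a *s m - of_int b *s n) (of_int d *s n - of_int c *s m)
        (sl2_act (a, b, c, d) x) * sl2 theta_bundle (a, b, c, d) x =
      sl2 theta_bundle (a, b, c, d) (lat_act m n x) * lat theta_bundle m n x"
    if g: "(a, b, c, d) \<in> SL2Z" and mn: "m \<in> coX G" "n \<in> coX G" for a b c d m n
    unfolding theta_bundle_def multiplier.simps sl2_act_eq lat_act_eq fst_conv snd_conv
      prod.distrib[symmetric] vector_minus_component vector_smult_component vector_add_component
    by (intro prod.cong refl theta_mixed[OF g Im] coX_Ints mn)
  fix w assume "w \<in> weyl G"
  then obtain p s where w: "bij p" "\<forall>j. s j \<in> {1, -1}" "(\<Prod>j\<in>UNIV. s j) = 1" "w = (\<lambda>z. \<chi> j. s j * z $ p j)"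
    by (rule weylE)
  show "lat theta_bundle (w m) (w n) (fst x, w (snd x)) = lat theta_bundle m n x"
    if "m \<in> coX G" "n \<in> coX G" for m n
  proof -
    have "lat theta_bundle (w m) (w n) (fst x, w (snd x)) =
        (\<Prod>j\<in>UNIV. theta_lat (m $ p j) (n $ p j) (fst x) (snd x $ p j))"
      unfolding theta_bundle_def multiplier.simps w(4) fst_conv snd_conv vec_lambda_beta
      by (intro prod.cong refl theta_lat_sign w(2)[rule_format] coX_Ints that)
    also have "\<dots> = lat theta_bundle m n x"
      unfolding theta_bundle_def multiplier.simps by (rule bij_prod_reindex[OF w(1)])
    finally show ?thesis .
  qed
  show "sl2 theta_bundle \<gamma> (fst x, w (snd x)) = sl2 theta_bundle \<gamma> x" for \<gamma>
  proof -
    have "sl2 theta_bundle \<gamma> (fst x, w (snd x)) =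
        (\<Prod>j\<in>UNIV. theta_sl2 \<gamma> (fst x) (snd x $ p j))"
      unfolding theta_bundle_def multiplier.simps w(4) fst_conv snd_conv vec_lambda_beta
      by (intro prod.cong refl theta_sl2_sign w(2)[rule_format])
    also have "\<dots> = sl2 theta_bundle \<gamma> x"
      unfolding theta_bundle_def multiplier.simps by (rule bij_prod_reindex[OF w(1)])
    finally show ?thesis .
  qed
qed

lemma weyl_add:
  assumes "w \<in> weyl G"
  shows "w (u + v) = w u + w v"
proof -
  obtain p s where w: "w = (\<lambda>z. \<chi> j. s j * z $ p j)" using assms by (rule weylE)
  show ?thesis unfolding w by (simp add: vec_eq_iff distrib_left)
qed

lemma weyl_scale:
  assumes "w \<in> weyl G"
  shows "w (c *s v) = c *s w v"
proof -
  obtain p s where w: "w = (\<lambda>z. \<chi> j. s j * z $ p j)" using assms by (rule weylE)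
  show ?thesis unfolding w by (simp add: vec_eq_iff)
qed

lemma weyl_lat_act: "w \<in> weyl G \<Longrightarrow> lat_act (w m) (w n) (fst x, w (snd x)) =
    (fst (lat_act m n x), w (snd (lat_act m n x)))"
  by (simp add: lat_act_eq weyl_add weyl_scale)

lemma weyl_sl2_act: "w \<in> weyl G \<Longrightarrow> sl2_act \<gamma> (fst x, w (snd x)) =
    (fst (sl2_act \<gamma> x), w (snd (sl2_act \<gamma> x)))"
  by (simp add: sl2_act_eq weyl_scale)

lemma line_bundle_coboundary:
  assumes "\<And>m n. m \<in> coX G \<Longrightarrow> n \<in> coX G \<Longrightarrow> holo_on (\<lambda>x. h (lat_act m n x)) (cover G)"
    and "\<And>\<gamma>. \<gamma> \<in> SL2Z \<Longrightarrow> holo_on (\<lambda>x. h (sl2_act \<gamma> x)) (cover G)"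
    and "holo_on h (cover G)"
    and nz: "\<And>x. h x \<noteq> 0" and inv: "\<And>x w. w \<in> weyl G \<Longrightarrow> h (fst x, w (snd x)) = h x"
  shows "line_bundle G (coboundary h)"
proof (rule line_bundleI)
  show "holo_on (lat (coboundary h) m n) (cover G)" if "m \<in> coX G" "n \<in> coX G" for m n
    unfolding coboundary_def multiplier.simps by (intro holo_intros assms that)
  show "holo_on (sl2 (coboundary h) \<gamma>) (cover G)" if "\<gamma> \<in> SL2Z" for \<gamma>
    unfolding coboundary_def multiplier.simps by (intro holo_intros assms that)
next
  fix x assume "x \<in> cover G"
  note Im = Im_cover[OF this]
  show "lat (coboundary h) m n x \<noteq> 0" "sl2 (coboundary h) \<gamma> x \<noteq> 0" for m n \<gamma>
    by (simp_all add: coboundary_def nz)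
  show "lat (coboundary h) (m1 + m2) (n1 + n2) x = lat (coboundary h) m1 n1 (lat_act m2 n2 x) * lat (coboundary h) m2 n2 x"
    for m1 n1 m2 n2 by (simp add: coboundary_def lat_act_add nz)
  show "sl2 (coboundary h) (mat2_mult \<gamma>1 \<gamma>2) x = sl2 (coboundary h) \<gamma>1 (sl2_act \<gamma>2 x) * sl2 (coboundary h) \<gamma>2 x"
    if "\<gamma>1 \<in> SL2Z" "\<gamma>2 \<in> SL2Z" for \<gamma>1 \<gamma>2
    by (simp add: coboundary_def sl2_act_mult[OF that Im] nz)
  show "lat (coboundary h) (of_int a *s m - of_int b *s n) (of_int d *s n - of_int c *s m)
        (sl2_act (a, b, c, d) x) * sl2 (coboundary h) (a, b, c, d) x =
      sl2 (coboundary h) (a, b, c, d) (lat_act m n x) * lat (coboundary h) m n x"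
    if g: "(a, b, c, d) \<in> SL2Z" and mn: "m \<in> coX G" "n \<in> coX G" for a b c d m n
    unfolding coboundary_def multiplier.simps lat_act_sl2_act[OF g Im] using nz by simp
  fix w assume w: "w \<in> weyl G"
  show "lat (coboundary h) (w m) (w n) (fst x, w (snd x)) = lat (coboundary h) m n x" for m n
    by (simp only: coboundary_def multiplier.simps weyl_lat_act[OF w] inv[OF w])
  show "sl2 (coboundary h) \<gamma> (fst x, w (snd x)) = sl2 (coboundary h) \<gamma> x" for \<gamma>
    by (simp only: coboundary_def multiplier.simps weyl_sl2_act[OF w] inv[OF w])
qed

lemma sigma_SO_lat:
  assumes "x \<in> cover G" "m \<in> coX G" "n \<in> coX G"
  shows "sigma_SO (lat_act m n x) = lat theta_bundle m n x * sigma_SO x"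
  unfolding sigma_SO_def theta_bundle_def multiplier.simps lat_act_eq fst_conv snd_conv
    prod.distrib[symmetric] vector_smult_component vector_add_component
  by (intro prod.cong refl sigma_lat coX_Ints Im_cover assms)

lemma sigma_SO_sl2:
  assumes "x \<in> cover G" "\<gamma> \<in> SL2Z"
  shows "sigma_SO (sl2_act \<gamma> x) = sl2 (tensor (omega (- int CARD('n))) theta_bundle) \<gamma> x * sigma_SO x"
proof -
  have "sigma_SO (sl2_act \<gamma> x) =
      (\<Prod>j\<in>UNIV. theta_sl2 \<gamma> (fst x) (snd x $ j) / denom \<gamma> (fst x) * sigma (fst x) (snd x $ j))"
    unfolding sigma_SO_def sl2_act_eq fst_conv snd_conv vector_smult_component
    by (intro prod.cong refl sigma_modular assms Im_cover)
  also have "\<dots> = (\<Prod>j\<in>UNIV. theta_sl2 \<gamma> (fst x) (snd x $ j)) / denom \<gamma> (fst x) ^ CARD('n) *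
      (\<Prod>j\<in>UNIV. sigma (fst x) (snd x $ j))"
    by (simp only: prod.distrib prod_dividef prod_constant)
  finally show ?thesis
    by (simp add: tensor_def omega_def theta_bundle_def sigma_SO_def power_int_minus divide_inverse mult_ac
      del: theta_sl2.simps denom.simps)
qed

text \<open>
As \<open>\<sigma>\<close> is odd in \<open>z\<close>, a signed permutation multiplies \<open>sigma_SO\<close> by the product of its signs.
\<close>

lemma sigma_SO_weyl:
  assumes "w \<in> weyl G"
  shows "sigma_SO (\<tau>, w z) = sigma_SO (\<tau>, z)"
proof -
  obtain p s where w: "bij p" "\<forall>j. s j \<in> {1, -1}" "(\<Prod>j\<in>UNIV. s j) = 1" "w = (\<lambda>z. \<chi> j. s j * z $ p j)"
    using weylE[OF assms] by blast
  have "sigma \<tau> (s j * v) = s j * sigma \<tau> v" for j v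
    using w(2)[rule_format, of j] by (auto simp: sigma_minus)
  then show ?thesis
    using bij_prod_reindex[OF w(1), of "\<lambda>j. sigma \<tau> (z $ j)"] w(3)
    by (simp add: sigma_SO_def w(4) prod.distrib)
qed

end

section \<open>Growth of sigma and global sections\<close>

text \<open>
Along a vertical ray the nome stays in a closed disc of radius less than \<open>1\<close>.  Up to a factor that does not
depend on \<open>\<tau>\<close>, \<open>\<sigma>\<close> is there a continuous function of the nome, including the value \<open>0\<close> that
corresponds to the cusp.
\<close>

lemma sigma_bounded:
  assumes "t0 > 0"
  obtains C where "\<And>t. t \<ge> t0 \<Longrightarrow> norm (sigma (Complex r t) z) \<le> C"
proof -
  define \<rho> where "\<rho> = exp (- (2 * pi * t0))"
  have \<rho>: "0 < \<rho>" "\<rho> < 1" using assms by (auto simp: \<rho>_def)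
  define K where "K = cball (0::complex) \<rho>"
  define F where "F = (\<lambda>q. qpoch q (y_of z) * qpoch q (q * inverse (y_of z)) / qpoch q q ^ 2)"
  have nz: "qpoch q q \<noteq> 0" if "q \<in> K" for q
  proof (cases "q = 0")
    case False
    have "norm q < 1" using that \<rho> by (simp add: K_def)
    then show ?thesis using False by (rule qpoch_self_nonzero)
  qed (simp add: qpoch_def)
  have "continuous_on K F"
    unfolding F_def by (intro continuous_intros) (use nz \<rho> in \<open>auto simp: K_def\<close>)
  then have "bounded (F ` K)"
    by (intro compact_imp_bounded compact_continuous_image) (auto simp: K_def)
  then obtain B where B: "\<And>q. q \<in> K \<Longrightarrow> norm (F q) \<le> B" unfolding bounded_iff by blast
  show ?thesis
  proof (rule that[of "norm (inverse (y_half z)) * B"])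
    show "norm (sigma (Complex r t) z) \<le> norm (inverse (y_half z)) * B" if "t \<ge> t0" for t
    proof -
      have "nome (Complex r t) \<in> K" using that by (simp add: K_def \<rho>_def nome_def)
      from B[OF this] have "norm (inverse (y_half z)) * norm (F (nome (Complex r t))) \<le> norm (inverse (y_half z)) * B"
        by (intro mult_left_mono) auto
      moreover have "sigma (Complex r t) z = - inverse (y_half z) * F (nome (Complex r t))"
        using that assms by (subst sigma_conv_qpoch) (auto simp: F_def)
      ultimately show ?thesis by (simp add: norm_mult)
    qed
  qed
qed

lemma sigma_SO_bounded:
  fixes z :: "complex ^ 'n"
  assumes "t0 > 0"
  obtains C where "\<And>t. t \<ge> t0 \<Longrightarrow> norm (sigma_SO (Complex r t, z)) \<le> C"
proof -
  have "\<forall>j. \<exists>C. \<forall>t\<ge>t0. norm (sigma (Complex r t) (z $ j)) \<le> C"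
    using sigma_bounded[OF assms] by meson
  then obtain C where C: "\<And>j t. t \<ge> t0 \<Longrightarrow> norm (sigma (Complex r t) (z $ j)) \<le> C j" by metis
  show ?thesis
    by (rule that[of "\<Prod>j\<in>UNIV. C j"]) (auto simp: sigma_SO_def prod_norm[symmetric] intro!: prod_mono C)
qed

text \<open>
After trivialisation by \<open>\<gamma>\<close> the growth condition at the cusp of \<open>\<gamma>\<close> is one on the function itself along a
vertical ray, because the function is invariant.  The constant \<open>c\<close> accounts for the factor between
\<open>sigma_U\<close> and \<open>sigma_SO\<close> on the torus of \<open>SU(n)\<close>.
\<close>

lemma (in torus) sigma_SO_global_section:
  "restrict (\<lambda>x. c * sigma_SO x) (cover G) \<in> global_sections G (tensor (omega (- int CARD('n))) theta_bundle)"
    (is "?f \<in> global_sections G ?L")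
proof -
  have lat: "?f (lat_act m n x) = lat ?L m n x * ?f x" if "x \<in> cover G" "m \<in> coX G" "n \<in> coX G" for x m n
    using sigma_SO_lat[OF that] lat_act_cover[OF that] that by (simp add: tensor_def omega_def)
  have sl2: "?f (sl2_act \<gamma> x) = sl2 ?L \<gamma> x * ?f x" if "x \<in> cover G" "\<gamma> \<in> SL2Z" for x \<gamma>
    using sigma_SO_sl2[OF that] sl2_act_cover[OF that] that by simp
  have "line_bundle G ?L"
    by (intro line_bundle_tensor line_bundle_omega line_bundle_theta)
  then have nz: "sl2 ?L \<gamma> x \<noteq> 0" if "x \<in> cover G" "\<gamma> \<in> SL2Z" for x \<gamma>
    using that by (rule line_bundleD)
  have "poly_growth G ?L (cover G) ?f"
    unfolding poly_growth_def
  proof (intro ballI allI impI)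
    fix \<gamma> z and r t0 :: real assume *: "\<gamma> \<in> SL2Z" "z \<in> tC G" "t0 > 0"
    obtain C where C: "\<And>t. t \<ge> t0 \<Longrightarrow> norm (sigma_SO (Complex r t, z)) \<le> C"
      using sigma_SO_bounded[OF *(3), where r=r and z=z] by blast
    have "norm (?f (sl2_act \<gamma> (Complex r t, z)) / sl2 ?L \<gamma> (Complex r t, z)) \<le> (norm c * C) * t ^ 0" if "t \<ge> t0" for t
    proof -
      have x: "(Complex r t, z) \<in> cover G" using that * by (simp add: cover_def upper_half_plane_def)
      have "?f (sl2_act \<gamma> (Complex r t, z)) / sl2 ?L \<gamma> (Complex r t, z) = c * sigma_SO (Complex r t, z)"
        unfolding sl2[OF x *(1)] using nz[OF x *(1)] x by simp
      then show ?thesis using C[OF that] by (simp add: norm_mult mult_left_mono)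
    qed
    then show "\<exists>C N. \<forall>t\<ge>t0. norm (?f (sl2_act \<gamma> (Complex r t, z)) / sl2 ?L \<gamma> (Complex r t, z)) \<le> C * t ^ N"
      by blast
  qed
  moreover have "holo_on ?f (cover G)"
  proof (rule holo_on_cong)
    show "holo_on (\<lambda>x. c * sigma_SO x) (cover G)"
      by (intro holo_intros holo_on_sigma_SO) (auto simp: cover_def)
  qed auto
  moreover have "?f (fst x, w (snd x)) = ?f x" if "x \<in> cover G" "w \<in> weyl G" for x w
    using sigma_SO_weyl[OF that(2)] weyl_cover[OF that] that by (simp add: sigma_SO_weyl)
  ultimately show ?thesis
    unfolding global_sections_def sections_def using lat sl2 by auto
qed

section \<open>The three groups and the Looijenga bundle\<close>

lemma holo_on_minus: "holo_on f U \<Longrightarrow> holo_on (\<lambda>x. - f x) U"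
  using holo_on_diff[OF holo_on_const[of 0]] by simp

text \<open>
The two multipliers differ by the sign \<open>-1\<close> to the sum of all entries of \<open>m\<close> and \<open>n\<close>, which is even.
\<close>

lemma agree_looijenga:
  fixes G :: "(complex ^ 'a) torus_data"
  assumes "\<And>m. m \<in> coX G \<Longrightarrow> (\<Sum>j\<in>UNIV. m $ j) / 2 \<in> \<int>"
  shows "agree G theta_bundle (looijenga level_one)"
  unfolding agree_def
proof (intro ballI conjI)
  fix x :: "complex \<times> (complex ^ 'a)"
  obtain \<tau> z where x: "x = (\<tau>, z)" by (cases x)
  show "lat theta_bundle m n x = lat (looijenga level_one) m n x" if mn: "m \<in> coX G" "n \<in> coX G" for m n
  proof -
    obtain k l where kl: "(\<Sum>j\<in>UNIV. m $ j) / 2 = of_int k" "(\<Sum>j\<in>UNIV. n $ j) / 2 = of_int l"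
      using assms[OF mn(1)] assms[OF mn(2)] by (auto elim!: Ints_cases)
    have "lat theta_bundle m n x =
        exp (\<Sum>j\<in>UNIV. of_real pi * \<i> * (m $ j + n $ j - 2 * n $ j * z $ j - (n $ j) ^ 2 * \<tau>))"
      by (simp add: theta_bundle_def theta_lat_def exp_sum x)
    also have "\<dots> = exp (of_real pi * \<i> * (\<Sum>j\<in>UNIV. m $ j + n $ j - 2 * n $ j * z $ j - (n $ j) ^ 2 * \<tau>))"
      by (simp only: sum_distrib_left)
    also have "\<dots> = exp (of_real pi * \<i> * (- (2 * level_one n z + level_one n n * \<tau>)))"
    proof (rule exp_pi_i_cong[of _ _ "k + l"])
      have "(\<Sum>j\<in>UNIV. m $ j + n $ j - 2 * n $ j * z $ j - (n $ j) ^ 2 * \<tau>) =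
          (\<Sum>j\<in>UNIV. m $ j) + (\<Sum>j\<in>UNIV. n $ j) - 2 * level_one n z - level_one n n * \<tau>"
        unfolding level_one_def sum_distrib_left sum_distrib_right sum.distrib[symmetric] sum_subtractf[symmetric]
        by (simp only: power2_eq_square mult.assoc)
      moreover have "(\<Sum>j\<in>UNIV. m $ j) = 2 * of_int k" "(\<Sum>j\<in>UNIV. n $ j) = 2 * of_int l"
        using kl by (simp_all add: field_simps)
      ultimately show "(\<Sum>j\<in>UNIV. m $ j + n $ j - 2 * n $ j * z $ j - (n $ j) ^ 2 * \<tau>) -
          (- (2 * level_one n z + level_one n n * \<tau>)) = 2 * of_int (k + l)"
        by simp
    qed
    also have "\<dots> = lat (looijenga level_one) m n x"
      unfolding looijenga_def x multiplier.simps prod.case mult_minus_right ..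
    finally show ?thesis .
  qed
  show "sl2 theta_bundle \<gamma> x = sl2 (looijenga level_one) \<gamma> x" for \<gamma>
  proof -
    obtain a b c d where g: "\<gamma> = (a, b, c, d)" by (cases \<gamma>)
    have "sl2 theta_bundle \<gamma> x =
        exp (\<Sum>j\<in>UNIV. of_real pi * \<i> * (of_int c * (z $ j) ^ 2 / (of_int c * \<tau> + of_int d)))"
      by (simp add: theta_bundle_def exp_sum x g)
    also have "(\<Sum>j\<in>UNIV. of_real pi * \<i> * (of_int c * (z $ j) ^ 2 / (of_int c * \<tau> + of_int d))) =
        of_real pi * \<i> * of_int c * level_one z z / (of_int c * \<tau> + of_int d)"
      by (simp add: level_one_def sum_distrib_left sum_divide_distrib power2_eq_square mult_ac)
    finally show ?thesis by (simp add: looijenga_def x g)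
  qed
qed

lemma permutation_even_signed: "permutation_maps \<subseteq> even_signed_permutation_maps"
proof
  fix w :: "complex ^ 'n \<Rightarrow> complex ^ 'n"
  assume "w \<in> permutation_maps"
  then obtain p where "bij p" "w = (\<lambda>z. \<chi> j. z $ p j)" by (auto simp: permutation_maps_def)
  then show "w \<in> even_signed_permutation_maps"
    unfolding even_signed_permutation_maps_def
    by (intro CollectI exI[of _ p] exI[of _ "\<lambda>_. 1"]) auto
qed

lemma bij_sum_reindex: "bij p \<Longrightarrow> (\<Sum>j\<in>UNIV. f (p j)) = (\<Sum>j\<in>UNIV. f j)"
  by (rule sum.reindex_bij_betw)

lemma int_vectors_add: "u \<in> int_vectors \<Longrightarrow> v \<in> int_vectors \<Longrightarrow> u + v \<in> int_vectors"
  and int_vectors_scale: "u \<in> int_vectors \<Longrightarrow> of_int k *s u \<in> int_vectors"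
  by (auto simp: int_vectors_def)

text \<open>
Changing the sign of an integer entry changes the sum by an even integer.
\<close>

lemma sum_signed_half_int:
  assumes "\<forall>j. s j \<in> {1, -1}" "v \<in> int_vectors" "(\<Sum>j\<in>UNIV. v $ j) / 2 \<in> \<int>" "bij p"
  shows "(\<Sum>j\<in>UNIV. s j * v $ p j) / 2 \<in> \<int>"
proof -
  have "s j * v $ p j = v $ p j - 2 * (if s j = 1 then 0 else v $ p j)" for j
    using assms(1)[rule_format, of j] by auto
  then have "(\<Sum>j\<in>UNIV. s j * v $ p j) = (\<Sum>j\<in>UNIV. v $ p j - 2 * (if s j = 1 then 0 else v $ p j))"
    by (rule sum.cong[OF refl])
  also have "\<dots> = (\<Sum>j\<in>UNIV. v $ j) - 2 * (\<Sum>j\<in>UNIV. if s j = 1 then 0 else v $ p j)"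
    by (simp only: sum_subtractf bij_sum_reindex[OF assms(4)] sum_distrib_left)
  finally have "(\<Sum>j\<in>UNIV. s j * v $ p j) / 2 = (\<Sum>j\<in>UNIV. v $ j) / 2 - (\<Sum>j\<in>UNIV. if s j = 1 then 0 else v $ p j)"
    by (simp add: diff_divide_distrib)
  moreover have "(\<Sum>j\<in>UNIV. if s j = 1 then 0 else v $ p j) \<in> \<int>"
    using assms(2) by (intro Ints_sum) (auto simp: int_vectors_def)
  ultimately show ?thesis using assms(3) by (simp only: Ints_diff)
qed

interpretation U: torus "U_data :: (complex ^ 'n::finite) torus_data"
proof
  show "weyl (U_data :: (complex ^ 'n) torus_data) \<subseteq> even_signed_permutation_maps"
    using permutation_even_signed by (simp add: U_data_def)
qed (auto simp: U_data_def int_vectors_add int_vectors_scale, auto simp: permutation_maps_def int_vectors_def)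

interpretation SU: torus "SU_data :: (complex ^ 'n::finite) torus_data"
proof
  show "weyl (SU_data :: (complex ^ 'n) torus_data) \<subseteq> even_signed_permutation_maps"
    using permutation_even_signed by (simp add: SU_data_def)
  fix w :: "complex ^ 'n \<Rightarrow> complex ^ 'n" assume "w \<in> weyl SU_data"
  then obtain p where p: "bij p" "w = (\<lambda>z. \<chi> j. z $ p j)"
    by (auto simp: permutation_maps_def SU_data_def)
  show "w z \<in> tC SU_data" if "z \<in> tC SU_data" for z
    using that bij_sum_reindex[OF p(1), of "($) z"] by (simp add: SU_data_def p(2))
  show "w z \<in> coX SU_data" if "z \<in> coX SU_data" for z
    using that bij_sum_reindex[OF p(1), of "($) z"] by (simp add: SU_data_def p(2) int_vectors_def)
qed (auto simp: SU_data_def int_vectors_add int_vectors_scale sum.distrib sum_distrib_left[symmetric])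

interpretation Spin: torus "Spin_data :: (complex ^ 'n::finite) torus_data"
proof
  fix w :: "complex ^ 'n \<Rightarrow> complex ^ 'n" and m :: "complex ^ 'n"
  assume w: "w \<in> weyl Spin_data" and m: "m \<in> coX Spin_data"
  then obtain p s where p: "bij p" "\<forall>j. s j \<in> {1, -1}" "w = (\<lambda>z. \<chi> j. s j * z $ p j)"
    unfolding Spin_data_def torus_data.simps even_signed_permutation_maps_def mem_Collect_eq by blast
  have "s j * m $ p j \<in> \<int>" for j
    using m by (intro Ints_mult) (use p(2)[rule_format, of j] in \<open>auto simp: Spin_data_def int_vectors_def\<close>)
  moreover have "(\<Sum>j\<in>UNIV. s j * m $ p j) / 2 \<in> \<int>"
    using m by (intro sum_signed_half_int p) (auto simp: Spin_data_def)
  ultimately show "w m \<in> coX Spin_data" by (simp add: Spin_data_def p(3) int_vectors_def)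
next
  fix m :: "complex ^ 'n" and k :: int assume m: "m \<in> coX Spin_data"
  then have "of_int k * ((\<Sum>j\<in>UNIV. m $ j) / 2) \<in> \<int>"
    by (intro Ints_mult) (auto simp: Spin_data_def)
  with m show "of_int k *s m \<in> coX Spin_data"
    by (simp add: Spin_data_def int_vectors_scale sum_distrib_left[symmetric])
next
  fix m n :: "complex ^ 'n" assume mn: "m \<in> coX Spin_data" "n \<in> coX Spin_data"
  then have "(\<Sum>j\<in>UNIV. m $ j) / 2 + (\<Sum>j\<in>UNIV. n $ j) / 2 \<in> \<int>"
    by (intro Ints_add) (auto simp: Spin_data_def)
  with mn show "m + n \<in> coX Spin_data"
    by (simp add: Spin_data_def int_vectors_add sum.distrib add_divide_distrib)
qed (auto simp: Spin_data_def)

section \<open>Uniqueness of the multiplier of sigma\<close>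

text \<open>
All coordinates are moved by the same small real number \<open>t\<close>.  As the zeros of \<open>\<sigma>\<close> form a lattice, only
countably many values of \<open>t\<close> are excluded.
\<close>

lemma sigma_SO_nonzero_dense:
  fixes z :: "complex ^ 'n"
  assumes "Im \<tau> > 0" "e > 0"
  obtains z' where "dist z' z < e" "sigma_SO (\<tau>, z') \<noteq> 0"
proof -
  define v where "v = ((\<chi> j. 1) :: complex ^ 'n)"
  define bad where "bad = range (\<lambda>(j, m :: int, n :: int). Re (of_int m + \<tau> * of_int n - z $ j))"
  have "countable bad" unfolding bad_def by (intro countable_image countableI_type)
  define d where "d = e / (2 * (norm v + 1))"
  have d: "d > 0" using assms(2) by (simp add: d_def add_nonneg_pos)
  then have "uncountable {0<..<d}" by (simp add: uncountable_open_interval)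
  then have "\<not> {0<..<d} \<subseteq> bad" using \<open>countable bad\<close> countable_subset by blast
  then obtain t where "t \<in> {0<..<d}" and t_bad: "t \<notin> bad" by (meson subsetI)
  then have t: "0 < t" "t < d" by auto
  show ?thesis
  proof (rule that)
    have "dist (z + t *\<^sub>R v) z = t * norm v" using t by (simp add: dist_norm)
    also have "\<dots> \<le> d * (norm v + 1)" using t by (intro mult_mono) auto
    also have "\<dots> = e / 2"
    proof -
      have "e / (2 * w) * w = e / 2" if "w > 0" for w :: real using that by simp
      moreover have "norm v + 1 > 0" by (simp add: add_nonneg_pos)
      ultimately show ?thesis unfolding d_def by blast
    qed
    also have "\<dots> < e" using assms(2) by simp
    finally show "dist (z + t *\<^sub>R v) z < e" .
    show "sigma_SO (\<tau>, z + t *\<^sub>R v) \<noteq> 0"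
    proof
      assume "sigma_SO (\<tau>, z + t *\<^sub>R v) = 0"
      then obtain j where j: "sigma \<tau> ((z + t *\<^sub>R v) $ j) = 0"
        by (auto simp: sigma_SO_def)
      have "(z + t *\<^sub>R v) $ j = z $ j + of_real t" 
        by (simp only: vector_add_component vector_scaleR_component v_def vec_lambda_beta)
          (simp add: scaleR_conv_of_real)
      with j have "sigma \<tau> (z $ j + of_real t) = 0" by simp
      with assms(1) obtain m n where mn: "m \<in> \<int>" "n \<in> \<int>" "z $ j + of_real t = m + \<tau> * n"
        by (rule sigma_eq_0_imp)
      obtain k l where kl: "m = of_int k" "n = of_int l" using mn(1,2) by (auto elim!: Ints_cases)
      have "of_real t = of_int k + \<tau> * of_int l - z $ j" using mn(3) kl by (simp add: algebra_simps)
      then have "t = Re (of_int k + \<tau> * of_int l - z $ j)" by (metis Re_complex_of_real)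
      then have "t \<in> bad" unfolding bad_def by (intro image_eqI[of _ _ "(j, k, l)"]) auto
      with t_bad show False ..
    qed
  qed
qed

lemma continuous_eq_on_dense:
  fixes f g :: "'a::metric_space \<Rightarrow> 'b::real_normed_vector"
  assumes "continuous_on X f" "continuous_on X g" "x \<in> X"
    and "\<And>e. e > 0 \<Longrightarrow> \<exists>y\<in>X. dist y x < e \<and> f y = g y"
  shows "f x = g x"
proof (rule ccontr)
  assume ne: "f x \<noteq> g x"
  have "continuous_on X (\<lambda>y. f y - g y)" by (intro continuous_on_diff assms)
  moreover have "norm (f x - g x) > 0" using ne by simp
  ultimately obtain d where d: "d > 0"
    "\<forall>y\<in>X. dist y x < d \<longrightarrow> dist (f y - g y) (f x - g x) < norm (f x - g x)"
    using assms(3) unfolding continuous_on_iff by blast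
  obtain y where "y \<in> X" "dist y x < d" "f y = g y" using assms(4)[OF d(1)] by blast
  moreover from this d(2) have "dist (f y - g y) (f x - g x) < norm (f x - g x)" by blast
  ultimately show False by (simp add: dist_norm norm_minus_commute)
qed

text \<open>
Where \<open>s\<close> does not vanish the multiplier is a quotient of values of \<open>s\<close>; elsewhere it follows by
continuity.
\<close>

lemma (in torus) transforms_by_unique:
  assumes "tC G = UNIV" and L: "transforms_by G s L" and L': "transforms_by G s L'"
    and s: "\<And>x. x \<in> cover G \<Longrightarrow> sigma_SO x \<noteq> 0 \<Longrightarrow> s x \<noteq> 0"
  shows "agree G L L'"
  unfolding agree_def
proof (intro ballI conjI)
  note lb = L[unfolded transforms_by_def, THEN conjunct1] L'[unfolded transforms_by_def, THEN conjunct1]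
  note tr = L[unfolded transforms_by_def, THEN conjunct2] L'[unfolded transforms_by_def, THEN conjunct2]
  fix x assume x: "x \<in> cover G"
  have dense: "\<exists>y\<in>cover G. dist y x < e \<and> s y \<noteq> 0" if e: "e > 0" for e
  proof -
    obtain z' where z': "dist z' (snd x) < e" "sigma_SO (fst x, z') \<noteq> 0"
      using sigma_SO_nonzero_dense[OF Im_cover[OF x] e, of "snd x"] by metis
    have c: "(fst x, z') \<in> cover G" using x assms(1) by (simp add: cover_def mem_Times_iff)
    have "dist (fst x, z') x = dist z' (snd x)" by (simp add: dist_prod_def)
    with z'(1) have "dist (fst x, z') x < e" by simp
    with s[OF c z'(2)] c show ?thesis by blast
  qed
  show "lat L m n x = lat L' m n x" if mn: "m \<in> coX G" "n \<in> coX G" for m n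
  proof (rule continuous_eq_on_dense[of "cover G" "lat L m n" "lat L' m n", OF _ _ x])
    show "continuous_on (cover G) (lat L m n)" "continuous_on (cover G) (lat L' m n)"
      by (intro holo_on_imp_continuous_on line_bundleD(1) lb mn)+
    fix e :: real assume "e > 0"
    then obtain y where y: "y \<in> cover G" "dist y x < e" "s y \<noteq> 0" using dense by blast
    have "s (lat_act m n y) = lat L m n y * s y" "s (lat_act m n y) = lat L' m n y * s y"
      using tr y(1) mn by blast+
    then have "lat L m n y * s y = lat L' m n y * s y" by (rule trans[OF sym])
    with y(3) have "lat L m n y = lat L' m n y" by simp
    with y(1,2) show "\<exists>y\<in>cover G. dist y x < e \<and> lat L m n y = lat L' m n y" by blast
  qed
  show "sl2 L \<gamma> x = sl2 L' \<gamma> x" if g: "\<gamma> \<in> SL2Z" for \<gamma>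
  proof (rule continuous_eq_on_dense[of "cover G" "sl2 L \<gamma>" "sl2 L' \<gamma>", OF _ _ x])
    show "continuous_on (cover G) (sl2 L \<gamma>)" "continuous_on (cover G) (sl2 L' \<gamma>)"
      by (intro holo_on_imp_continuous_on line_bundleD(2) lb g)+
    fix e :: real assume "e > 0"
    then obtain y where y: "y \<in> cover G" "dist y x < e" "s y \<noteq> 0" using dense by blast
    have "s (sl2_act \<gamma> y) = sl2 L \<gamma> y * s y" "s (sl2_act \<gamma> y) = sl2 L' \<gamma> y * s y"
      using tr y(1) g by blast+
    then have "sl2 L \<gamma> y * s y = sl2 L' \<gamma> y * s y" by (rule trans[OF sym])
    with y(3) have "sl2 L \<gamma> y = sl2 L' \<gamma> y" by simp
    with y(1,2) show "\<exists>y\<in>cover G. dist y x < e \<and> sl2 L \<gamma> y = sl2 L' \<gamma> y" by blast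
  qed
qed

lemma (in torus) bundle_of_agree:
  assumes "tC G = UNIV" "transforms_by G s L"
    and "\<And>x. x \<in> cover G \<Longrightarrow> sigma_SO x \<noteq> 0 \<Longrightarrow> s x \<noteq> 0"
  shows "agree G (bundle_of G s) L"
proof (rule transforms_by_unique[OF assms(1) _ assms(2,3)])
  show "transforms_by G s (bundle_of G s)"
    unfolding bundle_of_def by (rule someI[of "transforms_by G s", OF assms(2)])
qed

abbreviation sigma_bundle :: "(complex ^ 'n) multiplier" where
  "sigma_bundle \<equiv> tensor (omega (- int CARD('n))) theta_bundle"

lemma (in torus) transforms_by_sigma_SO: "transforms_by G sigma_SO sigma_bundle"
  unfolding transforms_by_def
proof (intro conjI ballI)
  show "line_bundle G sigma_bundle"
    by (intro line_bundle_tensor line_bundle_omega line_bundle_theta)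
  show "sigma_SO (lat_act m n x) = lat sigma_bundle m n x * sigma_SO x"
    if "x \<in> cover G" "m \<in> coX G" "n \<in> coX G" for x m n
    using sigma_SO_lat[OF that] by (simp add: tensor_def omega_def)
qed (rule sigma_SO_sl2)

section \<open>The line bundles of U(n) and Spin(2n)\<close>

text \<open>
The quotient of \<open>sigma_U\<close> by \<open>sigma_SO\<close>.
\<close>

definition y_half_prod :: "complex \<times> (complex ^ 'n) \<Rightarrow> complex" where
  "y_half_prod x = (\<Prod>j\<in>UNIV. - y_half (snd x $ j))"

lemma sigma_U_conv: "sigma_U x = y_half_prod x * sigma_SO x"
  by (simp add: sigma_U_def sigma_SO_def upsilon_def y_half_prod_def prod.distrib[symmetric])

lemma y_half_prod_nonzero: "y_half_prod x \<noteq> 0"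
  by (simp add: y_half_prod_def)

text \<open>
This exhibits a multiplier for \<open>sigma_U\<close>, so that the choice made in \<open>bundle_of\<close> is not vacuous.
\<close>

lemma transforms_by_sigma_U:
  "transforms_by U_data sigma_U (tensor (coboundary y_half_prod) (sigma_bundle :: (complex ^ 'n::finite) multiplier))"
proof -
  let ?G = "U_data :: (complex ^ 'n) torus_data"
  have nz: "denom \<gamma> (fst x) \<noteq> 0" if "\<gamma> \<in> SL2Z" "x \<in> cover ?G" for \<gamma> x
    by (intro denom_nonzero that U.Im_cover)
  have lb: "line_bundle ?G (coboundary y_half_prod)"
  proof (rule U.line_bundle_coboundary)
    show "holo_on (\<lambda>x. y_half_prod (lat_act m n x)) (cover ?G)" for m n
      unfolding lat_act_eq y_half_prod_def y_half_def snd_conv vector_add_component vector_smult_component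
      by (intro holo_intros holo_on_minus)
    show "holo_on (\<lambda>x. y_half_prod (sl2_act \<gamma> x)) (cover ?G)" if "\<gamma> \<in> SL2Z" for \<gamma>
    proof -
      obtain a b c d where g: "\<gamma> = (a, b, c, d)" by (cases \<gamma>)
      have "holo_on (\<lambda>x. denom \<gamma> (fst x)) (cover ?G)"
        unfolding g denom.simps by (intro holo_intros)
      then show ?thesis
        unfolding sl2_act_eq y_half_prod_def y_half_def snd_conv vector_add_component vector_smult_component
        by (intro holo_intros holo_on_minus nz that)
    qed
    show "holo_on y_half_prod (cover ?G)"
      unfolding y_half_prod_def y_half_def
      by (intro holo_intros holo_on_minus)
    show "y_half_prod x \<noteq> 0" for x :: "complex \<times> (complex ^ 'n)" by (rule y_half_prod_nonzero)
    fix w :: "complex ^ 'n \<Rightarrow> complex ^ 'n" and x assume "w \<in> weyl U_data"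
    then obtain p where p: "bij p" "w = (\<lambda>z. \<chi> j. z $ p j)"
      by (auto simp: permutation_maps_def U_data_def)
    show "y_half_prod (fst x, w (snd x)) = y_half_prod x"
      using bij_prod_reindex[OF p(1), of "\<lambda>j. - y_half (snd x $ j)"] by (simp add: y_half_prod_def p(2))
  qed
  note sig = U.transforms_by_sigma_SO[unfolded transforms_by_def]
  show ?thesis
    unfolding transforms_by_def
  proof (intro conjI ballI)
    show "line_bundle ?G (tensor (coboundary y_half_prod) sigma_bundle)"
      using lb sig by (blast intro: line_bundle_tensor)
    fix x assume x: "x \<in> cover ?G"
    show "sigma_U (lat_act m n x) = lat (tensor (coboundary y_half_prod) sigma_bundle) m n x * sigma_U x"
      if "m \<in> coX ?G" "n \<in> coX ?G" for m n
    proof -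
      have "sigma_SO (lat_act m n x) = lat sigma_bundle m n x * sigma_SO x" using sig x that by blast
      then show ?thesis
        unfolding sigma_U_conv lat_tensor[of "coboundary _"] lat_coboundary
        using y_half_prod_nonzero[of x] by simp
    qed
    show "sigma_U (sl2_act \<gamma> x) = sl2 (tensor (coboundary y_half_prod) sigma_bundle) \<gamma> x * sigma_U x"
      if "\<gamma> \<in> SL2Z" for \<gamma>
    proof -
      have "sigma_SO (sl2_act \<gamma> x) = sl2 sigma_bundle \<gamma> x * sigma_SO x" using sig x that by blast
      then show ?thesis
        unfolding sigma_U_conv sl2_tensor[of "coboundary _"] sl2_coboundary
        using y_half_prod_nonzero[of x] by simp
    qed
  qed
qed

lemma (in torus) agree_tensor_omega_cancel:
  "agree G (tensor (tensor (omega (- k)) L) (omega k)) L"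
  using denom_nonzero[OF _ Im_cover]
  by (simp add: agree_def tensor_def omega_def power_int_minus)

lemma agree_refl: "agree G L L" by (simp add: agree_def)

lemma L_Spin_agree: "agree (Spin_data :: (complex ^ 'n::finite) torus_data) L_Spin (looijenga level_one)"
proof -
  have "agree Spin_data A_Spin (sigma_bundle :: (complex ^ 'n) multiplier)"
    unfolding A_Spin_def by (rule Spin.bundle_of_agree[OF _ Spin.transforms_by_sigma_SO])
      (simp_all add: Spin_data_def)
  then have "agree (Spin_data :: (complex ^ 'n) torus_data) (tensor A_Spin (omega (int CARD('n)))) (tensor sigma_bundle (omega (int CARD('n))))"
    by (rule agree_tensor[OF _ agree_refl])
  then have "agree (Spin_data :: (complex ^ 'n) torus_data) L_Spin theta_bundle"
    unfolding L_Spin_def by (rule agree_trans[OF _ Spin.agree_tensor_omega_cancel])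
  moreover have "agree Spin_data theta_bundle (looijenga level_one :: (complex ^ 'n) multiplier)"
    by (rule agree_looijenga) (simp add: Spin_data_def)
  ultimately show ?thesis by (rule agree_trans)
qed

text \<open>
The product of the \<open>y\<^sub>j\<^sup>1\<^sup>/\<^sup>2\<close> is the exponential of \<open>\<pi>\<i>\<close> times the sum of the coordinates, which is \<open>0\<close>.
\<close>

lemma y_half_prod_SU:
  fixes x :: "complex \<times> (complex ^ 'n::finite)"
  assumes "x \<in> cover SU_data"
  shows "y_half_prod x = (- 1) ^ CARD('n)"
proof -
  have "y_half_prod x = (- 1) ^ CARD('n) * (\<Prod>j\<in>UNIV. y_half (snd x $ j))"
    by (simp add: y_half_prod_def prod_uminus)
  also have "(\<Prod>j\<in>UNIV. y_half (snd x $ j)) = exp (of_real pi * \<i> * (\<Sum>j\<in>UNIV. snd x $ j))"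
    by (simp add: y_half_def exp_sum sum_distrib_left)
  also have "(\<Sum>j\<in>UNIV. snd x $ j) = 0" using assms by (auto simp: cover_def SU_data_def)
  finally show ?thesis by simp
qed

text \<open>
On the torus of \<open>SU(n)\<close> the coboundary of a constant is trivial, so that the multiplier of \<open>sigma_U\<close>
restricts to that of \<open>sigma_SO\<close>.
\<close>

lemma SU_L_U_agree:
  "agree (SU_data :: (complex ^ 'n::finite) torus_data) (pullback SU_to_U L_U) (looijenga level_one)"
proof -
  let ?G = "SU_data :: (complex ^ 'n) torus_data" and ?H = "U_data :: (complex ^ 'n) torus_data"
  let ?C = "coboundary y_half_prod :: (complex ^ 'n) multiplier"
  have A: "agree ?H A_U (tensor ?C sigma_bundle)"
    unfolding A_U_def
  proof (rule U.bundle_of_agree[OF _ transforms_by_sigma_U])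
    show "sigma_U x \<noteq> 0" if "sigma_SO x \<noteq> 0" for x :: "complex \<times> (complex ^ 'n)"
      using that y_half_prod_nonzero[of x] by (simp add: sigma_U_conv)
  qed (simp add: U_data_def)
  have sub: "cover ?G \<subseteq> cover ?H" "coX ?G \<subseteq> coX ?H"
    by (auto simp: cover_def SU_data_def U_data_def)
  have "agree ?G (pullback SU_to_U L_U) (tensor sigma_bundle (omega (int CARD('n))))"
    unfolding agree_def
  proof (intro ballI conjI)
    fix x assume x: "x \<in> cover ?G"
    show "lat (pullback SU_to_U L_U) m n x = lat (tensor sigma_bundle (omega (int CARD('n)))) m n x"
      if mn: "m \<in> coX ?G" "n \<in> coX ?G" for m n
    proof -
      have "lat A_U m n x = lat (tensor ?C sigma_bundle) m n x"
        using A x mn sub unfolding agree_def by blast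
      moreover have "lat ?C m n x = 1"
        unfolding lat_coboundary sl2_coboundary
        by (simp add: y_half_prod_SU SU.lat_act_cover x mn)
      ultimately show ?thesis
        by (simp add: pullback_def SU_to_U_def L_U_def tensor_def)
    qed
    show "sl2 (pullback SU_to_U L_U) \<gamma> x = sl2 (tensor sigma_bundle (omega (int CARD('n)))) \<gamma> x"
      if g: "\<gamma> \<in> SL2Z" for \<gamma>
    proof -
      have "sl2 A_U \<gamma> x = sl2 (tensor ?C sigma_bundle) \<gamma> x"
        using A x g sub unfolding agree_def by blast
      moreover have "sl2 ?C \<gamma> x = 1"
        unfolding lat_coboundary sl2_coboundary
        by (simp add: y_half_prod_SU SU.sl2_act_cover x g)
      ultimately show ?thesis
        by (simp add: pullback_def SU_to_U_def L_U_def tensor_def)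
    qed
  qed
  then have "agree ?G (pullback SU_to_U L_U) theta_bundle"
    by (rule agree_trans[OF _ SU.agree_tensor_omega_cancel])
  moreover have "agree ?G theta_bundle (looijenga level_one :: (complex ^ 'n) multiplier)"
    by (rule agree_looijenga) (simp add: SU_data_def)
  ultimately show ?thesis by (rule agree_trans)
qed

lemma (in torus) ell_sections_agree:
  assumes "agree G L L'"
  shows "ell_sections G k L = ell_sections G k L'"
  unfolding ell_sections_def global_sections_agree[OF agree_tensor[OF agree_refl assms]] ..

lemma (in torus) Beta_sigma_ell_sections:
  assumes "agree G theta_bundle L"
  shows "Beta (- int CARD('n)) (restrict (\<lambda>x. c * sigma_SO x) (cover G)) \<in> ell_sections G (int CARD('n)) L"
  using sigma_SO_global_section[of c]
  unfolding ell_sections_agree[OF assms, symmetric] by (auto simp: ell_sections_def)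

lemma Eu_SU_alt:
  "(Eu_SU :: (complex \<times> (complex ^ 'n::finite)) beta_expr) =
    Beta (- int CARD('n)) (restrict (\<lambda>x. (- 1) ^ CARD('n) * sigma_SO x) (cover SU_data))"
  unfolding Eu_SU_def
  by (intro arg_cong[of _ _ "Beta _"] restrict_ext) (simp add: sigma_U_conv y_half_prod_SU)

lemma Eu_Spin_alt:
  "(Eu_Spin :: (complex \<times> (complex ^ 'n::finite)) beta_expr) =
    Beta (- int CARD('n)) (restrict (\<lambda>x. 1 * sigma_SO x) (cover Spin_data))"
  by (simp add: Eu_Spin_def)

text \<open>
An integer is congruent to its square modulo \<open>2\<close>.
\<close>

lemma level_one_even:
  assumes "v \<in> int_vectors" "(\<Sum>j\<in>UNIV. v $ j) / 2 \<in> \<int>"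
  shows "\<exists>k::int. level_one v v = 2 * of_int k"
proof -
  have "\<forall>j. \<exists>k::int. v $ j = of_int k" using assms(1) by (auto simp: int_vectors_def elim: Ints_cases)
  then obtain k where k: "\<And>j. v $ j = complex_of_int (k j)" by metis
  obtain l where l: "(\<Sum>j\<in>UNIV. v $ j) / 2 = of_int l" using assms(2) by (auto elim: Ints_cases)
  have "even (\<Sum>j\<in>UNIV. k j * k j - k j)" by (intro dvd_sum) simp
  then obtain m where m: "(\<Sum>j\<in>UNIV. k j * k j - k j) = 2 * m" by blast
  have "level_one v v = (\<Sum>j\<in>UNIV. complex_of_int (k j * k j - k j)) + (\<Sum>j\<in>UNIV. v $ j)"
    by (simp add: level_one_def k sum_subtractf)
  also have "(\<Sum>j\<in>UNIV. complex_of_int (k j * k j - k j)) = of_int (2 * m)"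
    by (simp only: m[symmetric] of_int_sum)
  also have "(\<Sum>j\<in>UNIV. v $ j) = 2 * of_int l" using l by simp
  finally have "level_one v v = 2 * of_int (m + l)" by simp
  then show ?thesis by blast
qed

lemma (in torus) is_level_one:
  assumes "\<And>m. m \<in> coX G \<Longrightarrow> (\<Sum>j\<in>UNIV. m $ j) / 2 \<in> \<int>"
  shows "is_level G level_one"
  unfolding is_level_def
proof (intro conjI ballI allI impI)
  fix u v w :: "complex ^ 'n" and c
  show "level_one (u + v) w = level_one u w + level_one v w"
    "level_one (c *s u) w = c * level_one u w" "level_one u v = level_one v u"
    by (simp_all add: level_one_def sum.distrib ring_distribs sum_distrib_left mult_ac)
next
  fix w and u v :: "complex ^ 'n" assume "w \<in> weyl G"
  then obtain p s where w: "bij p" "\<forall>j. s j \<in> {1, -1}" "w = (\<lambda>z. \<chi> j. s j * z $ p j)"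
    by (rule weylE)
  have sgn: "s j * a * (s j * b) = a * b" for j a b
    using w(2)[rule_format, of j] by auto
  show "level_one (w u) (w v) = level_one u v"
    unfolding level_one_def w(3) vec_lambda_beta sgn by (rule bij_sum_reindex[OF w(1)])
next
  fix u v :: "complex ^ 'n" assume "(\<forall>j. u $ j \<in> \<real>) \<and> (\<forall>j. v $ j \<in> \<real>)"
  then show "level_one u v \<in> \<real>" unfolding level_one_def by (intro sum_in_Reals Reals_mult) auto
next
  fix v :: "complex ^ 'n" assume v: "(\<forall>j. v $ j \<in> \<real>) \<and> v \<noteq> 0"
  have sq: "Re (v $ j * v $ j) = (Re (v $ j))\<^sup>2" for j
    using v by (auto simp: complex_is_Real_iff power2_eq_square)
  obtain i where "v $ i \<noteq> 0" using v by (auto simp: vec_eq_iff)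
  then have "Re (v $ i) \<noteq> 0" using v by (auto simp: complex_is_Real_iff complex_eq_iff)
  then have "0 < (\<Sum>j\<in>UNIV. (Re (v $ j))\<^sup>2)"
    by (intro sum_pos2[of _ i]) auto
  then show "0 < Re (level_one v v)" by (simp add: level_one_def sq del: times_complex.simps)
next
  show "\<exists>k::int. level_one v v = 2 * of_int k" if "v \<in> coX G" for v
    using that coX_int by (intro level_one_even assms) auto
qed

section \<open>Super characters of fermionic Fock spaces\<close>

text \<open>
The expansion of an infinite product over the finite sets of factors from which \<open>f\<close> is taken.  The sum
converges absolutely, since its partial sums are bounded by \<open>\<Prod> (1 + |f e|) \<le> exp (\<Sum> |f e|)\<close>; so its value
can be computed along the power sets of an exhausting sequence, where the expansion is finite.
\<close>

lemma has_sum_finite_subsets_prod: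
  fixes f :: "'a \<Rightarrow> complex" and A :: "nat \<Rightarrow> 'a set"
  assumes fin: "\<And>n. finite (A n)" and mono: "\<And>m n. m \<le> n \<Longrightarrow> A m \<subseteq> A n"
    and M: "(\<Union>n. A n) = M"
    and bound: "\<And>n. (\<Sum>e\<in>A n. norm (f e)) \<le> C"
    and lim: "(\<lambda>n. \<Prod>e\<in>A n. 1 + f e) \<longlonglongrightarrow> L"
  shows "((\<lambda>S. \<Prod>e\<in>S. f e) has_sum L) {S. finite S \<and> S \<subseteq> M}"
proof -
  define B where "B = {S. finite S \<and> S \<subseteq> M}"
  have cofinal: "\<exists>n. X \<subseteq> Pow (A n)" if X: "finite X" "X \<subseteq> B" for X
  proof -
    have "\<exists>n. S \<subseteq> A n" if "finite S" "S \<subseteq> M" for S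
      using that
    proof (induction S rule: finite_induct)
      case (insert x S)
      then obtain n k where "S \<subseteq> A n" "x \<in> A k" using M by blast
      then have "insert x S \<subseteq> A (max n k)"
        using mono[of n "max n k"] mono[of k "max n k"] by auto
      then show ?case ..
    qed auto
    moreover have "finite (\<Union>X)" "\<Union>X \<subseteq> M" using X by (auto simp: B_def)
    ultimately obtain n where "\<Union>X \<subseteq> A n" by blast
    then show ?thesis by blast
  qed
  have Pow: "(\<Sum>S\<in>Pow (A n). \<Prod>e\<in>S. g e) = (\<Prod>e\<in>A n. 1 + g e)" for n and g :: "'a \<Rightarrow> 'b::comm_semiring_1"
    using prod_add[OF fin, of g "\<lambda>_. 1" n] by (simp add: add.commute)
  have PowB: "Pow (A n) \<subseteq> B" for n
    using M by (auto simp: B_def intro: finite_subset[OF _ fin])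
  have "(\<lambda>S. norm (\<Prod>e\<in>S. f e)) summable_on B"
  proof (rule nonneg_bdd_above_summable_on)
    show "bdd_above (sum (\<lambda>S. norm (\<Prod>e\<in>S. f e)) ` {F. F \<subseteq> B \<and> finite F})"
    proof (rule bdd_aboveI2)
      fix F assume "F \<in> {F. F \<subseteq> B \<and> finite F}"
      then obtain n where n: "F \<subseteq> Pow (A n)" using cofinal by blast
      have "(\<Sum>S\<in>F. norm (\<Prod>e\<in>S. f e)) \<le> (\<Sum>S\<in>Pow (A n). norm (\<Prod>e\<in>S. f e))"
        using n fin by (intro sum_mono2) auto
      also have "\<dots> = (\<Prod>e\<in>A n. 1 + norm (f e))"
        unfolding prod_norm[symmetric] by (rule Pow)
      also have "\<dots> \<le> exp (\<Sum>e\<in>A n. norm (f e))"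
        by (rule prod_le_exp_sum) auto
      also have "\<dots> \<le> exp C" using bound by simp
      finally show "(\<Sum>S\<in>F. norm (\<Prod>e\<in>S. f e)) \<le> exp C" .
    qed
  qed auto
  then have "(\<lambda>S. \<Prod>e\<in>S. f e) summable_on B" by (rule abs_summable_summable)
  then obtain s where s: "((\<lambda>S. \<Prod>e\<in>S. f e) has_sum s) B" by (auto simp: summable_on_def)
  have "filterlim (\<lambda>n. Pow (A n)) (finite_subsets_at_top B) sequentially"
    unfolding filterlim_finite_subsets_at_top
  proof (intro allI impI)
    fix X assume "finite X \<and> X \<subseteq> B"
    then obtain n where n: "X \<subseteq> Pow (A n)" using cofinal by blast
    have "finite (Pow (A k)) \<and> X \<subseteq> Pow (A k) \<and> Pow (A k) \<subseteq> B" if "k \<ge> n" for k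
      using n mono[OF that] fin[of k] PowB[of k] by auto
    then show "\<forall>\<^sub>F k in sequentially. finite (Pow (A k)) \<and> X \<subseteq> Pow (A k) \<and> Pow (A k) \<subseteq> B"
      by (auto simp: eventually_sequentially)
  qed
  with s have "(\<lambda>n. \<Sum>S\<in>Pow (A n). \<Prod>e\<in>S. f e) \<longlonglongrightarrow> s"
    unfolding has_sum_def by (rule filterlim_compose)
  then have "(\<lambda>n. \<Prod>e\<in>A n. 1 + f e) \<longlonglongrightarrow> s" unfolding Pow .
  with lim have "L = s" by (rule LIMSEQ_unique)
  with s show ?thesis by (simp add: B_def)
qed

text \<open>
The modes of positive energy together with one half of the zero modes, selected by \<open>b\<close>.
\<close>

definition modes :: "bool \<Rightarrow> 'n mode set" where
  "modes b = {(m, j, s). s = b \<or> m > 0}"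

lemma vacuum_SU_modes: "vacuum_SU = fock_space (modes True) 0"
  unfolding vacuum_SU_def modes_def by (rule arg_cong[of _ _ "\<lambda>M. fock_space M 0"]) auto

lemma vacuum_Spin_modes: "vacuum_Spin = fock_space (modes False) (\<chi> j. 1 / 2)"
  unfolding vacuum_Spin_def modes_def by (rule arg_cong[of _ _ "\<lambda>M. fock_space M (\<chi> j. 1 / 2)"]) auto

lemma fock_space_simps [simp]:
  "basis (fock_space M \<mu>) = {S. finite S \<and> S \<subseteq> M}"
  "energy (fock_space M \<mu>) S = (\<Sum>e\<in>S. int (fst e))"
  "is_odd (fock_space M \<mu>) S = odd (card S)"
  "weight (fock_space M \<mu>) S = \<mu> + (\<Sum>e\<in>S. mode_weight e)"
  by (simp_all add: fock_space_def case_prod_unfold)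

text \<open>
A mode that occurs in a state has at most the energy of the state.
\<close>

lemma finite_energy_space:
  "finite {S \<in> basis (fock_space (M :: 'n::finite mode set) \<mu>). energy (fock_space M \<mu>) S = k}"
proof (rule finite_subset)
  show "finite (Pow ({..nat k} \<times> (UNIV :: ('n \<times> bool) set)))" by simp
  show "{S \<in> basis (fock_space M \<mu>). energy (fock_space M \<mu>) S = k} \<subseteq> Pow ({..nat k} \<times> UNIV)"
  proof
    fix S assume "S \<in> {S \<in> basis (fock_space M \<mu>). energy (fock_space M \<mu>) S = k}"
    then have S: "finite S" "(\<Sum>e\<in>S. int (fst e)) = k" by auto
    have "int (fst e) \<le> k" if "e \<in> S" for e
      unfolding S(2)[symmetric] using that S(1) by (intro member_le_sum) auto
    then show "S \<in> Pow ({..nat k} \<times> UNIV)" by (force simp: mem_Times_iff)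
  qed
qed

lemma torus_char_0: "torus_char 0 z = 1"
  and torus_char_add: "torus_char (\<mu> + \<nu>) z = torus_char \<mu> z * torus_char \<nu> z"
  by (simp_all add: torus_char_def ring_distribs sum.distrib exp_add)

lemma torus_char_sum: "torus_char (\<Sum>e\<in>S. f e) z = (\<Prod>e\<in>S. torus_char (f e) z)"
  by (induction S rule: infinite_finite_induct) (simp_all add: torus_char_0 torus_char_add)

lemma torus_char_mode_weight:
  "torus_char (mode_weight (m, j, s)) z = (if s then y_of (z $ j) else inverse (y_of (z $ j)))"
proof -
  have "(\<Sum>i\<in>UNIV. mode_weight (m, j, s) $ i * z $ i) = (\<Sum>i\<in>UNIV. if i = j then (if s then z $ j else - (z $ j)) else 0)"
    by (intro sum.cong refl) (simp add: mode_weight_def axis_def)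
  then have "torus_char (mode_weight (m, j, s)) z = y_of (if s then z $ j else - (z $ j))"
    by (simp add: torus_char_def y_of_def)
  then show ?thesis by (simp add: y_of_minus)
qed

lemma torus_char_half: "torus_char (\<chi> j. 1 / 2) z = (\<Prod>j\<in>UNIV. y_half (z $ j))"
  by (simp add: torus_char_def y_half_def exp_sum[symmetric] sum_distrib_left mult_ac)

text \<open>
A state \<open>S\<close> contributes \<open>\<Prod>e\<in>S. - q\<^sup>m y\<^sup>w\<close> with \<open>m\<close> the energy and \<open>w\<close> the weight of the mode \<open>e\<close>, apart from
the factor of the weight \<open>\<mu>\<close> of the empty state.  The sum over all states is therefore an expanded product; absolute
convergence allows it to be taken energy by energy.
\<close>

lemma fock_space_super_character:
  fixes \<mu> :: "complex ^ 'n::finite"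
  assumes "Im \<tau> > 0"
  shows "super_character (fock_space (modes b) \<mu>) (\<tau>, z) =
    torus_char \<mu> z * (\<Prod>j\<in>UNIV. (1 - (if b then y_of (z $ j) else inverse (y_of (z $ j)))) *
      (\<Prod>m. (1 - nome \<tau> ^ Suc m * y_of (z $ j)) * (1 - nome \<tau> ^ Suc m * inverse (y_of (z $ j)))))"
    (is "_ = _ * ?P")
proof -
  define q where "q = nome \<tau>"
  have q: "norm q < 1" using norm_nome_less_1[OF assms] by (simp add: q_def)
  define u where "u = (\<lambda>e :: 'n mode. torus_char (mode_weight e) z)"
  define f where "f = (\<lambda>e :: 'n mode. - (q ^ fst e * u e))"
  define A where "A = (\<lambda>n. {e \<in> (modes b :: 'n mode set). fst e \<le> n})"
  define M where "M = (modes b :: 'n mode set)"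
  define V where "V = fock_space M \<mu>"
  have fin: "finite (A n)" for n
  proof (rule finite_subset)
    show "A n \<subseteq> {..n} \<times> UNIV" by (auto simp: A_def)
  qed simp
  have A_eq: "A n = (\<lambda>j. (0, j, b)) ` UNIV \<union> (\<lambda>(m, j, s). (Suc m, j, s)) ` ({..<n} \<times> UNIV \<times> UNIV)" for n
  proof (rule set_eqI)
    fix e :: "'n mode"
    obtain m j s where e: "e = (m, j, s)" by (cases e)
    show "e \<in> A n \<longleftrightarrow> e \<in> (\<lambda>j. (0, j, b)) ` UNIV \<union> (\<lambda>(m, j, s). (Suc m, j, s)) ` ({..<n} \<times> UNIV \<times> UNIV)"
      unfolding e by (cases m) (auto simp: A_def modes_def image_iff)
  qed
  have prod_A: "(\<Prod>e\<in>A n. 1 + f e) = (\<Prod>j\<in>UNIV. (1 + f (0, j, b)) *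
      (\<Prod>m<n. (1 - q ^ Suc m * y_of (z $ j)) * (1 - q ^ Suc m * inverse (y_of (z $ j)))))" for n
  proof -
    have "(\<Prod>e\<in>A n. 1 + f e) = (\<Prod>e\<in>(\<lambda>j. (0, j, b)) ` UNIV. 1 + f e) *
        (\<Prod>e\<in>(\<lambda>(m, j, s). (Suc m, j, s)) ` ({..<n} \<times> UNIV \<times> UNIV). 1 + f e)"
      unfolding A_eq by (rule prod.union_disjoint) auto
    also have "(\<Prod>e\<in>(\<lambda>j. (0, j, b)) ` UNIV. 1 + f e) = (\<Prod>j\<in>UNIV. 1 + f (0, j, b))"
      by (subst prod.reindex) (auto simp: inj_on_def)
    also have "(\<Prod>e\<in>(\<lambda>(m, j, s). (Suc m, j, s)) ` ({..<n} \<times> UNIV \<times> UNIV). 1 + f e) =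
        (\<Prod>(m, j, s)\<in>{..<n} \<times> UNIV \<times> UNIV. 1 + f (Suc m, j, s))"
      by (subst prod.reindex) (auto simp: inj_on_def case_prod_unfold)
    also have "\<dots> = (\<Prod>m<n. \<Prod>j\<in>UNIV. \<Prod>s\<in>UNIV. 1 + f (Suc m, j, s))"
      by (simp add: prod.cartesian_product case_prod_unfold)
    also have "\<dots> = (\<Prod>j\<in>UNIV. \<Prod>m<n. \<Prod>s\<in>UNIV. 1 + f (Suc m, j, s))"
      by (rule prod.swap)
    also have "\<dots> = (\<Prod>j\<in>UNIV. \<Prod>m<n.
        (1 - q ^ Suc m * y_of (z $ j)) * (1 - q ^ Suc m * inverse (y_of (z $ j))))"
      by (intro prod.cong refl) (simp add: UNIV_bool f_def u_def torus_char_mode_weight mult.commute)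
    finally show ?thesis by (simp only: prod.distrib)
  qed
  have lim: "(\<lambda>n. \<Prod>e\<in>A n. 1 + f e) \<longlonglongrightarrow> ?P"
    unfolding prod_A
  proof (intro tendsto_prod tendsto_mult)
    fix j
    show "(\<lambda>n. 1 + f (0, j, b)) \<longlonglongrightarrow> 1 - (if b then y_of (z $ j) else inverse (y_of (z $ j)))"
      by (simp add: f_def u_def torus_char_mode_weight)
    have "convergent_prod (\<lambda>m. (1 - q ^ Suc m * y_of (z $ j)) * (1 - q ^ Suc m * inverse (y_of (z $ j))))"
      by (intro convergent_prod_mult prodinf_conv_qpoch(2) q)
    from convergent_prod_LIMSEQ[OF this]
    show "(\<lambda>n. \<Prod>m<n. (1 - q ^ Suc m * y_of (z $ j)) * (1 - q ^ Suc m * inverse (y_of (z $ j)))) \<longlonglongrightarrow>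
        (\<Prod>m. (1 - nome \<tau> ^ Suc m * y_of (z $ j)) * (1 - nome \<tau> ^ Suc m * inverse (y_of (z $ j))))"
      unfolding q_def by (rule LIMSEQ_lessThan_iff_atMost[THEN iffD2])
  qed
  \<comment> \<open>The weights do not depend on the energy, so the sum over all modes is dominated by a geometric series.\<close>
  define K where "K = (\<Sum>(j, s)\<in>UNIV. norm (u (0, j, s)))"
  have u0: "u (m, j, s) = u (0, j, s)" for m j s by (simp add: u_def torus_char_mode_weight)
  have bound: "(\<Sum>e\<in>A n. norm (f e)) \<le> (1 / (1 - norm q)) * K" for n
  proof -
    have "(\<Sum>e\<in>A n. norm (f e)) \<le> (\<Sum>e\<in>{..n} \<times> UNIV. norm (f e))"
      by (rule sum_mono2) (auto simp: A_def)
    also have "\<dots> = (\<Sum>(m, j, s)\<in>{..n} \<times> UNIV. norm q ^ m * norm (u (0, j, s)))"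
      by (intro sum.cong refl) (auto simp: f_def norm_mult norm_power u0[of "Suc _"] intro: arg_cong[OF u0])
    also have "\<dots> = (\<Sum>m\<le>n. \<Sum>x\<in>UNIV. norm q ^ m * norm (u (0, fst x, snd x)))"
      by (simp add: sum.cartesian_product case_prod_unfold)
    also have "\<dots> = (\<Sum>m\<le>n. norm q ^ m) * K"
      by (simp add: K_def case_prod_unfold sum_product)
    also have "(\<Sum>m\<le>n. norm q ^ m) \<le> (\<Sum>m. norm q ^ m)"
      using q by (intro sum_le_suminf summable_geometric) auto
    also have "(\<Sum>m. norm q ^ m) = 1 / (1 - norm q)" using q by (simp add: suminf_geometric)
    finally show ?thesis by (simp add: K_def mult_right_mono sum_nonneg case_prod_unfold)
  qed
  have hs: "((\<lambda>S. \<Prod>e\<in>S. f e) has_sum ?P) {S. finite S \<and> S \<subseteq> M}"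
    by (rule has_sum_finite_subsets_prod[OF fin _ _ bound lim]) (auto simp: A_def M_def)
  define B where "B = {S. finite S \<and> S \<subseteq> M}"
  define F where "F = (\<lambda>k. {S \<in> basis V. energy V S = k})"
  define g where "g = (\<lambda>S. torus_char \<mu> z * (\<Prod>e\<in>S. f e))"
  have g: "(g has_sum torus_char \<mu> z * ?P) B"
    unfolding g_def B_def using hs by (rule has_sum_cmult_right)
  have Ffin: "finite (F k)" for k unfolding F_def V_def by (rule finite_energy_space)
  have g_eq: "g S = (- 1) ^ card S * torus_char (weight V S) z * q powi energy V S" if "S \<in> basis V" for S
  proof -
    have "(\<Prod>e\<in>S. f e) = (- 1) ^ card S * ((\<Prod>e\<in>S. q ^ fst e) * (\<Prod>e\<in>S. u e))"
      by (simp add: f_def prod_uminus prod.distrib)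
    also have "(\<Prod>e\<in>S. q ^ fst e) = q powi energy V S"
      by (simp add: V_def power_sum[symmetric] flip: of_nat_sum)
    finally show ?thesis
      by (simp add: g_def u_def V_def torus_char_add torus_char_sum)
  qed
  have bij: "bij_betw (\<lambda>S. (energy V S, S)) B (Sigma UNIV F)"
    by (rule bij_betw_byWitness[where f' = snd]) (auto simp: F_def V_def B_def)
  have "(energy_char V k False z - energy_char V k True z) * q powi k = (\<Sum>S\<in>F k. g S)" for k
  proof -
    have split: "F k = {b \<in> basis V. energy V b = k \<and> is_odd V b = False} \<union> {b \<in> basis V. energy V b = k \<and> is_odd V b = True}"
      by (auto simp: F_def)
    have fin': "finite {b \<in> basis V. energy V b = k \<and> is_odd V b = p}" for p
      by (rule finite_subset[OF _ Ffin[of k]]) (auto simp: F_def)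
    have "(\<Sum>S\<in>F k. g S) = (\<Sum>S | S \<in> basis V \<and> energy V S = k \<and> is_odd V S = False. g S) +
        (\<Sum>S | S \<in> basis V \<and> energy V S = k \<and> is_odd V S = True. g S)"
      unfolding split by (rule sum.union_disjoint[OF fin' fin']) auto
    also have "(\<Sum>S | S \<in> basis V \<and> energy V S = k \<and> is_odd V S = False. g S) = energy_char V k False z * q powi k"
      unfolding energy_char_def sum_distrib_right by (intro sum.cong refl) (auto simp: g_eq V_def)
    also have "(\<Sum>S | S \<in> basis V \<and> energy V S = k \<and> is_odd V S = True. g S) = - (energy_char V k True z * q powi k)"
      unfolding energy_char_def sum_distrib_right sum_negf[symmetric] by (intro sum.cong refl) (auto simp: g_eq V_def)
    finally show ?thesis by (simp add: left_diff_distrib)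
  qed
  then have "super_character V (\<tau>, z) = (\<Sum>\<^sub>\<infinity>k. \<Sum>S\<in>F k. g S)"
    by (simp add: super_character_def q_def)
  also have "\<dots> = (\<Sum>\<^sub>\<infinity>k. infsum g (F k))" using Ffin by simp
  also have "\<dots> = infsum (\<lambda>(k, S). g S) (Sigma UNIV F)"
  proof (rule infsum_Sigma'_banach)
    show "(\<lambda>(k, S). g S) summable_on Sigma UNIV F"
      using summable_on_reindex_bij_betw[OF bij, of "\<lambda>(k, S). g S"] g
      by (auto simp: summable_on_def)
  qed
  also have "\<dots> = infsum g B"
    using infsum_reindex_bij_betw[OF bij, of "\<lambda>(k, S). g S"] by simp
  also have "\<dots> = torus_char \<mu> z * ?P" using g by (rule infsumI)
  finally show ?thesis by (simp add: V_def M_def)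
qed

lemma super_character_SU:
  assumes "x \<in> cover G"
  shows "super_character vacuum_SU x = vacuum_product_SU (x :: complex \<times> (complex ^ 'n::finite))"
proof -
  obtain \<tau> z where x: "x = (\<tau>, z)" by (cases x)
  have "Im \<tau> > 0" using assms by (auto simp: x cover_def upper_half_plane_def)
  from fock_space_super_character[OF this, of True 0 z] show ?thesis
    unfolding x vacuum_SU_modes vacuum_product_SU_def by (simp only: torus_char_0 if_True mult_1 fst_conv snd_conv)
qed

lemma super_character_Spin:
  assumes "x \<in> cover G"
  shows "super_character vacuum_Spin x = vacuum_product_Spin (x :: complex \<times> (complex ^ 'n::finite))"
proof -
  obtain \<tau> z where x: "x = (\<tau>, z)" by (cases x)
  have Im: "Im \<tau> > 0" using assms by (auto simp: x cover_def upper_half_plane_def)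
  have *: "y_half v - inverse (y_half v) = y_half v * (1 - inverse (y_of v))" for v
    by (simp add: y_of_conv_y_half right_diff_distrib power2_eq_square)
  show ?thesis
    using fock_space_super_character[OF Im, of False "\<chi> j. 1 / 2" z]
    unfolding x vacuum_Spin_modes vacuum_product_Spin_def torus_char_half * mult.assoc prod.distrib[symmetric] if_False
    by (simp only: fst_conv snd_conv)
qed

section \<open>Weyl invariance of the energy spaces\<close>

text \<open>
A permutation of the basis that respects energy and parity and twists the weights by \<open>w\<close> exhibits the
invariance of the characters of all energy spaces.
\<close>

lemma energy_char_weyl:
  assumes T: "bij_betw T (basis V) (basis V)"
    and inv: "\<And>S. S \<in> basis V \<Longrightarrow> energy V (T S) = energy V S \<and> is_odd V (T S) = is_odd V S \<and>
      torus_char (weight V (T S)) z = torus_char (weight V S) (w z)"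
  shows "energy_char V m p (w z) = energy_char V m p z"
proof -
  let ?F = "{S \<in> basis V. energy V S = m \<and> is_odd V S = p}"
  have "bij_betw T ?F ?F"
  proof (rule bij_betw_imageI)
    show "inj_on T ?F" using bij_betw_imp_inj_on[OF T] by (rule inj_on_subset) auto
    show "T ` ?F = ?F"
    proof
      show "T ` ?F \<subseteq> ?F" using inv bij_betwE[OF T] by auto
      show "?F \<subseteq> T ` ?F"
      proof
        fix S assume S: "S \<in> ?F"
        then obtain R where "R \<in> basis V" "S = T R" using bij_betw_imp_surj_on[OF T] by blast
        with S inv[of R] show "S \<in> T ` ?F" by auto
      qed
    qed
  qed
  then have "energy_char V m p z = (\<Sum>S\<in>?F. torus_char (weight V (T S)) z)"
    unfolding energy_char_def by (rule sum.reindex_bij_betw[symmetric])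
  also have "\<dots> = energy_char V m p (w z)"
    unfolding energy_char_def using inv by (intro sum.cong refl) auto
  finally show ?thesis by simp
qed

lemma odd_card_sym_diff:
  assumes "finite A" "finite B" "even (card B)"
  shows "odd (card ((A - B) \<union> (B - A))) = odd (card A)"
proof -
  have "card ((A - B) \<union> (B - A)) = card (A - B) + card (B - A)"
    using assms by (intro card_Un_disjoint) auto
  moreover have "card A = card (A - B) + card (A \<inter> B)" "card B = card (B - A) + card (A \<inter> B)"
    using assms card_Int_Diff[of A B] card_Int_Diff[of B A] by (simp_all add: Int_commute)
  ultimately show ?thesis using assms(3) by presburger
qed

text \<open>
The contribution of the zero modes is collected per coordinate together with that of \<open>\<mu>\<close>,
as a sign change in a coordinate exchanges the occupied and the empty zero mode of that coordinate.
\<close>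

lemma fock_space_torus_char:
  assumes "\<And>z. torus_char \<mu> z = (\<Prod>j\<in>UNIV. \<kappa> (z $ j))" "finite S" "S \<subseteq> modes b"
  shows "torus_char (weight (fock_space (modes b) \<mu>) S) z =
    (\<Prod>j\<in>UNIV. \<kappa> (z $ j) * (if (0, j, b) \<in> S then torus_char (mode_weight (0, j, b)) z else 1)) *
    (\<Prod>e\<in>{e \<in> S. fst e > 0}. torus_char (mode_weight e) z)"
proof -
  have "S = {e \<in> S. fst e = 0} \<union> {e \<in> S. fst e > 0}" by auto
  then have "(\<Prod>e\<in>S. torus_char (mode_weight e) z) =
      (\<Prod>e\<in>{e \<in> S. fst e = 0} \<union> {e \<in> S. fst e > 0}. torus_char (mode_weight e) z)" by simp
  also have "\<dots> = (\<Prod>e\<in>{e \<in> S. fst e = 0}. torus_char (mode_weight e) z) *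
      (\<Prod>e\<in>{e \<in> S. fst e > 0}. torus_char (mode_weight e) z)"
    using assms(2) by (intro prod.union_disjoint) auto
  also have "{e \<in> S. fst e = 0} = (\<lambda>j. (0, j, b)) ` {j \<in> UNIV. (0, j, b) \<in> S}"
    using assms(3) by (auto simp: modes_def)
  also have "(\<Prod>e\<in>(\<lambda>j. (0, j, b)) ` {j \<in> UNIV. (0, j, b) \<in> S}. torus_char (mode_weight e) z) =
      (\<Prod>j\<in>{j \<in> UNIV. (0, j, b) \<in> S}. torus_char (mode_weight (0, j, b)) z)"
    by (subst prod.reindex) (auto simp: inj_on_def)
  also have "\<dots> = (\<Prod>j\<in>UNIV. if (0, j, b) \<in> S then torus_char (mode_weight (0, j, b)) z else 1)"
    by (rule prod.inter_filter) simp
  finally show ?thesis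
    by (simp add: torus_char_add torus_char_sum assms(1) prod.distrib mult.assoc)
qed

text \<open>
A signed permutation acts on the modes of positive energy by permuting the coordinates and exchanging
the two modes of opposite weight where the sign is \<open>-1\<close>.  There is only one zero mode for each coordinate,
so there a sign \<open>-1\<close> exchanges occupied and empty: the occupied set is changed by the set \<open>F\<close> of the zero modes in
question.  The parity is preserved because the number of signs is even, and \<open>flip\<close> is the condition that the
two states of the zero mode have opposite weights.
\<close>

lemma fock_space_weyl:
  fixes p :: "'n::finite \<Rightarrow> 'n" and s :: "'n \<Rightarrow> complex" and \<mu> :: "complex ^ 'n"
  assumes p: "bij p" and s: "\<forall>j. s j \<in> {1, -1}" "(\<Prod>j\<in>UNIV. s j) = 1"
    and \<kappa>: "\<And>z. torus_char \<mu> z = (\<Prod>j\<in>UNIV. \<kappa> (z $ j))"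
    and flip: "\<And>j v. s j = -1 \<Longrightarrow> \<kappa> (- v) = \<kappa> v * (if b then y_of v else inverse (y_of v))"
  shows "energy_char (fock_space (modes b) \<mu>) m par (\<chi> j. s j * z $ p j) =
    energy_char (fock_space (modes b) \<mu>) m par z"
proof -
  define M where "M = (modes b :: 'n mode set)"
  define V where "V = fock_space M \<mu>"
  define wz where "wz = (\<chi> j. s j * z $ p j)"
  define g where "g = (\<lambda>(m :: nat, j, \<sigma>). (m, p j, if m = 0 then \<sigma> else (\<sigma> = (s j = 1))))"
  define g' where "g' = (\<lambda>(m :: nat, i, \<sigma>). (m, inv p i, if m = 0 then \<sigma> else (\<sigma> = (s (inv p i) = 1))))"
  have inv_p: "inv p (p j) = j" "p (inv p i) = i" for i j
    using p by (simp_all add: bij_is_inj bij_is_surj surj_f_inv_f)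
  have g'g: "g' (g e) = e" and gg': "g (g' e) = e" for e
    by (auto simp: g_def g'_def inv_p split: prod.splits)
  have g_M: "g e \<in> M \<longleftrightarrow> e \<in> M" and g'_M: "g' e \<in> M \<longleftrightarrow> e \<in> M" for e
    by (auto simp: g_def g'_def M_def modes_def split: prod.splits)
  have fst_g: "fst (g e) = fst e" for e by (simp add: g_def split: prod.splits)
  have inj_g: "inj g" by (metis g'g injI)
  define F where "F = (\<lambda>j. (0 :: nat, p j, b)) ` {j. s j = -1}"
  have F: "finite F" "F \<subseteq> M" by (auto simp: F_def M_def modes_def)
  have F0: "\<not> fst e > 0" if "e \<in> F" for e using that by (auto simp: F_def)
  have "(\<Prod>j\<in>UNIV. s j) = (\<Prod>j\<in>UNIV. if s j = -1 then -1 else 1)"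
    using s(1) by (intro prod.cong) auto
  also have "\<dots> = (- 1) ^ card {j. s j = -1}"
    by (simp add: prod.inter_filter[symmetric])
  finally have "even (card {j. s j = -1})" using s(2) by (cases "even (card {j. s j = -1})") auto
  moreover have "card F = card {j. s j = -1}"
    unfolding F_def using bij_is_inj[OF p] by (intro card_image) (auto simp: inj_on_def)
  ultimately have F_even: "even (card F)" by simp
  define T where "T = (\<lambda>S. (g ` S - F) \<union> (F - g ` S))"
  define T' where "T' = (\<lambda>S. g' ` ((S - F) \<union> (F - S)))"
  have bij: "bij_betw T (basis V) (basis V)"
  proof (rule bij_betw_byWitness[where f' = T'])
    show "\<forall>S\<in>basis V. T' (T S) = S"
    proof
      fix S
      have "(T S - F) \<union> (F - T S) = g ` S" by (auto simp: T_def)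
      then show "T' (T S) = S" by (simp add: T'_def image_image g'g)
    qed
    show "\<forall>S\<in>basis V. T (T' S) = S"
      by (auto simp: T_def T'_def image_image gg')
    show "T ` basis V \<subseteq> basis V" "T' ` basis V \<subseteq> basis V"
      using F g_M g'_M by (auto simp: T_def T'_def V_def)
  qed
  have *: "energy V (T S) = energy V S \<and> is_odd V (T S) = is_odd V S \<and>
      torus_char (weight V (T S)) z = torus_char (weight V S) wz" if "S \<in> basis V" for S
  proof (intro conjI)
    have S: "finite S" "S \<subseteq> M" using that by (auto simp: V_def)
    have TS: "finite (T S)" "T S \<subseteq> M" using bij_betwE[OF bij] that by (auto simp: V_def)
    have "{e \<in> T S. fst e > 0} = {e \<in> g ` S. fst e > 0}"
      unfolding T_def using F0 by blast
    also have "\<dots> = g ` {e \<in> S. fst e > 0}"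
      unfolding Compr_image_eq fst_g ..
    finally have pos: "{e \<in> T S. fst e > 0} = g ` {e \<in> S. fst e > 0}" .
    have energy_pos: "energy V R = (\<Sum>e\<in>{e \<in> R. fst e > 0}. int (fst e))" if "finite R" for R
      unfolding V_def fock_space_simps using that by (intro sum.mono_neutral_right) auto
    have "energy V (T S) = (\<Sum>e\<in>g ` {e \<in> S. fst e > 0}. int (fst e))"
      unfolding energy_pos[OF TS(1)] pos ..
    also have "\<dots> = (\<Sum>e\<in>{e \<in> S. fst e > 0}. int (fst e))"
      by (subst sum.reindex[OF inj_on_subset[OF inj_g]]) (auto simp: fst_g)
    also have "\<dots> = energy V S" using energy_pos[OF S(1)] by simp
    finally show "energy V (T S) = energy V S" .
    have "odd (card (T S)) = odd (card (g ` S))"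
      unfolding T_def using S F F_even by (intro odd_card_sym_diff) auto
    also have "card (g ` S) = card S" by (rule card_image[OF inj_on_subset[OF inj_g]]) auto
    finally show "is_odd V (T S) = is_odd V S" by (simp add: V_def)
    have zero: "(0, p j, b) \<in> T S \<longleftrightarrow> ((0, j, b) \<in> S) \<noteq> (s j = -1)" for j
    proof -
      have "(0, p j, b) = g (0, j, b)" by (simp add: g_def)
      then have "(0, p j, b) \<in> g ` S \<longleftrightarrow> (0, j, b) \<in> S" using inj_g by (simp add: inj_image_mem_iff)
      moreover have "(0, p j, b) \<in> F \<longleftrightarrow> s j = -1"
        using bij_is_inj[OF p] by (auto simp: F_def inj_def)
      ultimately show ?thesis unfolding T_def by blast
    qed
    have factor: "\<kappa> (z $ p j) * (if (0, p j, b) \<in> T S then torus_char (mode_weight (0, p j, b)) z else 1) =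
        \<kappa> (wz $ j) * (if (0, j, b) \<in> S then torus_char (mode_weight (0, j, b)) wz else 1)" for j
    proof (cases "s j = -1")
      case True
      then show ?thesis
        using flip[OF True, of "z $ p j"] unfolding zero
        by (simp add: torus_char_mode_weight wz_def y_of_minus)
    next
      case False
      then have "s j = 1" using s(1) by auto
      then show ?thesis unfolding zero by (simp add: torus_char_mode_weight wz_def)
    qed
    have u: "torus_char (mode_weight (g e)) z = torus_char (mode_weight e) wz" if "fst e > 0" for e
    proof -
      obtain m j \<sigma> where e: "e = (m, j, \<sigma>)" by (cases e)
      have "s j = 1 \<or> s j = -1" using s(1) by auto
      then show ?thesis using that
        by (auto simp: e g_def torus_char_mode_weight wz_def y_of_minus)
    qed
    have "torus_char (weight V (T S)) z =
        (\<Prod>j\<in>UNIV. \<kappa> (z $ j) * (if (0, j, b) \<in> T S then torus_char (mode_weight (0, j, b)) z else 1)) *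
        (\<Prod>e\<in>{e \<in> T S. fst e > 0}. torus_char (mode_weight e) z)"
      unfolding V_def M_def by (rule fock_space_torus_char[OF \<kappa> TS[unfolded M_def]])
    also have "(\<Prod>j\<in>UNIV. \<kappa> (z $ j) * (if (0, j, b) \<in> T S then torus_char (mode_weight (0, j, b)) z else 1)) =
        (\<Prod>j\<in>UNIV. \<kappa> (z $ p j) * (if (0, p j, b) \<in> T S then torus_char (mode_weight (0, p j, b)) z else 1))"
      by (rule bij_prod_reindex[OF p, symmetric])
    also have "\<dots> = (\<Prod>j\<in>UNIV. \<kappa> (wz $ j) * (if (0, j, b) \<in> S then torus_char (mode_weight (0, j, b)) wz else 1))"
      by (intro prod.cong refl factor)
    also have "(\<Prod>e\<in>{e \<in> T S. fst e > 0}. torus_char (mode_weight e) z) =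
        (\<Prod>e\<in>{e \<in> S. fst e > 0}. torus_char (mode_weight e) wz)"
      unfolding pos by (subst prod.reindex[OF inj_on_subset[OF inj_g]]) (auto simp: u)
    also have "(\<Prod>j\<in>UNIV. \<kappa> (wz $ j) * (if (0, j, b) \<in> S then torus_char (mode_weight (0, j, b)) wz else 1)) *
        (\<Prod>e\<in>{e \<in> S. fst e > 0}. torus_char (mode_weight e) wz) = torus_char (weight V S) wz"
      unfolding V_def M_def by (rule fock_space_torus_char[OF \<kappa> S[unfolded M_def], symmetric])
    finally show "torus_char (weight V (T S)) z = torus_char (weight V S) wz" .
  qed
  show ?thesis
    using energy_char_weyl[OF bij, of z "\<lambda>_. wz"] * unfolding V_def M_def wz_def by blast
qed

lemma positive_energy_fock_space:
  fixes G :: "(complex ^ 'n::finite) torus_data"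
  assumes weights: "\<And>v. v \<in> coX G \<Longrightarrow> (\<Sum>j\<in>UNIV. \<mu> $ j * v $ j) \<in> \<int>" "coX G \<subseteq> int_vectors"
    and weyl: "\<And>w m par z. w \<in> weyl G \<Longrightarrow>
      energy_char (fock_space M \<mu>) m par (w z) = energy_char (fock_space M \<mu>) m par z"
  shows "positive_energy G (fock_space M \<mu>)"
  unfolding positive_energy_def
proof (intro conjI allI ballI)
  show "\<exists>m0. \<forall>S\<in>basis (fock_space M \<mu>). m0 \<le> energy (fock_space M \<mu>) S"
    by (intro exI[of _ 0]) (simp add: sum_nonneg)
  show "finite {S \<in> basis (fock_space M \<mu>). energy (fock_space M \<mu>) S = m}" for m
    by (rule finite_energy_space)
  fix S v assume v: "v \<in> coX G"
  have "(\<Sum>j\<in>UNIV. mode_weight e $ j * v $ j) \<in> \<int>" for e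
  proof -
    obtain m i s where e: "e = (m, i, s)" by (cases e)
    show ?thesis
      using v weights(2) unfolding e
      by (intro Ints_sum Ints_mult) (auto simp: mode_weight_def axis_def int_vectors_def)
  qed
  then have "(\<Sum>e\<in>S. \<Sum>j\<in>UNIV. mode_weight e $ j * v $ j) \<in> \<int>" by (rule Ints_sum)
  then have "(\<Sum>j\<in>UNIV. \<Sum>e\<in>S. mode_weight e $ j * v $ j) \<in> \<int>" by (subst sum.swap)
  then show "(\<Sum>j\<in>UNIV. weight (fock_space M \<mu>) S $ j * v $ j) \<in> \<int>"
    using weights(1)[OF v] by (simp add: ring_distribs sum.distrib sum_distrib_right)
qed (rule weyl)

lemma positive_energy_SU: "positive_energy (SU_data :: (complex ^ 'n::finite) torus_data) vacuum_SU"
  unfolding vacuum_SU_modes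
proof (rule positive_energy_fock_space)
  fix w :: "complex ^ 'n \<Rightarrow> complex ^ 'n" and m par z assume "w \<in> weyl SU_data"
  then obtain p where p: "bij p" "w = (\<lambda>z. \<chi> j. z $ p j)"
    by (auto simp: SU_data_def permutation_maps_def)
  show "energy_char (fock_space (modes True) 0) m par (w z) = energy_char (fock_space (modes True) 0) m par z"
    using fock_space_weyl[OF p(1), of "\<lambda>_. 1" 0 "\<lambda>_. 1" True m par z]
    by (simp add: p(2) torus_char_0)
qed (auto simp: SU_data_def)

lemma positive_energy_Spin: "positive_energy (Spin_data :: (complex ^ 'n::finite) torus_data) vacuum_Spin"
  unfolding vacuum_Spin_modes
proof (rule positive_energy_fock_space)
  fix w :: "complex ^ 'n \<Rightarrow> complex ^ 'n" and m par z assume "w \<in> weyl Spin_data"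
  then obtain p s where w: "bij p" "\<forall>j. s j \<in> {1, -1}" "(\<Prod>j\<in>UNIV. s j) = 1" "w = (\<lambda>z. \<chi> j. s j * z $ p j)"
    unfolding Spin_data_def torus_data.simps even_signed_permutation_maps_def mem_Collect_eq by blast
  show "energy_char (fock_space (modes False) (\<chi> j. 1 / 2)) m par (w z) =
      energy_char (fock_space (modes False) (\<chi> j. 1 / 2)) m par z"
    unfolding w(4)
  proof (rule fock_space_weyl[OF w(1-3) torus_char_half])
    show "y_half (- v) = y_half v * (if False then y_of v else inverse (y_of v))" for v
      by (simp add: y_half_minus y_of_conv_y_half power2_eq_square)
  qed
next
  fix v :: "complex ^ 'n" assume "v \<in> coX Spin_data"
  then show "(\<Sum>j\<in>UNIV. (\<chi> j. 1 / 2) $ j * v $ j) \<in> \<int>"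
    by (simp add: Spin_data_def sum_divide_distrib)
qed (auto simp: Spin_data_def)

section \<open>Normalized super characters and the Euler classes\<close>

text \<open>
The denominators of \<open>\<sigma>\<close> are the factor by which super characters are normalised.
\<close>

lemma sigma_normalized:
  assumes "Im \<tau> > 0"
  shows "sigma \<tau> z = (y_half z - inverse (y_half z)) *
      (\<Prod>m. (1 - nome \<tau> ^ Suc m * y_of z) * (1 - nome \<tau> ^ Suc m * inverse (y_of z))) /
      (\<Prod>m. 1 - nome \<tau> ^ Suc m) ^ 2"
proof -
  note c = prodinf_conv_qpoch(2)[OF norm_nome_less_1[OF assms]]
  have c1: "convergent_prod (\<lambda>m. 1 - nome \<tau> ^ Suc m)" using c[of 1] by simp
  have "(\<Prod>m. (1 - nome \<tau> ^ Suc m * y_of z) * (1 - nome \<tau> ^ Suc m * inverse (y_of z)) / (1 - nome \<tau> ^ Suc m) ^ 2) =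
      (\<Prod>m. (1 - nome \<tau> ^ Suc m * y_of z) * (1 - nome \<tau> ^ Suc m * inverse (y_of z))) /
      (\<Prod>m. (1 - nome \<tau> ^ Suc m) ^ 2)"
    by (intro prodinf_divide[symmetric] convergent_prod_mult convergent_prod_power c c1)
  then show ?thesis
    unfolding sigma_def by (simp only: prodinf_power[OF c1] times_divide_eq_right)
qed

lemma vacuum_denominator:
  assumes "Im \<tau> > 0"
  shows "(\<Prod>m. (1 - nome \<tau> ^ Suc m) ^ (2 * n)) = ((\<Prod>m. 1 - nome \<tau> ^ Suc m) ^ 2) ^ n"
proof -
  have "convergent_prod (\<lambda>m. 1 - nome \<tau> ^ Suc m)"
    using prodinf_conv_qpoch(2)[OF norm_nome_less_1[OF assms], of 1] by simp
  from prodinf_power[OF this, of "2 * n"] show ?thesis by (simp only: power_mult[symmetric])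
qed

lemma normalized_super_character_Spin:
  assumes "x \<in> cover G"
  shows "normalized_super_character vacuum_Spin x = sigma_SO (x :: complex \<times> (complex ^ 'n::finite))"
proof -
  have Im: "Im (fst x) > 0" using assms by (auto simp: cover_def upper_half_plane_def)
  show ?thesis
    unfolding normalized_super_character_def super_character_Spin[OF assms] vacuum_denominator[OF Im]
      vacuum_product_Spin_def sigma_SO_def sigma_normalized[OF Im] prod_dividef prod_constant ..
qed

lemma normalized_super_character_SU:
  assumes "x \<in> cover G"
  shows "normalized_super_character vacuum_SU x = sigma_U (x :: complex \<times> (complex ^ 'n::finite))"
proof -
  have Im: "Im (fst x) > 0" using assms by (auto simp: cover_def upper_half_plane_def)
  have y: "- y_half v * ((y_half v - inverse (y_half v)) * A / B) = (1 - y_of v) * A / B" for v A B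
  proof -
    have "- y_half v * (y_half v - inverse (y_half v)) = 1 - y_of v"
      by (simp add: y_of_conv_y_half right_diff_distrib power2_eq_square)
    then show ?thesis by (metis mult.assoc times_divide_eq_right)
  qed
  show ?thesis
    unfolding normalized_super_character_def super_character_SU[OF assms] vacuum_denominator[OF Im]
      vacuum_product_SU_def sigma_U_def upsilon_def sigma_normalized[OF Im] y prod_dividef prod_constant ..
qed

lemma half_sum_Ints_SU: "m \<in> coX SU_data \<Longrightarrow> (\<Sum>j\<in>UNIV. m $ j) / 2 \<in> \<int>"
  and half_sum_Ints_Spin: "m \<in> coX Spin_data \<Longrightarrow> (\<Sum>j\<in>UNIV. m $ j) / 2 \<in> \<int>"
  by (simp_all add: SU_data_def Spin_data_def)

theorem proposition6p10:
  shows
    "is_level (Spin_data :: (complex ^ 'n::finite) torus_data) level_one \<and>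
     is_level (SU_data :: (complex ^ 'n) torus_data) level_one \<and>
     (\<exists>\<phi>. bundle_iso (Spin_data :: (complex ^ 'n) torus_data) L_Spin (looijenga level_one) \<phi> \<and>
          (Eu_Spin :: (complex \<times> (complex ^ 'n)) beta_expr) \<in> ell_sections Spin_data (int CARD('n)) L_Spin \<and>
          map_beta (\<phi> (cover Spin_data)) Eu_Spin = Eu_Spin) \<and>
     (\<exists>\<phi>. bundle_iso (SU_data :: (complex ^ 'n) torus_data)
            (pullback SU_to_U L_U) (looijenga level_one) \<phi> \<and>
          (Eu_SU :: (complex \<times> (complex ^ 'n)) beta_expr)
            \<in> ell_sections SU_data (int CARD('n)) (pullback SU_to_U L_U) \<and>
          map_beta (\<phi> (cover SU_data)) Eu_SU = Eu_SU) \<and>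
     (Eu_SU :: (complex \<times> (complex ^ 'n)) beta_expr)
       \<in> ell_sections SU_data (int CARD('n)) (looijenga level_one) \<and>
     (Eu_Spin :: (complex \<times> (complex ^ 'n)) beta_expr)
       \<in> ell_sections Spin_data (int CARD('n)) (looijenga level_one) \<and>
     positive_energy SU_data (vacuum_SU :: ('n mode set, complex ^ 'n) graded_rep) \<and>
     positive_energy Spin_data (vacuum_Spin :: ('n mode set, complex ^ 'n) graded_rep) \<and>
     (\<forall>x\<in>cover (SU_data :: (complex ^ 'n) torus_data).
        super_character vacuum_SU x = vacuum_product_SU x) \<and>
     (\<forall>x\<in>cover (Spin_data :: (complex ^ 'n) torus_data).
        super_character vacuum_Spin x = vacuum_product_Spin x) \<and>
     Eu_SU = Beta (- int CARD('n))
       (restrict (normalized_super_character vacuum_SU) (cover (SU_data :: (complex ^ 'n) torus_data))) \<and>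
     Eu_Spin = Beta (- int CARD('n))
       (restrict (normalized_super_character vacuum_Spin) (cover (Spin_data :: (complex ^ 'n) torus_data)))"
proof (intro conjI ballI)
  let ?Spin = "Spin_data :: (complex ^ 'n) torus_data" and ?SU = "SU_data :: (complex ^ 'n) torus_data"
  let ?L = "looijenga level_one :: (complex ^ 'n) multiplier"
  note Spin_theta = agree_looijenga[OF half_sum_Ints_Spin]
  note SU_theta = agree_looijenga[OF half_sum_Ints_SU]
  show "is_level ?Spin level_one" by (rule Spin.is_level_one[OF half_sum_Ints_Spin])
  show "is_level ?SU level_one" by (rule SU.is_level_one[OF half_sum_Ints_SU])
  have Spin_bundles: "line_bundle ?Spin ?L" "line_bundle ?Spin L_Spin"
    using Spin.line_bundle_agree[OF Spin.line_bundle_theta Spin_theta]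
      Spin.line_bundle_agree[OF _ agree_sym[OF L_Spin_agree]] by blast+
  have SU_bundles: "line_bundle ?SU ?L" "line_bundle ?SU (pullback SU_to_U L_U)"
    using SU.line_bundle_agree[OF SU.line_bundle_theta SU_theta]
      SU.line_bundle_agree[OF _ agree_sym[OF SU_L_U_agree]] by blast+
  show Spin_ell: "(Eu_Spin :: (complex \<times> (complex ^ 'n)) beta_expr) \<in> ell_sections ?Spin (int CARD('n)) ?L"
    unfolding Eu_Spin_alt by (rule Spin.Beta_sigma_ell_sections[OF Spin_theta])
  show SU_ell: "(Eu_SU :: (complex \<times> (complex ^ 'n)) beta_expr) \<in> ell_sections ?SU (int CARD('n)) ?L"
    unfolding Eu_SU_alt by (rule SU.Beta_sigma_ell_sections[OF SU_theta])
  have map_beta_id: "map_beta (\<lambda>f. f) e = e" for e :: "(complex \<times> (complex ^ 'n)) beta_expr"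
    by (cases e) (simp add: map_beta_def)
  \<comment> \<open>Both isomorphisms are the identity on functions.\<close>
  show "\<exists>\<phi>. bundle_iso ?Spin L_Spin ?L \<phi> \<and>
      (Eu_Spin :: (complex \<times> (complex ^ 'n)) beta_expr) \<in> ell_sections Spin_data (int CARD('n)) L_Spin \<and>
      map_beta (\<phi> (cover Spin_data)) Eu_Spin = Eu_Spin"
    using Spin.bundle_iso_agree[OF Spin_bundles(2,1) L_Spin_agree] Spin_ell
    unfolding Spin.ell_sections_agree[OF L_Spin_agree]
    by (intro exI[of _ "\<lambda>_ f. f"]) (simp add: map_beta_id)
  show "\<exists>\<phi>. bundle_iso ?SU (pullback SU_to_U L_U) ?L \<phi> \<and>
      (Eu_SU :: (complex \<times> (complex ^ 'n)) beta_expr)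
        \<in> ell_sections SU_data (int CARD('n)) (pullback SU_to_U L_U) \<and>
      map_beta (\<phi> (cover SU_data)) Eu_SU = Eu_SU"
    using SU.bundle_iso_agree[OF SU_bundles(2,1) SU_L_U_agree] SU_ell
    unfolding SU.ell_sections_agree[OF SU_L_U_agree]
    by (intro exI[of _ "\<lambda>_ f. f"]) (simp add: map_beta_id)
  show "positive_energy ?SU vacuum_SU" by (rule positive_energy_SU)
  show "positive_energy ?Spin vacuum_Spin" by (rule positive_energy_Spin)
  show "super_character vacuum_SU x = vacuum_product_SU x" if "x \<in> cover ?SU" for x
    using that by (rule super_character_SU)
  show "super_character vacuum_Spin x = vacuum_product_Spin x" if "x \<in> cover ?Spin" for x
    using that by (rule super_character_Spin)
  show "Eu_SU = Beta (- int CARD('n)) (restrict (normalized_super_character vacuum_SU) (cover ?SU))"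
    unfolding Eu_SU_def
    by (intro arg_cong[of _ _ "Beta _"] restrict_ext normalized_super_character_SU[symmetric])
  show "Eu_Spin = Beta (- int CARD('n)) (restrict (normalized_super_character vacuum_Spin) (cover ?Spin))"
    unfolding Eu_Spin_def
    by (intro arg_cong[of _ _ "Beta _"] restrict_ext normalized_super_character_Spin[symmetric])
qed

end
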